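(* Let $M$ be a connected closed manifold and let $g(t)$ be a solution of the Ricci flow $\frac{dg}{dt}=-2\,\mathrm{Ric}$ on $M$ for $t\in[t_0,t_1]$. Suppose that $\alpha:[t_0,t_1]\to P^\infty(M)$ is a solution of the backward heat equation $\frac{d\alpha}{dt}=-\nabla^2\alpha$. Write $\alpha(t)=\rho(t)\,d\mathrm{vol}_M$. Then $$\mathcal F=\int_M\left(|\nabla\log(\rho)|^2+R\right)\rho\,d\mathrm{vol}_M$$ is nondecreasing in $t$.
   Context: $P^\infty(M)$ is the set of probability measures on $M$ with a smooth positive density with respect to a Riemannian volume density. $R$ is scalar curvature, and $d\mathrm{vol}_M$, $\nabla$, norms and $R$ at time $t$ are those of $g(t)$. For $\mu=\rho\,d\mathrm{vol}_M$, $\nabla^2\mu$ means $(\nabla^2\rho)\,d\mathrm{vol}_M$; the equation for $\alpha$ is equivalent to $\frac{\partial\rho}{\partial t}=-\nabla^2\rho+R\rho$. *)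

theory Defs
  imports "HOL-Analysis.Analysis"
begin

section \<open>Smooth maps between Euclidean spaces\<close>

(* Derivatives are taken within S. For S open these are the ordinary derivatives; for
   S = {t0..t1} \<times> V with t0 < t1 and V open they are still unique, and smooth_on means smooth up to
   the end points of the time interval. *)

primrec Ck_on :: "nat \<Rightarrow> 'a::euclidean_space set \<Rightarrow> ('a \<Rightarrow> 'b::real_normed_vector) \<Rightarrow> bool" where
  "Ck_on 0 S f \<longleftrightarrow> continuous_on S f"
| "Ck_on (Suc k) S f \<longleftrightarrow>
     f differentiable_on S \<and> (\<forall>v. Ck_on k S (\<lambda>x. frechet_derivative f (at x within S) v))"

definition smooth_on :: "'a::euclidean_space set \<Rightarrow> ('a \<Rightarrow> 'b::real_normed_vector) \<Rightarrow> bool" where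
  "smooth_on S f \<longleftrightarrow> (\<forall>k. Ck_on k S f)"

definition partial :: "'n \<Rightarrow> (real ^ 'n \<Rightarrow> real) \<Rightarrow> real ^ 'n \<Rightarrow> real" where
  "partial i f x = frechet_derivative f (at x) (axis i 1)"


section \<open>Closed smooth manifolds\<close>

(* A chart is a pair (U, \<phi>); the values of \<phi> outside U are irrelevant. *)

type_synonym ('a, 'n) chart = "'a set \<times> ('a \<Rightarrow> real ^ 'n)"

abbreviation chart_dom :: "('a, 'n) chart \<Rightarrow> 'a set" where
  "chart_dom c \<equiv> fst c"

abbreviation chart_map :: "('a, 'n) chart \<Rightarrow> 'a \<Rightarrow> real ^ 'n" where
  "chart_map c \<equiv> snd c"

definition chart_img :: "('a, 'n) chart \<Rightarrow> (real ^ 'n) set" where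
  "chart_img c = chart_map c ` chart_dom c"

definition chart_inv :: "('a, 'n) chart \<Rightarrow> real ^ 'n \<Rightarrow> 'a" where
  "chart_inv c = inv_into (chart_dom c) (chart_map c)"

definition is_chart :: "'a topology \<Rightarrow> ('a, 'n::finite) chart \<Rightarrow> bool" where
  "is_chart X c \<longleftrightarrow>
     openin X (chart_dom c) \<and> open (chart_img c) \<and>
     homeomorphic_map (subtopology X (chart_dom c)) (top_of_set (chart_img c)) (chart_map c)"

definition transition :: "('a, 'n) chart \<Rightarrow> ('a, 'n) chart \<Rightarrow> real ^ 'n \<Rightarrow> real ^ 'n" where
  "transition c d = chart_map d \<circ> chart_inv c"

definition smooth_atlas :: "'a topology \<Rightarrow> ('a, 'n::finite) chart set \<Rightarrow> bool" where
  "smooth_atlas X A \<longleftrightarrow>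
     (\<forall>c\<in>A. is_chart X c) \<and> (\<Union>c\<in>A. chart_dom c) = topspace X \<and>
     (\<forall>c\<in>A. \<forall>d\<in>A. smooth_on (chart_map c ` (chart_dom c \<inter> chart_dom d)) (transition c d))"

(* Second countability follows from compactness. *)

definition closed_manifold :: "'a topology \<Rightarrow> ('a, 'n::finite) chart set \<Rightarrow> bool" where
  "closed_manifold X A \<longleftrightarrow> Hausdorff_space X \<and> compact_space X \<and> smooth_atlas X A"

definition chart_at :: "('a, 'n) chart set \<Rightarrow> 'a \<Rightarrow> ('a, 'n) chart" where
  "chart_at A p = (SOME c. c \<in> A \<and> p \<in> chart_dom c)"

definition smooth_fun :: "('a, 'n::finite) chart set \<Rightarrow> ('a \<Rightarrow> real) \<Rightarrow> bool" where
  "smooth_fun A f \<longleftrightarrow> (\<forall>c\<in>A. smooth_on (chart_img c) (f \<circ> chart_inv c))"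

definition smooth_fun_family ::
    "('a, 'n::finite) chart set \<Rightarrow> real \<Rightarrow> real \<Rightarrow> (real \<Rightarrow> 'a \<Rightarrow> real) \<Rightarrow> bool" where
  "smooth_fun_family A t0 t1 f \<longleftrightarrow>
     (\<forall>c\<in>A. smooth_on ({t0..t1} \<times> chart_img c) (\<lambda>(t, x). f t (chart_inv c x)))"


section \<open>Riemannian geometry in local coordinates\<close>

(* Throughout this section G is the matrix-valued function (g_ij) of the components of a metric in
   one coordinate system. *)

definition christoffel ::
    "(real ^ 'n \<Rightarrow> real ^ 'n ^ 'n) \<Rightarrow> 'n::finite \<Rightarrow> 'n \<Rightarrow> 'n \<Rightarrow> real ^ 'n \<Rightarrow> real" where
  "christoffel G k i j x =
     (\<Sum>l\<in>UNIV. matrix_inv (G x) $ k $ l *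
        (partial i (\<lambda>y. G y $ j $ l) x + partial j (\<lambda>y. G y $ i $ l) x
          - partial l (\<lambda>y. G y $ i $ j) x)) / 2"

(* coord_riemann G l k i j is the component R^l_kij with R(e_i, e_j) e_k = sum_l R^l_kij e_l, where
   R(Y, Z) = [nabla_Y, nabla_Z] - nabla_[Y,Z]. The contraction Ric(Y, Z) = tr (W |-> R(W, Y) Z) below
   is then positive on round spheres. *)

definition coord_riemann ::
    "(real ^ 'n \<Rightarrow> real ^ 'n ^ 'n) \<Rightarrow> 'n::finite \<Rightarrow> 'n \<Rightarrow> 'n \<Rightarrow> 'n \<Rightarrow> real ^ 'n \<Rightarrow> real" where
  "coord_riemann G l k i j x =
     partial i (christoffel G l j k) x - partial j (christoffel G l i k) x
     + (\<Sum>m\<in>UNIV. christoffel G l i m x * christoffel G m j k x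
                   - christoffel G l j m x * christoffel G m i k x)"

definition coord_ricci :: "(real ^ 'n \<Rightarrow> real ^ 'n ^ 'n) \<Rightarrow> real ^ 'n \<Rightarrow> real ^ 'n::finite ^ 'n" where
  "coord_ricci G x = (\<chi> j k. \<Sum>i\<in>UNIV. coord_riemann G i k i j x)"

definition coord_scalar_curvature ::
    "(real ^ 'n \<Rightarrow> real ^ 'n ^ 'n) \<Rightarrow> real ^ 'n::finite \<Rightarrow> real" where
  "coord_scalar_curvature G x =
     (\<Sum>i\<in>UNIV. \<Sum>j\<in>UNIV. matrix_inv (G x) $ i $ j * coord_ricci G x $ i $ j)"

definition coord_grad_norm_sq ::
    "(real ^ 'n \<Rightarrow> real ^ 'n ^ 'n) \<Rightarrow> (real ^ 'n \<Rightarrow> real) \<Rightarrow> real ^ 'n::finite \<Rightarrow> real" where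
  "coord_grad_norm_sq G u x =
     (\<Sum>i\<in>UNIV. \<Sum>j\<in>UNIV. matrix_inv (G x) $ i $ j * partial i u x * partial j u x)"

(* The metric trace of the covariant Hessian. *)

definition coord_laplacian ::
    "(real ^ 'n \<Rightarrow> real ^ 'n ^ 'n) \<Rightarrow> (real ^ 'n \<Rightarrow> real) \<Rightarrow> real ^ 'n::finite \<Rightarrow> real" where
  "coord_laplacian G u x =
     (\<Sum>i\<in>UNIV. \<Sum>j\<in>UNIV. matrix_inv (G x) $ i $ j *
        (partial i (partial j u) x - (\<Sum>k\<in>UNIV. christoffel G k i j x * partial k u x)))"


section \<open>Riemannian metrics on a manifold\<close>

(* A (0,2)-tensor field is given by its components in every chart of the atlas: T c x is the matrix
   of components in the chart c at the point with coordinates x. *)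

type_synonym ('a, 'n) tensor2 = "('a, 'n) chart \<Rightarrow> real ^ 'n \<Rightarrow> real ^ 'n ^ 'n"

definition tensor_transforms :: "('a, 'n::finite) chart set \<Rightarrow> ('a, 'n) tensor2 \<Rightarrow> bool" where
  "tensor_transforms A T \<longleftrightarrow>
     (\<forall>c\<in>A. \<forall>d\<in>A. \<forall>p\<in>chart_dom c \<inter> chart_dom d.
        let J = jacobian (transition c d) (at (chart_map c p))
        in T c (chart_map c p) = transpose J ** T d (chart_map d p) ** J)"

definition riemannian_metric :: "('a, 'n::finite) chart set \<Rightarrow> ('a, 'n) tensor2 \<Rightarrow> bool" where
  "riemannian_metric A g \<longleftrightarrow>
     tensor_transforms A g \<and>
     (\<forall>c\<in>A. smooth_on (chart_img c) (g c)) \<and>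
     (\<forall>c\<in>A. \<forall>x\<in>chart_img c.
        transpose (g c x) = g c x \<and> (\<forall>v. v \<noteq> 0 \<longrightarrow> 0 < v \<bullet> (g c x *v v)))"

(* The following three scalars do not depend on the chart around p. *)

definition scalar_curvature ::
    "('a, 'n::finite) chart set \<Rightarrow> ('a, 'n) tensor2 \<Rightarrow> 'a \<Rightarrow> real" where
  "scalar_curvature A g p =
     (let c = chart_at A p in coord_scalar_curvature (g c) (chart_map c p))"

definition grad_norm_sq ::
    "('a, 'n::finite) chart set \<Rightarrow> ('a, 'n) tensor2 \<Rightarrow> ('a \<Rightarrow> real) \<Rightarrow> 'a \<Rightarrow> real" where
  "grad_norm_sq A g f p =
     (let c = chart_at A p in coord_grad_norm_sq (g c) (f \<circ> chart_inv c) (chart_map c p))"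

definition laplacian ::
    "('a, 'n::finite) chart set \<Rightarrow> ('a, 'n) tensor2 \<Rightarrow> ('a \<Rightarrow> real) \<Rightarrow> 'a \<Rightarrow> real" where
  "laplacian A g f p =
     (let c = chart_at A p in coord_laplacian (g c) (f \<circ> chart_inv c) (chart_map c p))"

(* The Riemannian density is the Borel measure which reads sqrt (det g_ij) dx in every chart. *)

definition is_riemannian_volume ::
    "'a topology \<Rightarrow> ('a, 'n::finite) chart set \<Rightarrow> ('a, 'n) tensor2 \<Rightarrow> 'a measure \<Rightarrow> bool" where
  "is_riemannian_volume X A g \<nu> \<longleftrightarrow>
     space \<nu> = topspace X \<and>
     sets \<nu> = sigma_sets (topspace X) {U. openin X U} \<and>
     (\<forall>c\<in>A. \<forall>B\<in>sets \<nu>. B \<subseteq> chart_dom c \<longrightarrow>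
        emeasure \<nu> B = (\<integral>\<^sup>+x\<in>chart_map c ` B. ennreal (sqrt (det (g c x))) \<partial>lborel))"

definition riemannian_volume ::
    "'a topology \<Rightarrow> ('a, 'n::finite) chart set \<Rightarrow> ('a, 'n) tensor2 \<Rightarrow> 'a measure" where
  "riemannian_volume X A g = (THE \<nu>. is_riemannian_volume X A g \<nu>)"

definition P_infty :: "'a topology \<Rightarrow> ('a, 'n::finite) chart set \<Rightarrow> 'a measure set" where
  "P_infty X A = {\<mu>. emeasure \<mu> (space \<mu>) = 1 \<and>
     (\<exists>h \<sigma>. riemannian_metric A h \<and> smooth_fun A \<sigma> \<and> (\<forall>p\<in>topspace X. 0 < \<sigma> p) \<and>
       \<mu> = density (riemannian_volume X A h) (\<lambda>p. ennreal (\<sigma> p)))}"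


section \<open>Ricci flow, the backward heat equation and the F-functional\<close>

definition ricci_flow ::
    "('a, 'n::finite) chart set \<Rightarrow> real \<Rightarrow> real \<Rightarrow> (real \<Rightarrow> ('a, 'n) tensor2) \<Rightarrow> bool" where
  "ricci_flow A t0 t1 g \<longleftrightarrow>
     (\<forall>t\<in>{t0..t1}. riemannian_metric A (g t)) \<and>
     (\<forall>c\<in>A. smooth_on ({t0..t1} \<times> chart_img c) (\<lambda>(t, x). g t c x)) \<and>
     (\<forall>t\<in>{t0..t1}. \<forall>c\<in>A. \<forall>x\<in>chart_img c.
        ((\<lambda>s. g s c x) has_vector_derivative (- 2) *\<^sub>R coord_ricci (g t c) x)
          (at t within {t0..t1}))"

(* The density, with respect to Lebesgue measure in the coordinates of the chart c, of the signed
   measure whose density with respect to the Riemannian volume of g is f. *)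

definition coord_density ::
    "('a, 'n::finite) tensor2 \<Rightarrow> ('a \<Rightarrow> real) \<Rightarrow> ('a, 'n) chart \<Rightarrow> real ^ 'n \<Rightarrow> real" where
  "coord_density g f c x = f (chart_inv c x) * sqrt (det (g c x))"

(* For \<alpha> t = \<rho> t dvol(g t), this is d\<alpha>/dt = - (laplacian (\<rho> t)) dvol(g t), an equation between
   smooth signed measures, tested in charts on their densities with respect to the
   time-independent coordinate Lebesgue measure. Under Ricci flow the derivative of sqrt (det g) is
   - R sqrt (det g), which produces the zeroth order term of the equation satisfied by \<rho>. *)

definition backward_heat_flow ::
    "('a, 'n::finite) chart set \<Rightarrow> real \<Rightarrow> real \<Rightarrow> (real \<Rightarrow> ('a, 'n) tensor2) \<Rightarrow>
     (real \<Rightarrow> 'a \<Rightarrow> real) \<Rightarrow> bool" where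
  "backward_heat_flow A t0 t1 g \<rho> \<longleftrightarrow>
     smooth_fun_family A t0 t1 \<rho> \<and>
     (\<forall>t\<in>{t0..t1}. \<forall>c\<in>A. \<forall>x\<in>chart_img c.
        ((\<lambda>s. coord_density (g s) (\<rho> s) c x) has_real_derivative
           - coord_density (g t) (laplacian A (g t) (\<rho> t)) c x) (at t within {t0..t1}))"

definition F_functional ::
    "'a topology \<Rightarrow> ('a, 'n::finite) chart set \<Rightarrow> ('a, 'n) tensor2 \<Rightarrow> ('a \<Rightarrow> real) \<Rightarrow> real" where
  "F_functional X A g \<rho> =
     (\<integral>p. (grad_norm_sq A g (\<lambda>q. ln (\<rho> q)) p + scalar_curvature A g p) * \<rho> p
        \<partial>riemannian_volume X A g)"

end

theory Submission
  imports Defs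
begin

text \<open>
  Write \<open>f = - ln \<rho>\<close>. Since \<open>\<Delta> \<rho> = (|\<nabla> f|\<^sup>2 - \<Delta> f) \<rho>\<close> has integral zero, the functional is the integral of
  \<open>w = (2 \<Delta> f - |\<nabla> f|\<^sup>2 + R) \<rho>\<close>. Perelman's pointwise identity states
  \<open>\<partial>w/\<partial>t - R w = 2 |Ric + Hess f|\<^sup>2 \<rho> - \<Delta> w\<close>. As \<open>d vol\<close> evolves by \<open>- R d vol\<close>, the left hand side is the
  time derivative of the density \<open>w d vol\<close>, and the Laplacian on the right integrates to zero.

  The identity is proved in a commutative ring with commuting derivations, instantiated by germs of
  smooth functions in one chart of space-time. A partition of unity transfers the result to the
  manifold; the cutoffs need only be once continuously differentiable.
\<close>

section \<open>Levi-Civita calculus over a ring with derivations\<close>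

text \<open>With partial derivatives of functions, tensor calculus would carry a differentiability
  condition through every step. In a ring with commuting derivations each identity is a
  rearrangement of finite sums. Germs at an interior point of the space-time slab form such a ring,
  but one with zero divisors and without division: \<open>2\<close> is cancelled by
  \<open>two_cancel\<close>, and the inverse metric and the reciprocals of the volume density and of
  \<rho> enter as elements with known products. Since germs are taken at interior points, the sign
  of the derivative is found for t0 < t < t1, and continuity supplies the end points. What must hold
  at the end times too, such as the formula for \<Delta> \<rho>, is computed with derivatives within
  the slab. The geometry is defined through some chart around each point, while the divergence
  theorem works in one fixed chart; hence the proofs that \<Delta> u, the gradient pairing and R do
  not depend on the chart. A cutoff \<eta> enters only through div (\<eta> grad y) = \<eta> \<Delta>
  y + <d \<eta>, d y>, which differentiates it once; this is why one derivative suffices.\<close>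

abbreviation usum :: "('n::finite \<Rightarrow> 'r::comm_monoid_add) \<Rightarrow> 'r" (binder "SS " 10) where
  "usum F \<equiv> sum F UNIV"

lemma usum_swap: "(SS i. SS j. F i j) = (SS j. SS i. F i j)"
  by (rule sum.swap)

lemma usum2: "(\<And>i j. F i j = G j i) \<Longrightarrow> (SS i. SS j. F i j) = (SS i. SS j. G i j)"
  by (subst usum_swap) simp

text \<open>The digits in these names give the order in which the indices of \<open>F\<close> reach
  \<open>G\<close>. A reindexing of a triple sum is thereby reduced to an identity between summands,
  which \<open>mult_ac\<close> and the symmetries can settle.\<close>

lemma usum3_132: "(\<And>i j k. F i j k = G i k j) \<Longrightarrow> (SS i. SS j. SS k. F i j k) = (SS i. SS j. SS k. G i j k)"
  by (rule sum.cong[OF refl]) (rule usum2)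

lemma usum3_213: "(\<And>i j k. F i j k = G j i k) \<Longrightarrow> (SS i. SS j. SS k. F i j k) = (SS i. SS j. SS k. G i j k)"
  by (rule usum2) simp

lemma usum3_231: "(\<And>i j k. F i j k = G j k i) \<Longrightarrow> (SS i. SS j. SS k. F i j k) = (SS i. SS j. SS k. G i j k)"
  by (rule trans[OF usum3_213 usum3_132]) (rule refl | simp)+

lemma usum3_312: "(\<And>i j k. F i j k = G k i j) \<Longrightarrow> (SS i. SS j. SS k. F i j k) = (SS i. SS j. SS k. G i j k)"
  by (rule trans[OF usum3_132 usum3_213]) (rule refl | simp)+

lemma usum3_321: "(\<And>i j k. F i j k = G k j i) \<Longrightarrow> (SS i. SS j. SS k. F i j k) = (SS i. SS j. SS k. G i j k)"
  by (rule trans[OF usum3_213 usum3_312]) (rule refl | simp)+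

lemma usum_delta [simp]:
  fixes F :: "'n::finite \<Rightarrow> 'r::comm_ring_1"
  shows "(SS k. (if i = k then 1 else 0) * F k) = F i"
    and "(SS k. (if k = i then 1 else 0) * F k) = F i"
    and "(SS k. F k * (if i = k then 1 else 0)) = F i"
    and "(SS k. F k * (if k = i then 1 else 0)) = F i"
  by (simp_all add: if_distrib[of "\<lambda>x. x * _"] if_distrib[of "\<lambda>x. _ * x"] cong: if_cong)

section \<open>Derivations of a commutative ring and their action on matrices\<close>

definition derivation :: "('r::comm_ring_1 \<Rightarrow> 'r) \<Rightarrow> bool" where
  "derivation d \<longleftrightarrow> (\<forall>a b. d (a + b) = d a + d b \<and> d (a * b) = d a * b + a * d b)"

lemma of_nat_derivation:
  assumes "derivation d" shows "d (of_nat k) = 0"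
proof -
  have a: "d (a + b) = d a + d b" "d (a * b) = d a * b + a * d b" for a b
    using assms by (auto simp: derivation_def)
  have "d 0 = 0" "d 1 = 0" using a(1)[of 0 0] a(2)[of 1 1] by simp_all
  then show ?thesis by (induction k) (auto simp: a)
qed

lemma derivationD:
  assumes "derivation d"
  shows "d (a + b) = d a + d b" "d (a * b) = d a * b + a * d b" "d 0 = 0" "d 1 = 0"
    "d (- a) = - d a" "d (a - b) = d a - d b" "d (sum F I) = (\<Sum>i\<in>I. d (F i))"
    "d (numeral n) = 0" "d (if P then 1 else 0) = 0"
proof -
  have a: "d (a + b) = d a + d b" "d (a * b) = d a * b + a * d b" for a b
    using assms by (auto simp: derivation_def)
  show "d (a + b) = d a + d b" "d (a * b) = d a * b + a * d b" by (fact a)+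
  show 0: "d 0 = 0" using a(1)[of 0 0] by simp
  show 1: "d 1 = 0" using a(2)[of 1 1] by simp
  have m: "d (- a) = - d a" for a using a(1)[of a "-a"] 0 by (simp add: minus_unique)
  show "d (- a) = - d a" by (fact m)
  show "d (a - b) = d a - d b" using a(1)[of a "-b"] m by simp
  show "d (sum F I) = (\<Sum>i\<in>I. d (F i))"
    by (induction I rule: infinite_finite_induct) (auto simp: 0 a)
  have "d (of_nat k) = 0" for k by (induction k) (auto simp: 0 1 a)
  from this[of "numeral n"] show "d (numeral n) = 0" by simp
  show "d (if P then 1 else 0) = 0" using 0 1 by simp
qed

definition dmat :: "('r \<Rightarrow> 'r) \<Rightarrow> 'r^'n^'n \<Rightarrow> 'r::comm_ring_1^'n::finite^'n" where
  "dmat d A = (\<chi> i j. d (A $ i $ j))"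

lemma dmat_simps:
  assumes "derivation d"
  shows "dmat d (A + B) = dmat d A + dmat d B" "dmat d (A - B) = dmat d A - dmat d B"
    "dmat d (A ** B) = dmat d A ** B + A ** dmat d B" "dmat d (- A) = - dmat d A"
    "dmat d (transpose A) = transpose (dmat d A)" "dmat d (mat 1) = 0"
  by (simp_all add: dmat_def vec_eq_iff matrix_matrix_mult_def sum.distrib transpose_def mat_def
      derivationD[OF assms])

lemma mat_simps:
  fixes A B C :: "'r::comm_ring_1^'n::finite^'n"
  shows "(A - B) ** C = A ** C - B ** C" "A ** (B - C) = A ** B - A ** C"
    "(- A) ** B = - (A ** B)" "A ** (- B) = - (A ** B)"
    "(A + B) ** C = A ** C + B ** C" "A ** (B + C) = A ** B + A ** C"
    "A ** (B ** C) = A ** B ** C" "transpose (A ** B) = transpose B ** transpose A"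
    "transpose (A + B) = transpose A + transpose B" "transpose (A - B) = transpose A - transpose B"
    "transpose (transpose A) = A"
  by (simp_all add: vec_eq_iff matrix_matrix_mult_def algebra_simps sum_subtractf sum.distrib
      sum_negf transpose_def del: matrix_mul_assoc) (simp add: sum_distrib_left sum_distrib_right mult_ac, auto intro: usum2)

text \<open>The index functions are components with respect to a commuting frame: \<open>g\<close> is a metric, \<open>h\<close> its
  inverse and \<open>\<Gamma> k i j\<close> the Christoffel symbol with upper index \<open>k\<close>.\<close>

locale levi_civita =
  fixes D :: "'n::finite \<Rightarrow> 'r::comm_ring_1 \<Rightarrow> 'r"
    and g h :: "'n \<Rightarrow> 'n \<Rightarrow> 'r" and \<Gamma> :: "'n \<Rightarrow> 'n \<Rightarrow> 'n \<Rightarrow> 'r"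
  assumes D_deriv: "derivation (D i)"
    and D_comm: "D i (D j a) = D j (D i a)"
    and two_cancel: "a + a = 0 \<Longrightarrow> a = (0::'r)"
    and g_sym: "g i j = g j i" and h_sym: "h i j = h j i"
    and hg: "(SS k. h i k * g k j) = (if i = j then 1 else 0)"
    and \<Gamma>_sym: "\<Gamma> k i j = \<Gamma> k j i"
    and Dg: "D k (g i j) = (SS m. \<Gamma> m k i * g m j + \<Gamma> m k j * g m i)"
begin

lemmas D_simps = derivationD[OF D_deriv]
lemmas D_sum = derivationD(7)[OF D_deriv]
lemmas dmat_D = dmat_simps[OF D_deriv]

lemma two_cancel': "a + a = b + b \<Longrightarrow> a = (b::'r)"
  using two_cancel[of "a - b"] by (simp add: algebra_simps)

definition "gm = (\<chi> i j. g i j)"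
definition "hm = (\<chi> i j. h i j)"
text \<open>The connection matrix in direction \<open>m\<close>: a vector field v, as a column, has
  covariant derivative D m v + gam m v. In matrix form the curvature identities become identities in
  a noncommutative ring.\<close>

definition "gam m = (\<chi> l j. \<Gamma> l m j)"

lemma hm_gm: "hm ** gm = mat 1"
  by (simp add: vec_eq_iff matrix_matrix_mult_def hm_def gm_def mat_def hg)

lemma sym_m: "transpose gm = gm" "transpose hm = hm"
  by (simp_all add: vec_eq_iff transpose_def gm_def hm_def g_sym[of _ i for i] h_sym[of _ i for i])

lemma gm_hm: "gm ** hm = mat 1"
  using arg_cong[OF hm_gm, of transpose] by (simp add: mat_simps sym_m)

lemma D_gm: "dmat (D i) gm = transpose (gam i) ** gm + gm ** gam i"
  by (simp add: vec_eq_iff matrix_matrix_mult_def dmat_def gm_def gam_def transpose_def Dg sum.distrib)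
     (metis (no_types, lifting) g_sym mult.commute sum.cong)

text \<open>Differentiate \<open>hm ** gm = mat 1\<close>, insert \<open>D_gm\<close>, and cancel
  \<open>gm\<close> by multiplying with \<open>hm\<close> from the right. It says that the inverse
  metric is parallel.\<close>

lemma D_hm: "dmat (D i) hm = - (hm ** transpose (gam i)) - gam i ** hm"
proof -
  have "dmat (D i) hm ** gm + hm ** (transpose (gam i) ** gm + gm ** gam i) = 0"
    using arg_cong[OF hm_gm, of "dmat (D i)"] by (simp add: dmat_D D_gm)
  then have "(dmat (D i) hm ** gm + hm ** (transpose (gam i) ** gm + gm ** gam i)) ** hm = 0 ** hm"
    by simp
  then have "dmat (D i) hm + hm ** transpose (gam i) + gam i ** hm = 0"
    by (simp add: mat_simps hm_gm add.assoc) (simp add: gm_hm flip: matrix_mul_assoc)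
  then show ?thesis by (simp add: algebra_simps eq_neg_iff_add_eq_0)
qed

lemma D_h: "D k (h i j) = - (SS m. \<Gamma> i k m * h m j + \<Gamma> j k m * h m i)"
  using arg_cong[OF D_hm[of k], of "\<lambda>A. A $ i $ j"]
  by (simp add: matrix_matrix_mult_def dmat_def hm_def gam_def transpose_def sum.distrib h_sym[of i]
      mult.commute)

text \<open>The commutator of D i + gam i and D j + gam j, that is, the matrix of R(e_i, e_j); the
  entry in row l and column k is R^l_kij.\<close>

definition "curv i j = dmat (D i) (gam j) - dmat (D j) (gam i) + gam i ** gam j - gam j ** gam i"

lemma dmat_D_comm: "dmat (D i) (dmat (D j) A) = dmat (D j) (dmat (D i) A)"
  by (simp add: dmat_def D_comm)

text \<open>Two derivatives of the metric, expanded by metric compatibility, leave exactly these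
  curvature terms after antisymmetrisation in i and j, and the derivations commute.\<close>

lemma curv_lowered_antisym: "gm ** curv i j + transpose (curv i j) ** gm = 0"
proof -
  have "dmat (D i) (dmat (D j) gm) - dmat (D j) (dmat (D i) gm) = 0"
    by (simp add: dmat_D_comm)
  then show ?thesis
    by (simp add: D_gm dmat_D curv_def mat_simps algebra_simps)
qed

text \<open>Curvature with its second matrix index raised. It is antisymmetric in the lower pair and
  in the upper pair, and every trace of it is plus or minus the Ricci tensor with one index
  raised.\<close>

definition "B i j = curv i j ** hm"

lemma B_antisym: "transpose (B i j) = - B i j"
proof -
  have "hm ** (gm ** curv i j + transpose (curv i j) ** gm) ** hm = 0"
    by (simp add: curv_lowered_antisym)
  then have "curv i j ** hm + hm ** transpose (curv i j) = 0"
    by (simp add: mat_simps hm_gm) (simp add: gm_hm flip: matrix_mul_assoc)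
  then show ?thesis by (simp add: B_def mat_simps sym_m eq_neg_iff_add_eq_0 add.commute)
qed

lemma curv_swap: "curv i j = - curv j i"
  by (simp add: curv_def)

lemma B_swap: "B i j = - B j i"
  by (simp add: B_def curv_swap[of i j] mat_simps)

text \<open>The Jacobi identity for the operators D i + gam i. The Christoffel terms that a full
  covariant derivative would attach to the form indices are left out, because they cancel in the
  cyclic sum by the symmetry of \<Gamma>.\<close>

lemma curv_bianchi:
  "(dmat (D m) (curv i j) + gam m ** curv i j - curv i j ** gam m)
   + (dmat (D i) (curv j m) + gam i ** curv j m - curv j m ** gam i)
   + (dmat (D j) (curv m i) + gam j ** curv m i - curv m i ** gam j) = 0"
  by (simp add: curv_def dmat_D mat_simps dmat_D_comm[of m] dmat_D_comm[of j i] algebra_simps)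

text \<open>Multiply the identity for \<open>curv\<close> by \<open>hm\<close>. As \<open>hm\<close>
  is parallel, the commutator terms on the right turn into the connection terms of the raised
  index.\<close>

lemma B_bianchi:
  "(dmat (D m) (B i j) + gam m ** B i j + B i j ** transpose (gam m))
   + (dmat (D i) (B j m) + gam i ** B j m + B j m ** transpose (gam i))
   + (dmat (D j) (B m i) + gam j ** B m i + B m i ** transpose (gam j)) = 0" (is "?L = 0")
proof -
  have "?L = ((dmat (D m) (curv i j) + gam m ** curv i j - curv i j ** gam m)
   + (dmat (D i) (curv j m) + gam i ** curv j m - curv j m ** gam i)
   + (dmat (D j) (curv m i) + gam j ** curv m i - curv m i ** gam j)) ** hm"
    by (simp add: B_def dmat_D D_hm mat_simps algebra_simps)
  then show ?thesis by (simp add: curv_bianchi)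
qed

section \<open>Contractions, divergences, and second covariant derivatives\<close>

definition "Ric j k = (SS i. curv i j $ i $ k)"
definition "Scal = (SS i. SS j. h i j * Ric i j)"

definition "up T i j = (SS a. h i a * T a j)"
definition "Div X = (SS i. D i (X i)) + (SS i. SS m. \<Gamma> m m i * X i)"
definition "grad u i = (SS j. h i j * D j u)"
definition "hess u i j = D i (D j u) - (SS k. \<Gamma> k i j * D k u)"
definition "Lap u = (SS i. SS j. h i j * hess u i j)"
text \<open>The covariant divergence \<nabla>_i M^i_a of a tensor whose first index is upper and
  whose second is lower.\<close>

definition "DivM M a = (SS i. D i (M i a)) + (SS i. SS l. \<Gamma> l l i * M i a) - (SS l. SS i. \<Gamma> l i a * M i l)"
definition "cov i T j k = D i (T j k) - (SS m. \<Gamma> m i j * T m k) - (SS m. \<Gamma> m i k * T j m)"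

lemma hess_sym: "hess u i j = hess u j i"
  by (simp add: hess_def D_comm[of i j] \<Gamma>_sym[of _ i j])

lemma Lap_div: "Lap u = Div (grad u)"
proof -
  have "D i (h i j * D j u) = h i j * D i (D j u) - (SS m. \<Gamma> i i m * h m j * D j u)
      - (SS m. \<Gamma> j i m * h m i * D j u)" for i j
    by (simp add: D_simps D_h algebra_simps sum.distrib sum_distrib_left sum_distrib_right)
  then have "(SS i. D i (grad u i)) = (SS i. SS j. h i j * D i (D j u))
     - (SS i. SS j. SS m. \<Gamma> i i m * h m j * D j u) - (SS i. SS j. SS m. \<Gamma> j i m * h m i * D j u)"
    by (simp add: grad_def D_sum sum_subtractf sum.distrib)
  moreover have "(SS i. SS j. SS m. \<Gamma> i i m * h m j * D j u) = (SS i. SS m. \<Gamma> m m i * grad u i)"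
    by (simp add: grad_def sum_distrib_left) (rule usum3_312, simp add: mult_ac)
  moreover have "(SS i. SS j. SS m. \<Gamma> j i m * h m i * D j u) = (SS i. SS j. SS k. h i j * (\<Gamma> k i j * D k u))"
    by (rule usum3_132) (simp add: mult_ac h_sym)
  ultimately show ?thesis
    by (simp add: Lap_def Div_def hess_def algebra_simps sum_subtractf sum_distrib_left)
qed

lemma DivM_up:
  assumes "\<And>i j. T i j = T j i"
  shows "DivM (up T) a = (SS i. SS j. h i j * cov i T j a)"
proof -
  have "D i (h i j * T j a) = h i j * D i (T j a) - (SS m. \<Gamma> i i m * h m j * T j a)
      - (SS m. \<Gamma> j i m * h m i * T j a)" for i j
    by (simp add: D_simps D_h algebra_simps sum.distrib sum_distrib_left sum_distrib_right)
  then have "(SS i. D i (up T i a)) = (SS i. SS j. h i j * D i (T j a))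
     - (SS i. SS j. SS m. \<Gamma> i i m * h m j * T j a) - (SS i. SS j. SS m. \<Gamma> j i m * h m i * T j a)"
    by (simp add: up_def D_sum sum_subtractf sum.distrib)
  moreover have "(SS i. SS j. SS m. \<Gamma> i i m * h m j * T j a) = (SS i. SS l. \<Gamma> l l i * up T i a)"
    by (simp add: up_def sum_distrib_left) (rule usum3_312, simp add: mult_ac)
  moreover have "(SS i. SS j. SS m. \<Gamma> j i m * h m i * T j a) = (SS i. SS j. SS m. h i j * (\<Gamma> m i j * T m a))"
    by (rule usum3_132) (simp add: mult_ac h_sym)
  moreover have "(SS l. SS i. \<Gamma> l i a * up T i l) = (SS i. SS j. SS m. h i j * (\<Gamma> m i a * T j m))"
    by (simp add: up_def sum_distrib_left) (rule usum3_231, simp add: mult_ac)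
  ultimately show ?thesis
    by (simp add: DivM_def cov_def algebra_simps sum_subtractf sum_distrib_left sum.distrib)
qed

text \<open>The inverse metric is parallel: the Christoffel terms from differentiating
  \<open>h\<close> are those that complete the derivative of \<open>T\<close> to a covariant
  one.\<close>

lemma D_trace: "D a (SS i. SS j. h i j * T i j) = (SS i. SS j. h i j * cov a T i j)"
proof -
  have "D a (h i j * T i j) = h i j * D a (T i j) - (SS m. \<Gamma> i a m * h m j * T i j)
      - (SS m. \<Gamma> j a m * h m i * T i j)" for i j
    by (simp add: D_simps D_h algebra_simps sum.distrib sum_distrib_left sum_distrib_right)
  then have "D a (SS i. SS j. h i j * T i j) = (SS i. SS j. h i j * D a (T i j))
     - (SS i. SS j. SS m. \<Gamma> i a m * h m j * T i j) - (SS i. SS j. SS m. \<Gamma> j a m * h m i * T i j)"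
    by (simp add: D_sum sum_subtractf sum.distrib)
  moreover have "(SS i. SS j. SS m. \<Gamma> i a m * h m j * T i j) = (SS i. SS j. SS m. h i j * (\<Gamma> m a i * T m j))"
    by (rule usum3_321) (simp add: mult_ac)
  moreover have "(SS i. SS j. SS m. \<Gamma> j a m * h m i * T i j) = (SS i. SS j. SS m. h i j * (\<Gamma> m a j * T i m))"
    by (rule usum3_132) (simp add: mult_ac h_sym)
  ultimately show ?thesis
    by (simp add: cov_def algebra_simps sum_subtractf sum_distrib_left sum.distrib)
qed

text \<open>Third derivatives of u and all terms symmetric in i and j drop out of the difference.
  What remains is the curvature acting on the covector D u.\<close>

lemma ricci_identity:
  "cov i (hess u) j k - cov j (hess u) i k = - (SS l. curv i j $ l $ k * D l u)"
proof -
  have 1: "cov i (hess u) j k = D i (D j (D k u))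
     - (SS l. D i (\<Gamma> l j k) * D l u) - (SS l. \<Gamma> l j k * D i (D l u))
     - (SS m. \<Gamma> m i j * hess u m k) - (SS m. \<Gamma> m i k * D j (D m u))
     + (SS m. SS l. \<Gamma> m i k * \<Gamma> l j m * D l u)" for i j
    by (simp add: cov_def hess_def D_simps algebra_simps sum.distrib sum_subtractf sum_distrib_left)
  have 2: "(SS l. curv i j $ l $ k * D l u) = (SS l. D i (\<Gamma> l j k) * D l u) - (SS l. D j (\<Gamma> l i k) * D l u)
    + (SS m. SS l. \<Gamma> m j k * \<Gamma> l i m * D l u) - (SS m. SS l. \<Gamma> m i k * \<Gamma> l j m * D l u)"
    apply (simp add: curv_def gam_def dmat_def matrix_matrix_mult_def algebra_simps sum.distrib sum_subtractf
       sum_distrib_left)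
    apply (subst usum_swap[of "\<lambda>m l. D l u * (\<Gamma> m j k * \<Gamma> l i m)"])
    apply (subst usum_swap[of "\<lambda>m l. D l u * (\<Gamma> m i k * \<Gamma> l j m)"])
    apply (simp add: mult_ac)
    done
  show ?thesis
    unfolding 1 2 by (simp add: D_comm[of i j] \<Gamma>_sym[of _ i j])
qed


section \<open>The contracted Bianchi identity, and the divergence of a Hessian\<close>

definition "S = up Ric"

lemma Ric_B: "(SS l. B l j $ l $ k) = (SS a. h k a * Ric j a)"
proof -
  have "(SS l. B l j $ l $ k) = (SS l. SS a. curv l j $ l $ a * h a k)"
    by (simp add: B_def matrix_matrix_mult_def hm_def)
  also have "\<dots> = (SS a. h k a * Ric j a)"
    by (subst usum_swap) (simp add: Ric_def sum_distrib_left sum_distrib_right mult_ac h_sym[of k])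
  finally show ?thesis .
qed

lemma div_B: "(SS i. B i a $ l $ i) = - (SS k. h l k * Ric a k)"
proof -
  have "B i a $ l $ i = - (B i a $ i $ l)" for i
    using arg_cong[OF B_antisym[of i a], of "\<lambda>A. A $ i $ l"] by (simp add: transpose_def)
  then show ?thesis by (simp add: sum_negf Ric_B)
qed

text \<open>Take the double trace of \<open>B_bianchi\<close> over l and j. Two of the three cyclic
  terms become the divergence of the Ricci tensor, the middle one minus the derivative of its trace.
  \<open>S'\<close> contracts the second index of \<open>Ric\<close>, because this is what the
  traces of \<open>B\<close> produce; it agrees with \<open>S\<close> once \<open>Ric\<close> is
  known to be symmetric.\<close>

lemma contracted_bianchi_aux:
  defines "S' \<equiv> \<lambda>l i. (SS a. h l a * Ric i a)"
  shows "DivM S' i + DivM S' i = D i (SS j. S' j j)"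
proof -
  have B1: "(SS j. B i j $ l $ j) = S' l i" for i l
    using div_B[of i l] by (simp add: S'_def B_swap[of i] sum_negf)
  have B2: "(SS l. B l j $ l $ k) = S' k j" for k j
    by (simp add: Ric_B S'_def)
  have comp: "(D l (B i j $ l $ j) + (SS a. \<Gamma> l l a * B i j $ a $ j) + (SS a. B i j $ l $ a * \<Gamma> j l a))
     + (D i (B j l $ l $ j) + (SS a. \<Gamma> l i a * B j l $ a $ j) + (SS a. B j l $ l $ a * \<Gamma> j i a))
     + (D j (B l i $ l $ j) + (SS a. \<Gamma> l j a * B l i $ a $ j) + (SS a. B l i $ l $ a * \<Gamma> j j a)) = 0" for l j
    using arg_cong[OF B_bianchi[of l i j], of "\<lambda>A. A $ l $ j"]
    by (simp add: dmat_def matrix_matrix_mult_def transpose_def gam_def)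
  have "(SS l. SS j. (D l (B i j $ l $ j) + (SS a. \<Gamma> l l a * B i j $ a $ j) + (SS a. B i j $ l $ a * \<Gamma> j l a))
     + (D i (B j l $ l $ j) + (SS a. \<Gamma> l i a * B j l $ a $ j) + (SS a. B j l $ l $ a * \<Gamma> j i a))
     + (D j (B l i $ l $ j) + (SS a. \<Gamma> l j a * B l i $ a $ j) + (SS a. B l i $ l $ a * \<Gamma> j j a))) = 0"
    by (simp add: comp)
  then have sum0: "(SS l. SS j. D l (B i j $ l $ j)) + (SS l. SS j. SS a. \<Gamma> l l a * B i j $ a $ j)
     + (SS l. SS j. SS a. B i j $ l $ a * \<Gamma> j l a)
     + ((SS l. SS j. D i (B j l $ l $ j)) + (SS l. SS j. SS a. \<Gamma> l i a * B j l $ a $ j)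
     + (SS l. SS j. SS a. B j l $ l $ a * \<Gamma> j i a))
     + ((SS l. SS j. D j (B l i $ l $ j)) + (SS l. SS j. SS a. \<Gamma> l j a * B l i $ a $ j)
     + (SS l. SS j. SS a. B l i $ l $ a * \<Gamma> j j a)) = 0"
    by (simp add: sum.distrib)
  have Bt: "B i j $ a $ b = - (B i j $ b $ a)" for i j a b
    using arg_cong[OF B_antisym[of i j], of "\<lambda>A. A $ b $ a"] by (simp add: transpose_def)
  have Bs: "B i j $ a $ b = - (B j i $ a $ b)" for i j a b
    by (subst B_swap) simp
  have B3: "(SS j. B j l $ a $ j) = - S' a l" for l a
    by (simp add: div_B S'_def)
  have B4: "(SS l. B j l $ l $ a) = - S' a j" for j a
    unfolding B2[symmetric] sum_negf[symmetric] by (intro sum.cong refl Bs)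
  have t1: "(SS l. SS j. D l (B i j $ l $ j)) = (SS l. D l (S' l i))"
    by (simp add: B1 flip: D_sum)
  have t2: "(SS l. SS j. SS a. \<Gamma> l l a * B i j $ a $ j) = (SS a. SS l. \<Gamma> l l a * S' a i)"
    by (subst (2) usum_swap, subst usum_swap) (simp add: B1 flip: sum_distrib_left)
  \<comment> \<open>This triple sum is the negative of the one in the third group that is left
    unevaluated, so the two cancel in \<open>sum0\<close>: \<open>B\<close> changes sign when its
    lower indices are swapped, \<Gamma> does not.\<close>
  have t3: "(SS l. SS j. SS a. B i j $ l $ a * \<Gamma> j l a) = - (SS l. SS j. SS a. \<Gamma> l j a * B l i $ a $ j)"
  proof -
    have "B i j $ l $ a * \<Gamma> j l a = - (\<Gamma> j a l * B j i $ l $ a)" for l j a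
      by (simp add: Bs[of i j] \<Gamma>_sym[of j l a])
    then have "(SS l. SS j. SS a. B i j $ l $ a * \<Gamma> j l a) = (SS l. SS j. SS a. - (\<Gamma> l j a * B l i $ a $ j))"
      by (rule usum3_231)
    then show ?thesis by (simp add: sum_negf)
  qed
  have t4: "(SS l. SS j. D i (B j l $ l $ j)) = - D i (SS j. S' j j)"
  proof -
    have "(SS l. SS j. D i (B j l $ l $ j)) = D i (SS l. SS j. B j l $ l $ j)"
      by (simp add: D_sum)
    also have "(SS l. SS j. B j l $ l $ j) = - (SS l. SS j. B j l $ j $ l)"
      unfolding sum_negf[symmetric] by (intro sum.cong refl Bt)
    finally show ?thesis by (simp add: B2 D_simps(5))
  qed
  have t5: "(SS l. SS j. SS a. \<Gamma> l i a * B j l $ a $ j) = - (SS l. SS a. \<Gamma> l i a * S' a l)"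
  proof -
    have "(SS l. SS j. SS a. \<Gamma> l i a * B j l $ a $ j) = (SS l. SS a. \<Gamma> l i a * (SS j. B j l $ a $ j))"
      unfolding sum_distrib_left by (rule usum3_132) simp
    then show ?thesis by (simp add: B3 sum_negf)
  qed
  have t6: "(SS l. SS j. SS a. B j l $ l $ a * \<Gamma> j i a) = - (SS l. SS a. \<Gamma> l i a * S' a l)"
  proof -
    have "(SS l. SS j. SS a. B j l $ l $ a * \<Gamma> j i a) = (SS j. SS a. (SS l. B j l $ l $ a) * \<Gamma> j i a)"
      unfolding sum_distrib_right by (rule usum3_231) simp
    then show ?thesis by (simp add: B4 sum_negf mult_ac)
  qed
  have t7: "(SS l. SS j. D j (B l i $ l $ j)) = (SS j. D j (S' j i))"
    by (subst usum_swap) (simp add: B2 flip: D_sum)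
  have t9: "(SS l. SS j. SS a. B l i $ l $ a * \<Gamma> j j a) = (SS a. SS l. \<Gamma> l l a * S' a i)"
  proof -
    have "(SS l. SS j. SS a. B l i $ l $ a * \<Gamma> j j a) = (SS a. SS j. (SS l. B l i $ l $ a) * \<Gamma> j j a)"
      unfolding sum_distrib_right by (rule usum3_321) simp
    then show ?thesis by (simp add: B2 mult_ac)
  qed
  show ?thesis
    using sum0 unfolding t1 t2 t3 t4 t5 t6 t7 t9 by (simp add: DivM_def algebra_simps \<Gamma>_sym[of _ i])
qed

lemma cov_grad: "D i (grad u b) + (SS a. \<Gamma> b i a * grad u a) = (SS j. h b j * hess u i j)"
proof -
  have "D i (h b j * D j u) = h b j * D i (D j u) - (SS m. \<Gamma> b i m * h m j * D j u)
      - (SS m. \<Gamma> j i m * h m b * D j u)" for j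
    by (simp add: D_simps D_h algebra_simps sum.distrib sum_distrib_left sum_distrib_right)
  then have "D i (grad u b) = (SS j. h b j * D i (D j u))
     - (SS j. SS m. \<Gamma> b i m * h m j * D j u) - (SS j. SS m. \<Gamma> j i m * h m b * D j u)"
    by (simp add: grad_def D_sum sum_subtractf sum.distrib)
  moreover have "(SS j. SS m. \<Gamma> b i m * h m j * D j u) = (SS a. \<Gamma> b i a * grad u a)"
    by (subst usum_swap) (simp add: grad_def sum_distrib_left mult_ac)
  moreover have "(SS j. SS m. \<Gamma> j i m * h m b * D j u) = (SS j. SS k. h b j * (\<Gamma> k i j * D k u))"
    by (rule usum2) (simp add: mult_ac h_sym)
  ultimately show ?thesis
    by (simp add: hess_def algebra_simps sum_subtractf sum_distrib_left)
qed

lemma Div_contract: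
  "Div (\<lambda>i. SS a. M i a * X a) = (SS a. DivM M a * X a) + (SS i. SS b. M i b * (D i (X b) + (SS a. \<Gamma> b i a * X a)))"
proof -
  have 1: "(SS i. D i (SS a. M i a * X a)) = (SS a. (SS i. D i (M i a)) * X a) + (SS i. SS b. M i b * D i (X b))"
    by (simp add: D_simps sum.distrib sum_distrib_right) (rule usum_swap)
  have 2: "(SS i. SS m. \<Gamma> m m i * (SS a. M i a * X a)) = (SS a. (SS i. SS l. \<Gamma> l l i * M i a) * X a)"
    by (simp add: sum_distrib_left sum_distrib_right) (rule usum3_312, simp add: mult_ac)
  have 3: "(SS a. (SS l. SS i. \<Gamma> l i a * M i l) * X a) = (SS i. SS b. M i b * (SS a. \<Gamma> b i a * X a))"
    by (simp add: sum_distrib_left sum_distrib_right) (rule usum3_321, simp add: mult_ac)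
  show ?thesis
    unfolding Div_def 1 2 DivM_def
    by (simp add: distrib_left sum.distrib 3[symmetric] left_diff_distrib distrib_right sum_subtractf)
qed

lemma cov_sym: "(\<And>i j. T i j = T j i) \<Longrightarrow> cov i T j k = cov i T k j"
  by (simp add: cov_def algebra_simps)

text \<open>The Hessian is symmetric, so its divergence differs from the derivative of its trace
  only by a commutator of covariant derivatives. By \<open>ricci_identity\<close> this is a
  curvature term, and \<open>div_B\<close> traces it to Ricci.\<close>

lemma DivM_hess:
  assumes Ric_sym: "\<And>i j. Ric i j = Ric j i"
  shows "DivM (up (hess u)) a = D a (Lap u) + (SS b. S b a * D b u)"
proof -
  have "cov i (hess u) j a = cov i (hess u) a j" for i j
    by (rule cov_sym[OF hess_sym])
  then have "cov i (hess u) j a = cov a (hess u) i j - (SS l. curv i a $ l $ j * D l u)" for i j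
    using ricci_identity[where i=i and u=u and j=a and k=j] by (simp add: algebra_simps)
  then have "DivM (up (hess u)) a = D a (Lap u) - (SS i. SS j. h i j * (SS l. curv i a $ l $ j * D l u))"
    by (simp add: DivM_up[OF hess_sym] Lap_def D_trace right_diff_distrib sum_subtractf)
  also have "(SS i. SS j. h i j * (SS l. curv i a $ l $ j * D l u)) = (SS l. (SS i. B i a $ l $ i) * D l u)"
  proof -
    have "(SS i. SS j. h i j * (SS l. curv i a $ l $ j * D l u)) = (SS i. SS j. SS l. h i j * curv i a $ l $ j * D l u)"
      by (simp add: sum_distrib_left mult_ac)
    also have "\<dots> = (SS l. SS i. SS j. curv i a $ l $ j * h j i * D l u)"
      by (rule usum3_312) (simp add: h_sym mult_ac)
    finally show ?thesis
      by (simp add: B_def matrix_matrix_mult_def hm_def sum_distrib_right)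
  qed
  also have "\<dots> = - (SS b. S b a * D b u)"
    by (simp add: div_B S_def up_def sum_negf Ric_sym[of a])
  finally show ?thesis by simp
qed

section \<open>Gradient pairings and Bochner's formula\<close>

definition "N u = (SS a. SS b. h a b * (D a u * D b u))"
definition "inn u w = (SS a. D a u * grad w a)"

lemma up_apply_grad: "(SS a. up (hess u) i a * grad u a) = (SS j. SS a. h i j * hess u j a * grad u a)"
  unfolding up_def sum_distrib_right by (rule usum_swap)

lemma D_N: "D c (N u) = (SS a. hess u c a * grad u a) + (SS a. hess u c a * grad u a)"
proof -
  have "D c (N u) = (SS i. SS j. h i j * cov c (\<lambda>a b. D a u * D b u) i j)"
    unfolding N_def by (rule D_trace)
  also have "\<dots> = (SS i. SS j. h i j * (hess u c i * D j u)) + (SS i. SS j. h i j * (D i u * hess u c j))"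
    by (simp add: cov_def hess_def D_simps algebra_simps sum.distrib sum_subtractf sum_distrib_left)
  also have "(SS i. SS j. h i j * (D i u * hess u c j)) = (SS i. SS j. h i j * (hess u c i * D j u))"
    by (rule usum2) (simp add: h_sym mult_ac)
  also have "(SS i. SS j. h i j * (hess u c i * D j u)) = (SS a. hess u c a * grad u a)"
    by (simp add: grad_def sum_distrib_left mult_ac)
  finally show ?thesis .
qed

text \<open>The trace of the product of the two raised tensors. For symmetric tensors it is their
  metric inner product; the sign of \<open>sq Q Q\<close> makes sense only after evaluation at a
  point.\<close>

definition "sq P Q = (SS i. SS j. up P i j * up Q j i)"

text \<open>The gradient of |\<nabla> u|^2 is twice the raised Hessian applied to grad u. In its
  divergence one derivative falls on the Hessian and yields, by \<open>DivM_hess\<close>, the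
  derivative of the Laplacian and the Ricci term; the other falls on grad u and yields |Hess
  u|^2.\<close>

lemma bochner:
  assumes Ric_sym: "\<And>i j. Ric i j = Ric j i"
  shows "Lap (N u) = 2 * (inn u (Lap u) + (SS a. (SS b. S b a * D b u) * grad u a) + sq (hess u) (hess u))"
proof -
  let ?M = "up (hess u)" and ?X = "grad u"
  have "(SS j. h i j * (SS a. hess u j a * grad u a)) = (SS a. ?M i a * ?X a)" for i
    unfolding up_apply_grad by (simp add: sum_distrib_left mult_ac)
  then have "grad (N u) i = (SS a. ?M i a * ?X a) + (SS a. ?M i a * ?X a)" for i
    by (simp only: grad_def[of "N u"] D_N distrib_left sum.distrib)
  then have "Lap (N u) = Div (\<lambda>i. SS a. ?M i a * ?X a) + Div (\<lambda>i. SS a. ?M i a * ?X a)"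
    by (simp only: Lap_div Div_def D_simps(1) sum.distrib distrib_left ac_simps)
  also have "Div (\<lambda>i. SS a. ?M i a * ?X a) = (SS a. DivM ?M a * ?X a) + (SS i. SS b. ?M i b * ?M b i)"
  proof -
    have "(SS j. h b j * hess u i j) = ?M b i" for i b
      unfolding up_def by (simp add: hess_sym[of u i])
    then show ?thesis unfolding Div_contract cov_grad by simp
  qed
  also have "(SS a. DivM ?M a * ?X a) = (SS a. D a (Lap u) * ?X a) + (SS a. (SS b. S b a * D b u) * ?X a)"
    by (simp add: DivM_hess[OF Ric_sym] distrib_right sum.distrib)
  also have "(SS a. D a (Lap u) * ?X a) = inn u (Lap u)"
    by (simp add: inn_def grad_def sum_distrib_left) (rule usum2, simp add: h_sym mult_ac)
  finally show ?thesis by (simp add: sq_def algebra_simps)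
qed

end

section \<open>Evolution of the geometry under Ricci flow\<close>

locale ricci_flow_jet = levi_civita D g h \<Gamma>
  for D :: "'n::finite \<Rightarrow> 'r::comm_ring_1 \<Rightarrow> 'r" and g h \<Gamma> +
  fixes T :: "'r \<Rightarrow> 'r"
  assumes T_deriv: "derivation T" and T_comm: "T (D i a) = D i (T a)"
    and Tg: "T (g i j) = - (Ric i j + Ric i j)"
begin

lemmas T_simps = derivationD[OF T_deriv]

text \<open>Symmetry is read off the flow equation: its left-hand side is symmetric, and the factor
  2 can be cancelled.\<close>

lemma Ric_sym: "Ric i j = Ric j i"
  using Tg[of i j] Tg[of j i] two_cancel'[of "Ric i j" "Ric j i"] by (simp add: g_sym[of i j])

lemma T_h: "T (h i j) = (SS a. S i a * h a j) + (SS a. S i a * h a j)"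
proof -
  define R2 where "R2 = (\<chi> i j. Ric i j + Ric i j)"
  have "dmat T gm = - R2"
    by (simp add: vec_eq_iff dmat_def gm_def Tg R2_def)
  then have "dmat T hm ** gm - hm ** R2 = 0"
    using arg_cong[OF hm_gm, of "dmat T"] by (simp add: dmat_simps[OF T_deriv] mat_simps)
  then have "(dmat T hm ** gm - hm ** R2) ** hm = 0" by simp
  then have "dmat T hm = hm ** R2 ** hm"
    by (simp add: mat_simps) (simp add: gm_hm flip: matrix_mul_assoc)
  from arg_cong[OF this, of "\<lambda>A. A $ i $ j"]
  have "T (h i j) = (SS k. (SS a. h i a * (Ric a k + Ric a k)) * h k j)"
    by (simp add: dmat_def matrix_matrix_mult_def hm_def R2_def)
  then show ?thesis
    by (simp only: S_def up_def distrib_left distrib_right sum.distrib)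
qed

lemma S_sym: "(SS a. S i a * h a j) = (SS a. S j a * h a i)"
  unfolding S_def up_def sum_distrib_right
  by (rule usum2) (simp add: h_sym Ric_sym mult_ac)

lemma Scal_trace: "Scal = (SS j. S j j)"
  by (simp add: Scal_def S_def up_def Ric_sym)

lemma contracted_bianchi: "DivM S i + DivM S i = D i Scal"
  using contracted_bianchi_aux[of i] by (simp add: Scal_trace) (simp add: S_def up_def[abs_def] Ric_sym)

text \<open>The time derivative of the Christoffel symbols, which is a tensor although \<Gamma> is
  not. \<open>Cl\<close> is the same tensor with its upper index lowered.\<close>

definition "C k i j = T (\<Gamma> k i j)"
definition "Cl l i j = (SS m. C m i j * g m l)"

lemma C_sym: "C k i j = C k j i" and Cl_sym: "Cl k i j = Cl k j i"
  by (simp_all add: C_def Cl_def \<Gamma>_sym[of _ i])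

text \<open>Apply T to the metric compatibility \<open>Dg\<close> and substitute the flow equation.
  The terms in which T hits the metric supply the Christoffel corrections of the covariant
  derivative of \<open>Ric\<close>.\<close>

lemma cov_Ric: "- (cov k Ric i j + cov k Ric i j) = Cl j k i + Cl i k j"
proof -
  have "T (D k (g i j)) = Cl j k i + Cl i k j
      + ((SS m. \<Gamma> m k i * T (g m j)) + (SS m. \<Gamma> m k j * T (g m i)))"
    by (simp add: Dg T_simps C_def Cl_def sum.distrib)
  moreover have "T (D k (g i j)) = - (D k (Ric i j) + D k (Ric i j))"
    by (simp add: T_comm Tg D_simps)
  ultimately show ?thesis
    by (simp add: cov_def Tg distrib_left sum.distrib sum_negf sum_subtractf Ric_sym[of i] algebra_simps flip: sum_distrib_left)
qed

text \<open>\<open>cov_Ric\<close> has the form of metric compatibility, so the cyclic combination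
  that gives the Christoffel symbols of a metric solves it for \<open>Cl\<close>.\<close>

lemma koszul: "Cl l i j + Cl l i j = - (cov i Ric j l + cov i Ric j l)
   - (cov j Ric i l + cov j Ric i l) + (cov l Ric i j + cov l Ric i j)"
proof -
  have "Cl l i j + Cl l i j = (Cl l i j + Cl j i l) + (Cl l j i + Cl i j l) - (Cl j l i + Cl i l j)"
    by (simp add: Cl_sym[of _ j i] Cl_sym[of _ l])
  then show ?thesis unfolding cov_Ric[symmetric] by (simp add: algebra_simps)
qed

lemma h_g: "(SS k. g i k * h k j) = (if i = j then 1 else 0)"
  using arg_cong[OF gm_hm, of "\<lambda>A. A $ i $ j"]
  by (simp add: matrix_matrix_mult_def hm_def gm_def mat_def)

text \<open>The metric trace of \<open>koszul\<close> is -4 div Ric + 2 d Scal, which the contracted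
  Bianchi identity makes zero. For this reason the evolution equations of Laplacians contain no
  first order term.\<close>

lemma C_trace_h: "(SS i. SS j. h i j * C k i j) = 0"
proof -
  define P where "P l = (SS i. SS j. h i j * Cl l i j)" for l
  have "P l + P l = (SS i. SS j. h i j * (Cl l i j + Cl l i j))" for l
    by (simp only: P_def distrib_left sum.distrib)
  also have "\<dots> l = - ((DivM S l + DivM S l) + (DivM S l + DivM S l)) + (D l Scal + D l Scal)" for l
  proof -
    have "(SS i. SS j. h i j * cov i Ric j l) = DivM S l"
      unfolding S_def by (simp add: DivM_up Ric_sym)
    moreover have "(SS i. SS j. h i j * cov j Ric i l) = DivM S l"
      unfolding S_def by (subst usum_swap) (simp add: DivM_up Ric_sym h_sym)
    moreover have "(SS i. SS j. h i j * cov l Ric i j) = D l Scal"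
      by (simp add: Scal_def D_trace)
    ultimately show ?thesis
      by (simp add: koszul algebra_simps sum.distrib sum_subtractf flip: sum_distrib_left)
  qed
  finally have "P l + P l = 0" for l
    unfolding contracted_bianchi by simp
  then have P0: "P l = 0" for l by (rule two_cancel)
  have "(SS i. SS j. h i j * C k i j) = (SS i. SS j. h i j * (SS m. C m i j * (SS l. g m l * h l k)))"
    by (simp add: h_g)
  also have "\<dots> = (SS i. SS j. h i j * (SS l. h l k * Cl l i j))"
  proof -
    have "(SS m. C m i j * (SS l. g m l * h l k)) = (SS l. h l k * Cl l i j)" for i j
      unfolding Cl_def sum_distrib_left by (rule usum2) (simp add: mult_ac)
    then show ?thesis by simp
  qed
  also have "\<dots> = (SS l. SS i. SS j. h l k * (h i j * Cl l i j))"
    unfolding sum_distrib_left by (rule usum3_312) (simp add: mult_ac)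
  also have "\<dots> = (SS l. h l k * P l)"
    by (simp add: P_def sum_distrib_left)
  finally show ?thesis by (simp add: P0)
qed

text \<open>The trace of \<Gamma> is the logarithmic derivative of the volume density, which decays
  at rate \<open>Scal\<close>. The proof traces \<open>cov_Ric\<close>, whose two terms on the right
  have equal traces.\<close>

lemma C_trace: "(SS m. C m m k) = - D k Scal"
proof -
  have "(SS i. SS j. h i j * (Cl j k i + Cl i k j)) = - (D k Scal + D k Scal)"
    unfolding cov_Ric[symmetric] by (simp only: Scal_def D_trace distrib_left sum.distrib sum_negf mult_minus_right)
  moreover have "(SS i. SS j. h i j * Cl j k i) = (SS m. C m m k)"
  proof -
    have "(SS i. SS j. h i j * Cl j k i) = (SS i. SS m. C m k i * (SS j. g m j * h j i))"
      unfolding Cl_def sum_distrib_left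
      by (rule sum.cong[OF refl], rule usum2) (simp add: mult_ac h_sym)
    then show ?thesis by (simp add: h_g C_sym)
  qed
  moreover have "(SS i. SS j. h i j * Cl i k j) = (SS i. SS j. h i j * Cl j k i)"
    by (rule usum2) (simp add: h_sym)
  ultimately have "- D k Scal + - D k Scal = (SS m. C m m k) + (SS m. C m m k)"
    by (simp add: distrib_left sum.distrib)
  then show ?thesis by (rule two_cancel'[symmetric])
qed

lemma T_trace: "T (SS i. SS j. h i j * Q i j) = (SS i. SS j. h i j * T (Q i j))
   + (SS i. SS b. S i b * up Q b i) + (SS i. SS b. S i b * up Q b i)"
proof -
  have "(SS i. SS j. (SS a. S i a * h a j) * Q i j) = (SS i. SS b. S i b * up (\<lambda>i j. Q j i) b i)"
    unfolding up_def sum_distrib_left sum_distrib_right by (rule usum3_132) (simp add: mult_ac)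
  moreover have "(SS i. SS j. (SS a. S i a * h a j) * Q i j) = (SS i. SS b. S i b * up Q b i)"
    apply (subst S_sym, subst usum_swap)
    unfolding up_def sum_distrib_left sum_distrib_right by (rule usum3_132) (simp add: mult_ac)
  ultimately show ?thesis
    by (simp only: T_simps T_h distrib_right distrib_left sum.distrib ac_simps)
qed

text \<open>Palatini's variation formula: T Ric is the divergence of C minus the derivative of its
  trace. After contraction with \<open>h\<close> the divergence vanishes by
  \<open>C_trace_h\<close>, and \<open>C_trace\<close> turns the other part into Lap Scal; the
  variation of \<open>h\<close> itself contributes 2 |Ric|^2. \<open>Y\<close> collects the products
  of \<Gamma> and C that complete partial derivatives to covariant ones.\<close>

lemma T_Scal: "T Scal = Lap Scal + 2 * sq Ric Ric"
proof -
  define Y where "Y a b = (SS i. SS j. \<Gamma> j i a * C i j b)" for a b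
  have hY: "(SS j. SS k. h j k * Y k j) = (SS j. SS k. h j k * Y j k)"
    by (rule usum2) (simp add: h_sym)
  have TRic: "T (Ric j k) = (SS i. D i (C i j k)) - D j (SS m. C m m k)
     + (SS m. (SS i. C i i m) * \<Gamma> m j k) + (SS i. SS m. \<Gamma> i i m * C m j k) - Y k j - Y j k" for j k
  proof -
    have "(SS i. SS m. C i j m * \<Gamma> m i k) = Y k j"
      by (simp add: Y_def C_sym[of _ j] mult_ac)
    moreover have "(SS i. SS m. \<Gamma> i j m * C m i k) = Y j k"
      unfolding Y_def by (rule usum2) (simp add: \<Gamma>_sym[of _ j])
    moreover have "(SS i. SS m. C i i m * \<Gamma> m j k) = (SS m. (SS i. C i i m) * \<Gamma> m j k)"
      by (subst usum_swap) (simp add: sum_distrib_right)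
    moreover have "T (Ric j k) = (SS i. D i (C i j k)) - (SS i. D j (C i i k))
       + ((SS i. SS m. C i i m * \<Gamma> m j k) + (SS i. SS m. \<Gamma> i i m * C m j k))
       - ((SS i. SS m. C i j m * \<Gamma> m i k) + (SS i. SS m. \<Gamma> i j m * C m i k))"
      by (simp add: Ric_def curv_def gam_def dmat_def matrix_matrix_mult_def T_simps T_comm
          flip: C_def sum.distrib sum_subtractf)
    ultimately show ?thesis by (simp add: D_sum)
  qed
  \<comment> \<open>Differentiate the vanishing trace of \<open>C_trace_h\<close> in direction i:
    moving the derivative past \<open>h\<close> produces the cross terms, which cancel those in
    \<open>TRic\<close>.\<close>
  have 1: "(SS j. SS k. h j k * (SS i. D i (C i j k))) = (SS j. SS k. h j k * Y j k) + (SS j. SS k. h j k * Y j k)"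
  proof -
    define U where "U i a b = (SS j. \<Gamma> j i a * C i j b)" for i a b
    have "(SS j. SS k. h j k * D i (C i j k)) = (SS j. SS k. h j k * U i j k) + (SS j. SS k. h j k * U i j k)" for i
    proof -
      have "0 = D i (SS j. SS k. h j k * C i j k)"
        by (simp add: C_trace_h D_simps)
      also have "\<dots> = (SS j. SS k. h j k * D i (C i j k))
          - ((SS j. SS k. SS m. \<Gamma> j i m * h m k * C i j k) + (SS j. SS k. SS m. \<Gamma> k i m * h m j * C i j k))"
        by (simp add: D_simps D_h sum.distrib sum_subtractf distrib_right left_diff_distrib sum_distrib_right sum_negf)
      also have "(SS j. SS k. SS m. \<Gamma> j i m * h m k * C i j k) = (SS j. SS k. h j k * U i j k)"
        unfolding U_def sum_distrib_left by (rule usum3_321) (simp add: mult_ac)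
      also have "(SS j. SS k. SS m. \<Gamma> k i m * h m j * C i j k) = (SS j. SS k. h j k * U i j k)"
        unfolding U_def sum_distrib_left by (rule usum3_312) (simp add: mult_ac C_sym)
      finally show ?thesis by (simp add: algebra_simps)
    qed
    then have "(SS i. SS j. SS k. h j k * D i (C i j k))
       = (SS i. SS j. SS k. h j k * U i j k) + (SS i. SS j. SS k. h j k * U i j k)"
      by (simp only: sum.distrib)
    moreover have "(SS i. SS j. SS k. h j k * D i (C i j k)) = (SS j. SS k. h j k * (SS i. D i (C i j k)))"
      unfolding sum_distrib_left by (rule usum3_231) simp
    moreover have "(SS i. SS j. SS k. h j k * U i j k) = (SS j. SS k. h j k * Y j k)"
      unfolding Y_def U_def[symmetric] sum_distrib_left by (rule usum3_231) simp
    ultimately show ?thesis by simp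
  qed
  have 2: "(SS j. SS k. h j k * (SS i. SS m. \<Gamma> i i m * C m j k)) = 0"
  proof -
    have "(SS j. SS k. h j k * (SS i. SS m. \<Gamma> i i m * C m j k))
        = (SS j. SS k. SS m. (SS i. \<Gamma> i i m) * (h j k * C m j k))"
      unfolding sum_distrib_left sum_distrib_right
      by (rule sum.cong[OF refl], rule sum.cong[OF refl], rule usum2) (simp add: mult_ac)
    also have "\<dots> = (SS m. SS j. SS k. (SS i. \<Gamma> i i m) * (h j k * C m j k))"
      by (rule usum3_312) simp
    finally show ?thesis by (simp add: C_trace_h flip: sum_distrib_left)
  qed
  have "(SS j. SS k. h j k * T (Ric j k)) = Lap Scal"
    unfolding TRic C_trace
    by (simp add: right_diff_distrib distrib_left sum.distrib sum_subtractf 1 2 hY D_simps Lap_def hess_def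
        sum_negf mult.commute[of "D _ Scal"])
  moreover have "(SS i. SS b. S i b * up Ric b i) = sq Ric Ric"
    by (simp add: sq_def S_def)
  ultimately show ?thesis
    unfolding Scal_def T_trace by (simp add: Scal_def)
qed

text \<open>The Laplacian varies through \<open>h\<close>, which gives the Ricci term, and through
  \<Gamma>, whose contribution is the trace that vanishes by \<open>C_trace_h\<close>.\<close>

lemma T_Lap: "T (Lap u) = Lap (T u) + 2 * sq Ric (hess u)"
proof -
  have "T (hess u i j) = hess (T u) i j - (SS k. C k i j * D k u)" for i j
    by (simp add: hess_def T_simps T_comm C_def sum.distrib)
  moreover have "(SS i. SS j. h i j * (SS k. C k i j * D k u)) = 0"
  proof -
    have "(SS i. SS j. h i j * (SS k. C k i j * D k u)) = (SS k. SS i. SS j. D k u * (h i j * C k i j))"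
      unfolding sum_distrib_left by (rule usum3_312) (simp add: mult_ac)
    then show ?thesis by (simp add: C_trace_h flip: sum_distrib_left)
  qed
  ultimately show ?thesis
    unfolding Lap_def T_trace by (simp add: right_diff_distrib sum_subtractf sq_def S_def)
qed

lemma T_N: "T (N u) = 2 * (inn u (T u) + (SS a. (SS b. S b a * D b u) * grad u a))"
proof -
  have "(SS i. SS b. S i b * up (\<lambda>a b. D a u * D b u) b i) = (SS a. (SS b. S b a * D b u) * grad u a)"
    by (subst usum_swap) (simp add: up_def grad_def sum_distrib_left sum_distrib_right mult_ac)
  moreover have "(SS a. SS b. h a b * (D a (T u) * D b u)) = inn u (T u)"
    by (subst usum_swap) (simp add: inn_def grad_def sum_distrib_left h_sym mult_ac)
  moreover have "(SS a. SS b. h a b * (D a u * D b (T u))) = inn u (T u)"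
    by (simp add: inn_def grad_def sum_distrib_left mult_ac)
  ultimately show ?thesis
    unfolding N_def T_trace by (simp add: T_simps T_comm distrib_left sum.distrib algebra_simps)
qed

lemma Lap_simps: "Lap (a + b) = Lap a + Lap b" "Lap (a - b) = Lap a - Lap b" "Lap (- a) = - Lap a"
  by (simp_all add: Lap_def hess_def D_simps algebra_simps sum.distrib sum_subtractf sum_negf)

lemma inn_simps: "inn u (a + b) = inn u a + inn u b" "inn u (a - b) = inn u a - inn u b" "inn u (- a) = - inn u a"
  by (simp_all add: inn_def grad_def D_simps algebra_simps sum.distrib sum_subtractf sum_negf)

lemma inn_sym: "inn u w = inn w u"
  unfolding inn_def grad_def sum_distrib_left by (rule usum2) (simp add: h_sym mult_ac)

lemma N_inn: "N u = inn u u"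
  by (simp add: N_def inn_def grad_def sum_distrib_left mult_ac)

lemma Lap_mult: "Lap (a * b) = Lap a * b + 2 * inn a b + a * Lap b"
proof -
  have "hess (a * b) i j = hess a i j * b + D i a * D j b + D j a * D i b + a * hess b i j" for i j
    by (simp add: hess_def D_simps algebra_simps sum.distrib sum_distrib_left)
  then have "Lap (a * b) = Lap a * b + (SS i. SS j. h i j * (D i a * D j b)) + (SS i. SS j. h i j * (D j a * D i b)) + a * Lap b"
    by (simp add: Lap_def distrib_left sum.distrib sum_distrib_left sum_distrib_right mult_ac)
  moreover have "(SS i. SS j. h i j * (D i a * D j b)) = inn a b"
    by (simp add: inn_def grad_def sum_distrib_left mult_ac)
  moreover have "(SS i. SS j. h i j * (D j a * D i b)) = inn a b"
    unfolding inn_sym[of a] by (simp add: inn_def grad_def sum_distrib_left mult_ac)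
  ultimately show ?thesis by simp
qed

lemma sq_sym: "sq P Q = sq Q P"
  unfolding sq_def by (rule usum2) (simp add: mult_ac)

lemma sq_add: "sq (\<lambda>i j. P i j + Q i j) (\<lambda>i j. P i j + Q i j) = sq P P + 2 * sq P Q + sq Q Q"
proof -
  have "up (\<lambda>i j. P i j + Q i j) i j = up P i j + up Q i j" for i j
    by (simp add: up_def distrib_left sum.distrib)
  then have "sq (\<lambda>i j. P i j + Q i j) (\<lambda>i j. P i j + Q i j) = sq P P + sq P Q + sq Q P + sq Q Q"
    by (simp add: sq_def distrib_left distrib_right sum.distrib)
  then show ?thesis by (simp add: sq_sym[of Q P])
qed

text \<open>Perelman's pointwise identity; \<open>u\<close> plays the role of \<open>exp (- f)\<close>.\<close>

lemma perelman_identity: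
  assumes Tf: "T f = - Lap f + N f - Scal"
    and Du: "\<And>i. D i u = - (u * D i f)" and Tu: "T u = - (u * T f)"
  defines "w \<equiv> 2 * Lap f - N f + Scal"
  shows "T (w * u) - Scal * (w * u)
    = 2 * sq (\<lambda>i j. Ric i j + hess f i j) (\<lambda>i j. Ric i j + hess f i j) * u - Lap (w * u)"
proof -
  have hu: "hess u i j = - (u * hess f i j) + u * (D i f * D j f)" for i j
    by (simp add: hess_def Du D_simps algebra_simps sum_distrib_left sum_negf)
  have Lapu: "Lap u = - (u * Lap f) + u * N f"
    unfolding Lap_def N_def hu
    by (simp add: right_diff_distrib sum_subtractf distrib_left sum.distrib sum_distrib_left sum_negf mult_ac)
  have innu: "inn w' u = - (u * inn f w')" for w'
    unfolding inn_sym[of w'] by (simp add: inn_def Du sum_distrib_left sum_negf mult_ac)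
  have "Lap (2 * b) = 2 * Lap b" for b
    using Lap_simps(1)[of b b] by (simp flip: mult_2)
  moreover have "inn f (2 * b) = 2 * inn f b" for b
    using inn_simps(1)[of f b b] by (simp flip: mult_2)
  \<comment> \<open>After substitution 2 Lap (N f) from T (2 Lap f) meets one - Lap (N f) from
    moving - Lap (w u) across. Of the single Bochner expression left over, the Ricci term cancels
    against \<open>T_N\<close>; its Hessian term together with those of \<open>T_Lap\<close> and
    \<open>T_Scal\<close> is the expanded square.\<close>
  ultimately show ?thesis
    unfolding sq_add w_def
    by (simp add: Lap_mult Lapu innu Tu T_simps T_Lap T_N T_Scal Tf Lap_simps inn_simps bochner[OF Ric_sym])
       (simp add: N_inn algebra_simps)
qed

end

section \<open>Derivatives within a set\<close>

text \<open>The condition under which derivatives within \<open>S\<close> are unique; it covers open sets, nondegenerate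
  compact intervals and their products.\<close>

definition approachable :: "'a::euclidean_space set \<Rightarrow> bool" where
  "approachable S \<longleftrightarrow> (\<forall>x\<in>S. \<forall>i\<in>Basis. \<forall>e>0. \<exists>d. 0 < \<bar>d\<bar> \<and> \<bar>d\<bar> < e \<and> x + d *\<^sub>R i \<in> S)"

lemma approachable_open:
  assumes "open S" shows "approachable S"
  unfolding approachable_def
proof (intro ballI allI impI)
  fix x and i :: 'a and e :: real assume x: "x \<in> S" "i \<in> Basis" "e > 0"
  then obtain r where r: "r > 0" "ball x r \<subseteq> S" using assms open_contains_ball by blast
  define d where "d = min e r / 2"
  have "0 < d" "d < e" "d < r" using r x by (auto simp: d_def min_def field_simps)
  then have "x + d *\<^sub>R i \<in> S" using r x by (intro set_mp[OF r(2)]) (auto simp: dist_norm)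
  then show "\<exists>d. 0 < \<bar>d\<bar> \<and> \<bar>d\<bar> < e \<and> x + d *\<^sub>R i \<in> S" using \<open>0 < d\<close> \<open>d < e\<close> by (intro exI[of _ d]) auto
qed

lemma approachable_interval:
  fixes a b :: real
  assumes "a < b" shows "approachable {a..b}"
  unfolding approachable_def
proof (intro ballI allI impI)
  fix x i e :: real assume x: "x \<in> {a..b}" "i \<in> Basis" "e > 0"
  define d where "d = (if x < (a+b)/2 then min e ((b-a)/2) / 2 else - (min e ((b-a)/2) / 2))"
  have "0 < \<bar>d\<bar>" "\<bar>d\<bar> < e" "x + d \<in> {a..b}" using x assms by (auto simp: d_def min_def field_simps)
  then show "\<exists>d. 0 < \<bar>d\<bar> \<and> \<bar>d\<bar> < e \<and> x + d *\<^sub>R i \<in> {a..b}"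
    using x by (intro exI[of _ d]) auto
qed

lemma approachable_Times:
  assumes "approachable S" "approachable T" shows "approachable (S \<times> T)"
  unfolding approachable_def
proof (intro ballI allI impI)
  fix p and i :: "'a \<times> 'b" and e :: real assume p: "p \<in> S \<times> T" "i \<in> Basis" "e > 0"
  show "\<exists>d. 0 < \<bar>d\<bar> \<and> \<bar>d\<bar> < e \<and> p + d *\<^sub>R i \<in> S \<times> T"
  proof (cases "\<exists>u\<in>Basis. i = (u, 0)")
    case True
    then show ?thesis using assms(1) p unfolding approachable_def
      by (cases p) (force)
  next
    case False
    then obtain u where "u \<in> Basis" "i = (0, u)" using p by (auto simp: Basis_prod_def)
    then show ?thesis using assms(2) p unfolding approachable_def
      by (cases p) (force)
  qed
qed

text \<open>The direction comes before the function, so that \<open>dder S v\<close> is an operator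
  on functions and can be iterated.\<close>

definition dder :: "'a::euclidean_space set \<Rightarrow> 'a \<Rightarrow> ('a \<Rightarrow> 'b::real_normed_vector) \<Rightarrow> 'a \<Rightarrow> 'b" where
  "dder S v f x = frechet_derivative f (at x within S) v"

lemma fderiv_eq:
  assumes "approachable S" "x \<in> S" "(f has_derivative f') (at x within S)"
  shows "frechet_derivative f (at x within S) = f'"
proof -
  have "(f has_derivative frechet_derivative f (at x within S)) (at x within S)"
    using assms(3) frechet_derivative_works unfolding differentiable_def by blast
  then show ?thesis
    using assms by (intro frechet_derivative_unique_within[OF _ assms(3)]) (auto simp: approachable_def)
qed

lemma dder_eq:
  assumes "approachable S" "x \<in> S" "(f has_derivative f') (at x within S)"
  shows "dder S v f x = f' v"
  by (simp add: dder_def fderiv_eq[OF assms])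

lemma dder_has_derivative:
  assumes "f differentiable_on S" "x \<in> S"
  shows "(f has_derivative (\<lambda>v. dder S v f x)) (at x within S)"
  using assms unfolding dder_def differentiable_on_def by (simp flip: frechet_derivative_works)

lemma has_derivative_cong_on:
  assumes "x \<in> S" "\<And>y. y \<in> S \<Longrightarrow> f y = g y"
  shows "(f has_derivative f') (at x within S) \<longleftrightarrow> (g has_derivative f') (at x within S)"
  using assms has_derivative_transform[of x S] by metis

lemma dder_cong:
  assumes "x \<in> S" "\<And>y. y \<in> S \<Longrightarrow> f y = g y"
  shows "dder S v f x = dder S v g x"
  by (simp add: dder_def frechet_derivative_def has_derivative_cong_on[OF assms])

lemma Ck_Suc: "Ck_on (Suc k) S f \<longleftrightarrow> f differentiable_on S \<and> (\<forall>v. Ck_on k S (dder S v f))"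
  by (simp add: dder_def[abs_def])

declare Ck_on.simps(2) [simp del]

lemma Ck_cong:
  assumes "\<And>y. y \<in> S \<Longrightarrow> f y = g y"
  shows "Ck_on k S f \<longleftrightarrow> Ck_on k S g"
  using assms
proof (induction k arbitrary: f g)
  case 0
  then show ?case using continuous_on_cong by auto
next
  case (Suc k)
  have 1: "f differentiable_on S \<longleftrightarrow> g differentiable_on S"
    unfolding differentiable_on_def differentiable_def
    using has_derivative_cong_on[of _ S f g] Suc.prems by (intro ball_cong) auto
  have 2: "Ck_on k S (dder S v f) = Ck_on k S (dder S v g)" for v
    by (rule Suc.IH) (use Suc.prems in \<open>auto intro: dder_cong\<close>)
  show ?case unfolding Ck_Suc 1 2 ..
qed

lemma Ck_SucD: "Ck_on (Suc k) S f \<Longrightarrow> Ck_on k S f"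
  by (induction k arbitrary: f) (auto simp: Ck_Suc differentiable_imp_continuous_on)

text \<open>Any derivative may be exhibited: on an approachable set derivatives within the set are
  unique, so it agrees with the one chosen by \<open>frechet_derivative\<close>.\<close>

lemma Ck_SucI:
  assumes "approachable S" "\<And>x. x \<in> S \<Longrightarrow> (f has_derivative f' x) (at x within S)"
    "\<And>v. Ck_on k S (\<lambda>x. f' x v)"
  shows "Ck_on (Suc k) S f"
  unfolding Ck_Suc
proof (intro conjI allI)
  show "f differentiable_on S" using assms(2) unfolding differentiable_on_def differentiable_def by blast
  show "Ck_on k S (dder S v f)" for v
    using assms(3)[of v] by (subst Ck_cong[of S _ "\<lambda>x. f' x v"]) (auto simp: dder_eq[OF assms(1) _ assms(2)])
qed

section \<open>Closure properties of C^k and smooth functions\<close>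

context
  fixes S :: "'a::euclidean_space set"
  assumes S: "approachable S"
begin

lemma Ck_const: "Ck_on k S (\<lambda>x. c)"
  by (induction k arbitrary: c) (auto intro!: Ck_SucI[OF S] derivative_eq_intros)

lemma Ck_linear:
  assumes "bounded_linear L" "Ck_on k S f"
  shows "Ck_on k S (\<lambda>x. L (f x))"
  using assms(2)
proof (induction k arbitrary: f)
  case 0
  then show ?case using bounded_linear.continuous_on[OF assms(1)] by auto
next
  case (Suc k)
  show ?case
    by (rule Ck_SucI[OF S, where f' = "\<lambda>x v. L (dder S v f x)"])
      (use Suc in \<open>auto simp: Ck_Suc intro: bounded_linear.has_derivative[OF assms(1)] dder_has_derivative\<close>)
qed

lemma Ck_add:
  assumes "Ck_on k S f" "Ck_on k S g" shows "Ck_on k S (\<lambda>x. f x + g x)"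
  using assms
proof (induction k arbitrary: f g)
  case 0 then show ?case by (auto intro: continuous_on_add)
next
  case (Suc k)
  show ?case
    by (rule Ck_SucI[OF S, where f' = "\<lambda>x v. dder S v f x + dder S v g x"])
      (use Suc in \<open>auto simp: Ck_Suc intro: has_derivative_add dder_has_derivative\<close>)
qed

lemma Ck_minus: "Ck_on k S f \<Longrightarrow> Ck_on k S (\<lambda>x. - f x)"
  by (rule Ck_linear) (auto intro: bounded_linear_minus bounded_linear_ident)

lemma Ck_mult:
  fixes f g :: "'a \<Rightarrow> real"
  assumes "Ck_on k S f" "Ck_on k S g" shows "Ck_on k S (\<lambda>x. f x * g x)"
  using assms
proof (induction k arbitrary: f g)
  case 0 then show ?case by (auto intro: continuous_on_mult)
next
  case (Suc k)
  show ?case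
    by (rule Ck_SucI[OF S, where f' = "\<lambda>x v. f x * dder S v g x + dder S v f x * g x"])
      (use Suc Ck_SucD[of k S] in \<open>auto simp: Ck_Suc intro!: has_derivative_mult dder_has_derivative Ck_add\<close>)
qed

lemma Ck_inverse:
  fixes f :: "'a \<Rightarrow> real"
  assumes "Ck_on k S f" "\<And>x. x \<in> S \<Longrightarrow> f x \<noteq> 0" shows "Ck_on k S (\<lambda>x. inverse (f x))"
  using assms
proof (induction k arbitrary: f)
  case 0 then show ?case by (auto intro: continuous_on_inverse)
next
  case (Suc k)
  have i: "Ck_on k S (\<lambda>x. inverse (f x))" using Suc Ck_SucD by blast
  show ?case
  proof (rule Ck_SucI[OF S])
    show "((\<lambda>x. inverse (f x)) has_derivative (\<lambda>v. - (inverse (f x) * dder S v f x * inverse (f x)))) (at x within S)"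
      if "x \<in> S" for x
      by (rule Deriv.has_derivative_inverse) (use Suc.prems that in \<open>auto simp: Ck_Suc intro: dder_has_derivative\<close>)
    show "Ck_on k S (\<lambda>x. - (inverse (f x) * dder S v f x * inverse (f x)))" for v
      using Suc.prems i by (simp add: Ck_minus Ck_mult Ck_Suc)
  qed
qed

lemma Ck_ln:
  fixes f :: "'a \<Rightarrow> real"
  assumes "Ck_on k S f" "\<And>x. x \<in> S \<Longrightarrow> f x > 0" shows "Ck_on k S (\<lambda>x. ln (f x))"
proof (cases k)
  case 0 then show ?thesis using assms by (fastforce intro: continuous_on_ln)
next
  case (Suc l)
  have "((\<lambda>x. ln (f x)) has_derivative (\<lambda>v. dder S v f x * inverse (f x))) (at x within S)" if "x \<in> S" for x
    using assms Suc that
    by (auto intro!: derivative_eq_intros dder_has_derivative simp: Ck_Suc)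
  then show ?thesis unfolding Suc
    by (rule Ck_SucI[OF S])
      (use Suc assms Ck_SucD[of l S f] in \<open>force simp: Ck_Suc intro!: Ck_mult Ck_inverse\<close>)+
qed

lemma Ck_sqrt:
  fixes f :: "'a \<Rightarrow> real"
  assumes "Ck_on k S f" "\<And>x. x \<in> S \<Longrightarrow> f x > 0" shows "Ck_on k S (\<lambda>x. sqrt (f x))"
  using assms
proof (induction k)
  case 0 then show ?case by (auto intro: continuous_on_real_sqrt)
next
  case (Suc k)
  have "((\<lambda>x. sqrt (f x)) has_derivative (\<lambda>v. dder S v f x * (inverse (sqrt (f x)) / 2))) (at x within S)" if "x \<in> S" for x
    by (rule has_derivative_real_sqrt) (use Suc.prems that in \<open>auto simp: Ck_Suc intro: dder_has_derivative\<close>)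
  then show ?case
  proof (rule Ck_SucI[OF S])
    fix v
    have "Ck_on k S (\<lambda>x. sqrt (f x))" using Suc Ck_SucD by blast
    then have "Ck_on k S (\<lambda>x. inverse (sqrt (f x)))"
      by (rule Ck_inverse) (use Suc.prems(2) in force)
    then have "Ck_on k S (\<lambda>x. dder S v f x * (inverse (sqrt (f x)) * (1/2)))"
      using Suc.prems(1) by (intro Ck_mult Ck_const) (simp_all add: Ck_Suc)
    then show "Ck_on k S (\<lambda>x. dder S v f x * (inverse (sqrt (f x)) / 2))" by simp
  qed
qed

lemma smooth_const: "smooth_on S (\<lambda>x. c)"
  and smooth_linear: "bounded_linear L \<Longrightarrow> smooth_on S F \<Longrightarrow> smooth_on S (\<lambda>x. L (F x))"
  and smooth_add: "smooth_on S G \<Longrightarrow> smooth_on S G' \<Longrightarrow> smooth_on S (\<lambda>x. G x + G' x)"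
  and smooth_minus: "smooth_on S G \<Longrightarrow> smooth_on S (\<lambda>x. - G x)"
  by (simp_all add: smooth_on_def Ck_const Ck_linear Ck_add Ck_minus)

lemma smooth_diff: "smooth_on S G \<Longrightarrow> smooth_on S G' \<Longrightarrow> smooth_on S (\<lambda>x. G x - G' x)"
  using smooth_add[of G "\<lambda>x. - G' x"] smooth_minus[of G'] by simp

lemma smooth_mult: "smooth_on S f \<Longrightarrow> smooth_on S g \<Longrightarrow> smooth_on S (\<lambda>x. f x * g x :: real)"
  and smooth_inverse: "smooth_on S f \<Longrightarrow> (\<And>x. x \<in> S \<Longrightarrow> f x \<noteq> 0) \<Longrightarrow> smooth_on S (\<lambda>x. inverse (f x :: real))"
  and smooth_ln: "smooth_on S f \<Longrightarrow> (\<And>x. x \<in> S \<Longrightarrow> f x > 0) \<Longrightarrow> smooth_on S (\<lambda>x. ln (f x :: real))"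
  and smooth_sqrt: "smooth_on S f \<Longrightarrow> (\<And>x. x \<in> S \<Longrightarrow> f x > 0) \<Longrightarrow> smooth_on S (\<lambda>x. sqrt (f x :: real))"
  by (simp_all add: smooth_on_def Ck_mult Ck_inverse Ck_ln Ck_sqrt)

lemma smooth_divide: "smooth_on S f \<Longrightarrow> smooth_on S g \<Longrightarrow> (\<And>x. x \<in> S \<Longrightarrow> g x \<noteq> 0) \<Longrightarrow> smooth_on S (\<lambda>x. f x / g x :: real)"
  by (simp add: divide_inverse smooth_mult smooth_inverse)

lemma smooth_sum: "(\<And>i. i \<in> I \<Longrightarrow> smooth_on S (\<lambda>x. f i x)) \<Longrightarrow> smooth_on S (\<lambda>x. \<Sum>i\<in>I. f i x)"
  by (induction I rule: infinite_finite_induct) (auto intro: smooth_const smooth_add)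

lemma smooth_prod: "(\<And>i. i \<in> I \<Longrightarrow> smooth_on S (\<lambda>x. f i x :: real)) \<Longrightarrow> smooth_on S (\<lambda>x. \<Prod>i\<in>I. f i x)"
  by (induction I rule: infinite_finite_induct) (auto intro: smooth_const smooth_mult)

lemma smooth_det:
  assumes "\<And>i j. smooth_on S (\<lambda>x. M x $ i $ j)"
  shows "smooth_on S (\<lambda>x. det (M x :: real^'n^'n))"
  unfolding det_def by (intro smooth_sum smooth_mult smooth_const smooth_prod assms)

end

lemma smooth_cong: "(\<And>x. x \<in> S \<Longrightarrow> f x = g x) \<Longrightarrow> smooth_on S f \<longleftrightarrow> smooth_on S g"
  unfolding smooth_on_def using Ck_cong by blast

lemma smooth_dder: "smooth_on S f \<Longrightarrow> smooth_on S (dder S v f)"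
  unfolding smooth_on_def using Ck_Suc by blast

lemma smooth_differentiable: "smooth_on S f \<Longrightarrow> f differentiable_on S"
  unfolding smooth_on_def using Ck_Suc by blast

lemma smooth_has_derivative:
  "smooth_on S f \<Longrightarrow> x \<in> S \<Longrightarrow> (f has_derivative (\<lambda>v. dder S v f x)) (at x within S)"
  by (rule dder_has_derivative[OF smooth_differentiable])

lemma smooth_continuous: "smooth_on S f \<Longrightarrow> continuous_on S f"
  using smooth_differentiable differentiable_imp_continuous_on by blast

lemma dder_open_subset:
  assumes "open T" "T \<subseteq> S" "x \<in> T"
  shows "dder S v f x = dder T v f x" "dder T v f x = frechet_derivative f (at x) v"
proof -
  have "at x within S = at x" using assms by (meson at_within_interior interior_maximal subsetD)
  moreover have "at x within T = at x" using assms at_within_open by blast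
  ultimately show "dder S v f x = dder T v f x" "dder T v f x = frechet_derivative f (at x) v"
    by (simp_all add: dder_def)
qed

lemma Ck_open_subset:
  assumes "open T" "T \<subseteq> S" "Ck_on k S f" shows "Ck_on k T f"
  using assms(3)
proof (induction k arbitrary: f)
  case 0 then show ?case using assms continuous_on_subset by auto
next
  case (Suc k)
  have "Ck_on k T (dder S v f)" for v using Suc by (simp add: Ck_Suc)
  then have "Ck_on k T (dder T v f)" for v
    using Ck_cong[of T "dder S v f" "dder T v f"] dder_open_subset(1)[OF assms(1,2)] by blast
  then show ?case using Suc.prems assms(2) by (auto simp: Ck_Suc intro: differentiable_on_subset)
qed

lemma smooth_open_subset: "smooth_on S f \<Longrightarrow> open T \<Longrightarrow> T \<subseteq> S \<Longrightarrow> smooth_on T f"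
  unfolding smooth_on_def using Ck_open_subset by blast

section \<open>Time slices, restriction, and symmetry of second derivatives\<close>

lemma slice_has_derivative:
  assumes "F differentiable_on ({a..b::real} \<times> V)" "t \<in> {a..b}" "x \<in> V"
  shows "((\<lambda>x. F (t, x)) has_derivative (\<lambda>v. dder ({a..b} \<times> V) (0, v) F (t, x))) (at x within V)"
proof -
  have "((\<lambda>x. F ((\<lambda>x. (t, x)) x)) has_derivative (\<lambda>v. dder ({a..b} \<times> V) (0, v) F (t, x))) (at x within V)"
    by (rule has_derivative_in_compose2[where t = "{a..b} \<times> V"])
      (use assms in \<open>auto intro!: derivative_eq_intros dder_has_derivative\<close>)
  then show ?thesis by simp
qed

lemma Ck_slice:
  assumes "approachable V" "t \<in> {a..b::real}" "Ck_on k ({a..b} \<times> V) F"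
  shows "Ck_on k V (\<lambda>x. F (t, x))"
  using assms(3)
proof (induction k arbitrary: F)
  case 0
  then have F: "continuous_on ({a..b} \<times> V) F" by simp
  have "continuous_on V (\<lambda>x. F (t, x))"
    by (rule continuous_on_compose2[OF F, of V "\<lambda>x. (t, x)"])
      (use assms(2) in \<open>auto intro: continuous_on_Pair continuous_on_const continuous_on_id\<close>)
  then show ?case by simp
next
  case (Suc k)
  show ?case
  proof (rule Ck_SucI[OF assms(1)])
    show "((\<lambda>x. F (t, x)) has_derivative (\<lambda>v. dder ({a..b} \<times> V) (0, v) F (t, x))) (at x within V)" if "x \<in> V" for x
      using Suc.prems[unfolded Ck_Suc] slice_has_derivative[OF _ assms(2) that] by blast
    show "Ck_on k V (\<lambda>x. dder ({a..b} \<times> V) (0, v) F (t, x))" for v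
      using Suc.prems[unfolded Ck_Suc] Suc.IH by blast
  qed
qed

lemma smooth_slice:
  assumes "approachable V" "t \<in> {a..b::real}" "smooth_on ({a..b} \<times> V) F"
  shows "smooth_on V (\<lambda>x. F (t, x))"
  using assms Ck_slice unfolding smooth_on_def by blast

lemma slice_partial:
  assumes "open V" "t \<in> {a..b::real}" "x \<in> V" "smooth_on ({a..b} \<times> V) F"
  shows "frechet_derivative (\<lambda>x. F (t, x)) (at x) v = dder ({a..b} \<times> V) (0, v) F (t, x)"
  using slice_has_derivative[OF smooth_differentiable[OF assms(4)] assms(2,3)]
    at_within_open[OF assms(3,1)] by (metis frechet_derivative_at)

text \<open>Both iterated derivatives are limits of the same second difference, by the mean value
  theorem applied twice.\<close>

lemma second_difference:
  fixes f :: "'a::euclidean_space \<Rightarrow> real"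
  assumes "smooth_on U f" "open U" "s > 0" and sub: "\<And>a b. \<lbrakk>0 \<le> a; a \<le> s; 0 \<le> b; b \<le> s\<rbrakk> \<Longrightarrow> x + a *\<^sub>R v + b *\<^sub>R w \<in> U"
  shows "\<exists>a b. 0 \<le> a \<and> a \<le> s \<and> 0 \<le> b \<and> b \<le> s \<and>
    f (x + s *\<^sub>R v + s *\<^sub>R w) - f (x + s *\<^sub>R v) - f (x + s *\<^sub>R w) + f x
     = s * s * dder U w (dder U v f) (x + a *\<^sub>R v + b *\<^sub>R w)"
proof -
  have D: "(h has_derivative (\<lambda>v. dder U v h y)) (at y)" if "smooth_on U h" "y \<in> U" for h :: "'a \<Rightarrow> real" and y
    using smooth_has_derivative[OF that] at_within_open[OF that(2) assms(2)] by simp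
  have lin: "dder U (c *\<^sub>R v) h y = c * dder U v h y" if "smooth_on U h" "y \<in> U" for h :: "'a \<Rightarrow> real" and y c v
    using linear_simps(5)[OF has_derivative_bounded_linear[OF D[OF that]]] by simp
  define \<phi> where "\<phi> a = f (x + a *\<^sub>R v + s *\<^sub>R w) - f (x + a *\<^sub>R v)" for a
  have d1: "((\<lambda>a. h (y + a *\<^sub>R u)) has_derivative (\<lambda>c. c * dder U u h (y + a *\<^sub>R u))) (at a)"
    if "smooth_on U h" "y + a *\<^sub>R u \<in> U" for h :: "'a \<Rightarrow> real" and y u a
  proof -
    have "((\<lambda>a. h (y + a *\<^sub>R u)) has_derivative (\<lambda>c. dder U (c *\<^sub>R u) h (y + a *\<^sub>R u))) (at a)"
      by (rule has_derivative_compose[where g=h and f="\<lambda>a. y + a *\<^sub>R u", OF _ D[OF that]])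
        (auto intro!: derivative_eq_intros)
    then show ?thesis by (simp add: lin[OF that])
  qed
  have in1: "x + a *\<^sub>R v \<in> U" if "0 \<le> a" "a \<le> s" for a using sub[of a 0] that assms(3) by simp
  have "\<exists>a\<in>{0<..<s}. \<phi> s - \<phi> 0 = (s - 0) * (dder U v f (x + a *\<^sub>R v + s *\<^sub>R w) - dder U v f (x + a *\<^sub>R v))"
  proof (rule mvt_simple[of 0 s \<phi> "\<lambda>a c. c * (dder U v f (x + a *\<^sub>R v + s *\<^sub>R w) - dder U v f (x + a *\<^sub>R v))"])
    show "0 < s" by fact
    show "(\<phi> has_derivative (\<lambda>c. c * (dder U v f (x + a *\<^sub>R v + s *\<^sub>R w) - dder U v f (x + a *\<^sub>R v)))) (at a within {0..s})"
      if "0 \<le> a" "a \<le> s" for a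
    proof -
      have "((\<lambda>a. f ((x + s *\<^sub>R w) + a *\<^sub>R v) - f (x + a *\<^sub>R v)) has_derivative
        (\<lambda>c. c * dder U v f ((x + s *\<^sub>R w) + a *\<^sub>R v) - c * dder U v f (x + a *\<^sub>R v))) (at a)"
        by (intro has_derivative_diff d1 assms(1)) (use sub[of a s] in1[of a] that assms(3) in \<open>auto simp: ac_simps\<close>)
      then show ?thesis unfolding \<phi>_def
        by (auto simp: algebra_simps intro: has_derivative_at_withinI)
    qed
  qed
  then obtain a where a: "0 < a" "a < s" "\<phi> s - \<phi> 0 = s * (dder U v f (x + a *\<^sub>R v + s *\<^sub>R w) - dder U v f (x + a *\<^sub>R v))"
    by auto
  have "\<exists>b\<in>{0<..<s}. dder U v f ((x + a *\<^sub>R v) + s *\<^sub>R w) - dder U v f ((x + a *\<^sub>R v) + 0 *\<^sub>R w) = (s - 0) * dder U w (dder U v f) ((x + a *\<^sub>R v) + b *\<^sub>R w)"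
  proof (rule mvt_simple[of 0 s "\<lambda>b. dder U v f ((x + a *\<^sub>R v) + b *\<^sub>R w)" "\<lambda>b c. c * dder U w (dder U v f) ((x + a *\<^sub>R v) + b *\<^sub>R w)"])
    show "0 < s" by fact
    show "((\<lambda>b. dder U v f ((x + a *\<^sub>R v) + b *\<^sub>R w)) has_derivative
        (\<lambda>c. c * dder U w (dder U v f) ((x + a *\<^sub>R v) + b *\<^sub>R w))) (at b within {0..s})"
      if "0 \<le> b" "b \<le> s" for b
      by (rule has_derivative_at_withinI, rule d1[OF smooth_dder[OF assms(1)]], rule sub) (use a that in auto)
  qed
  then obtain b where "0 < b" "b < s" "dder U v f (x + a *\<^sub>R v + s *\<^sub>R w) - dder U v f (x + a *\<^sub>R v) = s * dder U w (dder U v f) (x + a *\<^sub>R v + b *\<^sub>R w)"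
    by auto
  with a show ?thesis by (intro exI[of _ a] exI[of _ b]) (simp add: \<phi>_def mult.assoc)
qed

lemma dder_commute:
  fixes f :: "'a::euclidean_space \<Rightarrow> real"
  assumes f: "smooth_on U f" and U: "open U" and x: "x \<in> U"
  shows "dder U v (dder U w f) x = dder U w (dder U v f) x"
proof (rule ccontr)
  let ?P = "dder U v (dder U w f)" and ?Q = "dder U w (dder U v f)"
  assume "?P x \<noteq> ?Q x"
  define e where "e = \<bar>?P x - ?Q x\<bar> / 2"
  have "e > 0" using \<open>?P x \<noteq> ?Q x\<close> by (simp add: e_def)
  have "continuous_on U ?P" "continuous_on U ?Q" by (intro smooth_continuous smooth_dder f)+
  then have "isCont ?P x" "isCont ?Q x" using U x continuous_on_eq_continuous_at by blast+
  then obtain d1 d2 where d: "d1 > 0" "d2 > 0" "\<And>y. dist y x < d1 \<Longrightarrow> dist (?P y) (?P x) < e"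
      "\<And>y. dist y x < d2 \<Longrightarrow> dist (?Q y) (?Q x) < e"
    using \<open>e > 0\<close> unfolding continuous_at_eps_delta by metis
  obtain r where r: "r > 0" "ball x r \<subseteq> U" using U x open_contains_ball by blast
  define \<delta> where "\<delta> = min (min d1 d2) r"
  \<comment> \<open>With this side length the parallelogram spanned by s v and s w stays in the ball
    of radius \<delta>; the summand 1 keeps the denominator positive when both directions are
    zero.\<close>
  define s where "s = \<delta> / (2 * (norm v + norm w + 1))"
  have nn: "0 < norm v + norm w + 1" by (simp add: add_nonneg_pos)
  have \<delta>: "\<delta> > 0" "\<delta> \<le> d1" "\<delta> \<le> d2" "\<delta> \<le> r" using d r by (auto simp: \<delta>_def)
  have s: "s > 0" using \<delta> nn by (simp add: s_def)
  have near: "dist (x + a *\<^sub>R v + b *\<^sub>R w) x < \<delta>" if "0 \<le> a" "a \<le> s" "0 \<le> b" "b \<le> s" for a b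
  proof -
    have "dist (x + a *\<^sub>R v + b *\<^sub>R w) x \<le> norm (a *\<^sub>R v) + norm (b *\<^sub>R w)"
      using norm_triangle_ineq[of "a *\<^sub>R v" "b *\<^sub>R w"] by (simp add: dist_norm add.assoc)
    also have "\<dots> \<le> s * norm v + s * norm w" using that by (auto intro!: add_mono mult_right_mono)
    also have "\<dots> \<le> s * (norm v + norm w + 1)" using s by (simp add: algebra_simps)
    also have "\<dots> = \<delta> / 2" using nn by (simp add: s_def field_simps)
    also have "\<dots> < \<delta>" using \<delta> by simp
    finally show ?thesis .
  qed
  have sub: "x + a *\<^sub>R v + b *\<^sub>R w \<in> U" if "0 \<le> a" "a \<le> s" "0 \<le> b" "b \<le> s" for a b
    using near[OF that] \<delta> r by (auto simp: dist_commute)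
  obtain a b where ab: "0 \<le> a" "a \<le> s" "0 \<le> b" "b \<le> s"
     "f (x + s *\<^sub>R v + s *\<^sub>R w) - f (x + s *\<^sub>R v) - f (x + s *\<^sub>R w) + f x = s * s * ?Q (x + a *\<^sub>R v + b *\<^sub>R w)"
    using second_difference[OF f U s, of x v w] sub by blast
  obtain a' b' where ab': "0 \<le> a'" "a' \<le> s" "0 \<le> b'" "b' \<le> s"
     "f (x + s *\<^sub>R w + s *\<^sub>R v) - f (x + s *\<^sub>R w) - f (x + s *\<^sub>R v) + f x = s * s * ?P (x + a' *\<^sub>R w + b' *\<^sub>R v)"
  proof -
    have "x + a *\<^sub>R w + b *\<^sub>R v \<in> U" if "0 \<le> a" "a \<le> s" "0 \<le> b" "b \<le> s" for a b
      using sub[of b a] that by (simp add: algebra_simps)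
    then show ?thesis using second_difference[OF f U s, of x w v] that by blast
  qed
  have "s * s * ?Q (x + a *\<^sub>R v + b *\<^sub>R w) = s * s * ?P (x + b' *\<^sub>R v + a' *\<^sub>R w)"
    using ab(5) ab'(5) by (simp add: algebra_simps)
  then have eq: "?Q (x + a *\<^sub>R v + b *\<^sub>R w) = ?P (x + b' *\<^sub>R v + a' *\<^sub>R w)" using s by simp
  have "dist (?Q (x + a *\<^sub>R v + b *\<^sub>R w)) (?Q x) < e" "dist (?P (x + b' *\<^sub>R v + a' *\<^sub>R w)) (?P x) < e"
    using near ab ab' \<delta> d by (meson less_le_trans)+
  then have "\<bar>?P x - ?Q x\<bar> < 2 * e" unfolding eq dist_real_def by linarith
  then show False by (simp add: e_def)
qed

section \<open>Germs of smooth functions at the origin\<close>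

definition smooth_near :: "('e::euclidean_space \<Rightarrow> real) \<Rightarrow> bool" where
  "smooth_near f \<longleftrightarrow> (\<exists>U. open U \<and> 0 \<in> U \<and> smooth_on U f)"

lemma smooth_near_const: "smooth_near (\<lambda>x. c)"
  unfolding smooth_near_def by (intro exI[of _ UNIV]) (simp add: smooth_const approachable_open)

lemma smooth_near_common:
  assumes "smooth_near f" "smooth_near g"
  obtains U where "open U" "0 \<in> U" "smooth_on U f" "smooth_on U g"
proof -
  obtain U V where "open U" "0 \<in> U" "smooth_on U f" "open V" "0 \<in> V" "smooth_on V g"
    using assms unfolding smooth_near_def by auto
  then show ?thesis
    by (intro that[of "U \<inter> V"]) (auto intro: smooth_open_subset)
qed

definition germ_rel :: "('e::euclidean_space \<Rightarrow> real) \<Rightarrow> ('e \<Rightarrow> real) \<Rightarrow> bool" where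
  "germ_rel f g \<longleftrightarrow> smooth_near f \<and> smooth_near g \<and> (\<forall>\<^sub>F x in nhds 0. f x = g x)"

lemma germ_relI: "smooth_near f \<Longrightarrow> smooth_near g \<Longrightarrow> \<forall>\<^sub>F x in nhds 0. f x = g x \<Longrightarrow> germ_rel f g"
  by (simp add: germ_rel_def)

\<comment> \<open>The quotient is partial because only functions smooth near 0 represent a germ; all
  others lie outside the domain of the relation.\<close>
quotient_type (overloaded) 'e germ = "'e::euclidean_space \<Rightarrow> real" / partial: germ_rel
proof (rule part_equivpI)
  show "\<exists>f. germ_rel f (f :: 'e \<Rightarrow> real)"
    using smooth_near_const[of 0] by (auto simp: germ_rel_def)
  show "symp (germ_rel :: ('e \<Rightarrow> real) \<Rightarrow> _)" by (simp add: symp_def germ_rel_def eq_commute)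
  show "transp (germ_rel :: ('e \<Rightarrow> real) \<Rightarrow> _)"
  proof (rule transpI)
    fix f g h :: "'e \<Rightarrow> real" assume a: "germ_rel f g" "germ_rel g h"
    then have "\<forall>\<^sub>F x in nhds 0. f x = g x" "\<forall>\<^sub>F x in nhds 0. g x = h x"
      by (simp_all add: germ_rel_def)
    then have "\<forall>\<^sub>F x in nhds 0. f x = h x" by eventually_elim simp
    then show "germ_rel f h" using a by (simp add: germ_rel_def)
  qed
qed

lemma smooth_near_add: "smooth_near f \<Longrightarrow> smooth_near g \<Longrightarrow> smooth_near (\<lambda>x. f x + g x)"
  unfolding smooth_near_def[of "\<lambda>x. f x + g x"]
  by (erule (1) smooth_near_common) (blast intro: smooth_add approachable_open)

lemma smooth_near_diff: "smooth_near f \<Longrightarrow> smooth_near g \<Longrightarrow> smooth_near (\<lambda>x. f x - g x)"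
  unfolding smooth_near_def[of "\<lambda>x. f x - g x"]
  by (erule (1) smooth_near_common) (blast intro: smooth_diff approachable_open)

lemma smooth_near_mult: "smooth_near f \<Longrightarrow> smooth_near g \<Longrightarrow> smooth_near (\<lambda>x. f x * g x)"
  unfolding smooth_near_def[of "\<lambda>x. f x * g x"]
  by (erule (1) smooth_near_common) (blast intro: smooth_mult approachable_open)

lemma smooth_near_minus: "smooth_near f \<Longrightarrow> smooth_near (\<lambda>x. - f x)"
  using smooth_near_diff[OF smooth_near_const[of 0]] by simp

lemma smooth_near_frechet:
  assumes "smooth_near f" shows "smooth_near (\<lambda>x. frechet_derivative f (at x) v)"
proof -
  obtain U where U: "open U" "0 \<in> U" "smooth_on U f" using assms unfolding smooth_near_def by auto
  have "smooth_on U (dder U v f)" using U smooth_dder by blast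
  then have "smooth_on U (\<lambda>x. frechet_derivative f (at x) v)"
    using smooth_cong[of U "dder U v f" "\<lambda>x. frechet_derivative f (at x) v"] dder_open_subset(2)[OF U(1) subset_refl]
    by blast
  then show ?thesis using U unfolding smooth_near_def by auto
qed

lemma eventually_frechet_cong:
  assumes "\<forall>\<^sub>F x in nhds 0. f x = (g x :: real)"
  shows "\<forall>\<^sub>F x in nhds (0::'e::euclidean_space). frechet_derivative f (at x) v = frechet_derivative g (at x) v"
proof -
  obtain U where U: "open U" "0 \<in> U" "\<And>x. x \<in> U \<Longrightarrow> f x = g x"
    using assms unfolding eventually_nhds by auto
  have "frechet_derivative f (at x) = frechet_derivative g (at x)" if "x \<in> U" for x
  proof -
    have "(f has_derivative D) (at x) \<longleftrightarrow> (g has_derivative D) (at x)" for D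
      using has_derivative_transform_within_open[OF _ U(1) that] U(3) by metis
    then show ?thesis by (simp add: frechet_derivative_def)
  qed
  then show ?thesis using U unfolding eventually_nhds by auto
qed

lemma germ_rel_app2:
  fixes f f' g g' :: "'e::euclidean_space \<Rightarrow> real"
  assumes "\<And>f g :: 'e \<Rightarrow> real. smooth_near f \<Longrightarrow> smooth_near g \<Longrightarrow> smooth_near (\<lambda>x. op (f x) (g x))"
    and "germ_rel f f'" "germ_rel g g'"
  shows "germ_rel (\<lambda>x. op (f x) (g x)) (\<lambda>x. op (f' x) (g' x))"
proof (rule germ_relI)
  show "\<forall>\<^sub>F x in nhds 0. op (f x) (g x) = op (f' x) (g' x)"
  proof -
    have "\<forall>\<^sub>F x in nhds 0. f x = f' x" "\<forall>\<^sub>F x in nhds 0. g x = g' x"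
      using assms(2,3) by (simp_all add: germ_rel_def)
    then show ?thesis by eventually_elim simp
  qed
qed (use assms(1)[of f g] assms(1)[of f' g'] assms(2,3) in \<open>simp_all add: germ_rel_def\<close>)

section \<open>The ring of germs, its derivations, and evaluation\<close>

instantiation germ :: (euclidean_space) comm_ring_1
begin

lift_definition zero_germ :: "'a germ" is "\<lambda>_. 0"
  by (simp add: germ_rel_def smooth_near_const)
lift_definition one_germ :: "'a germ" is "\<lambda>_. 1"
  by (simp add: germ_rel_def smooth_near_const)
lift_definition plus_germ :: "'a germ \<Rightarrow> 'a germ \<Rightarrow> 'a germ" is "\<lambda>f g x. f x + g x"
  by (rule germ_rel_app2[OF smooth_near_add])
lift_definition minus_germ :: "'a germ \<Rightarrow> 'a germ \<Rightarrow> 'a germ" is "\<lambda>f g x. f x - g x"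
  by (rule germ_rel_app2[OF smooth_near_diff])
lift_definition times_germ :: "'a germ \<Rightarrow> 'a germ \<Rightarrow> 'a germ" is "\<lambda>f g x. f x * g x"
  by (rule germ_rel_app2[OF smooth_near_mult])
lift_definition uminus_germ :: "'a germ \<Rightarrow> 'a germ" is "\<lambda>f x. - f x"
  by (simp add: germ_rel_def smooth_near_minus)

lemmas smooth_near_intros = smooth_near_add smooth_near_diff smooth_near_mult smooth_near_minus smooth_near_const

instance
proof
  fix a b c :: "'a germ"
  show "a + b + c = a + (b + c)"
    by transfer (auto simp: germ_rel_def add.assoc intro!: smooth_near_intros)
  show "a + b = b + a"
    by transfer (auto simp: germ_rel_def add.commute intro!: smooth_near_intros)
  show "0 + a = a"
    by transfer (auto simp: germ_rel_def)
  show "a * b * c = a * (b * c)"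
    by transfer (auto simp: germ_rel_def mult.assoc intro!: smooth_near_intros)
  show "a * b = b * a"
    by transfer (auto simp: germ_rel_def mult.commute intro!: smooth_near_intros)
  show "1 * a = a"
    by transfer (auto simp: germ_rel_def)
  show "(a + b) * c = a * c + b * c"
    by transfer (auto simp: germ_rel_def distrib_right intro!: smooth_near_intros)
  show "- a + a = 0"
    by transfer (auto simp: germ_rel_def intro!: smooth_near_intros)
  show "a - b = a + - b"
    by transfer (auto simp: germ_rel_def intro!: smooth_near_intros)
  show "(0::'a germ) \<noteq> 1"
    by transfer (simp add: germ_rel_def)
qed

end

lift_definition gD :: "'e::euclidean_space \<Rightarrow> 'e germ \<Rightarrow> 'e germ" is "\<lambda>v f x. frechet_derivative f (at x) v"
  unfolding germ_rel_def by (blast intro: smooth_near_frechet eventually_frechet_cong)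

lift_definition ev :: "'e::euclidean_space germ \<Rightarrow> real" is "\<lambda>f. f 0"
  unfolding germ_rel_def by (blast dest: eventually_nhds_x_imp_x)

lemma ev_simps: "ev (a + b) = ev a + ev b" "ev (a * b) = ev a * ev b" "ev 0 = 0" "ev 1 = 1"
    "ev (a - b) = ev a - ev b" "ev (- a) = - ev a"
  by (transfer, simp)+

lemma ev_sum: "ev (sum f I) = (\<Sum>i\<in>I. ev (f i))"
  by (induction I rule: infinite_finite_induct) (auto simp: ev_simps)

lemma germ_two_cancel: "a + a = 0 \<Longrightarrow> a = (0 :: 'e::euclidean_space germ)"
  by transfer (simp add: germ_rel_def)

lemma eventually_smooth:
  assumes "smooth_near f"
  shows "\<forall>\<^sub>F x in nhds 0. (f has_derivative frechet_derivative f (at x)) (at x)"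
proof -
  obtain U where U: "open U" "0 \<in> U" "smooth_on U f" using assms unfolding smooth_near_def by auto
  have "(f has_derivative frechet_derivative f (at x)) (at x)" if "x \<in> U" for x
  proof -
    have "f differentiable (at x within U)"
      using smooth_differentiable[OF U(3)] that unfolding differentiable_on_def by blast
    then show ?thesis
      unfolding at_within_open[OF that U(1)] frechet_derivative_works .
  qed
  then show ?thesis using U(1,2) unfolding eventually_nhds by blast
qed

lemma derivation_gD: "derivation (gD v)"
  unfolding derivation_def
proof (intro allI conjI)
  fix a b :: "'a germ"
  show "gD v (a + b) = gD v a + gD v b"
  proof transfer
    fix v and f g :: "'a \<Rightarrow> real" assume "germ_rel f f" "germ_rel g g"
    then have s: "smooth_near f" "smooth_near g" by (auto simp: germ_rel_def)
    have "\<forall>\<^sub>F x in nhds 0. frechet_derivative (\<lambda>x. f x + g x) (at x) v = frechet_derivative f (at x) v + frechet_derivative g (at x) v"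
      using eventually_smooth[OF s(1)] eventually_smooth[OF s(2)]
      by eventually_elim (simp add: frechet_derivative_at[symmetric, OF has_derivative_add])
    then show "germ_rel (\<lambda>x. frechet_derivative (\<lambda>x. f x + g x) (at x) v)
         (\<lambda>x. frechet_derivative f (at x) v + frechet_derivative g (at x) v)"
      using s by (intro germ_relI smooth_near_frechet smooth_near_add)
  qed
  show "gD v (a * b) = gD v a * b + a * gD v b"
  proof transfer
    fix v and f g :: "'a \<Rightarrow> real" assume "germ_rel f f" "germ_rel g g"
    then have s: "smooth_near f" "smooth_near g" by (auto simp: germ_rel_def)
    have "\<forall>\<^sub>F x in nhds 0. frechet_derivative (\<lambda>x. f x * g x) (at x) v
        = frechet_derivative f (at x) v * g x + f x * frechet_derivative g (at x) v"
      using eventually_smooth[OF s(1)] eventually_smooth[OF s(2)]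
      by eventually_elim (simp add: frechet_derivative_at[symmetric, OF has_derivative_mult])
    then show "germ_rel (\<lambda>x. frechet_derivative (\<lambda>x. f x * g x) (at x) v)
         (\<lambda>x. frechet_derivative f (at x) v * g x + f x * frechet_derivative g (at x) v)"
      using s by (intro germ_relI smooth_near_frechet smooth_near_add smooth_near_mult)
  qed
qed

lemma gD_commute: "gD v (gD w a) = gD w (gD v a)"
proof transfer
  fix v w and f :: "'a \<Rightarrow> real" assume "germ_rel f f"
  then have s: "smooth_near f" by (auto simp: germ_rel_def)
  then obtain U where U: "open U" "0 \<in> U" "smooth_on U f" unfolding smooth_near_def by auto
  have "frechet_derivative (\<lambda>x. frechet_derivative f (at x) w) (at x) v = dder U v (dder U w f) x" if "x \<in> U" for x v w
    unfolding dder_open_subset(2)[OF U(1) subset_refl that, symmetric]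
    by (rule dder_cong[OF that]) (simp add: dder_open_subset(2)[OF U(1) subset_refl])
  then have "\<forall>\<^sub>F x in nhds 0. frechet_derivative (\<lambda>x. frechet_derivative f (at x) w) (at x) v
      = frechet_derivative (\<lambda>x. frechet_derivative f (at x) v) (at x) w"
    unfolding eventually_nhds using U dder_commute[OF U(3,1)] by auto
  then show "germ_rel (\<lambda>x. frechet_derivative (\<lambda>x. frechet_derivative f (at x) w) (at x) v)
        (\<lambda>x. frechet_derivative (\<lambda>x. frechet_derivative f (at x) v) (at x) w)"
    using s by (intro germ_relI smooth_near_frechet)
qed

lemma Ck_translate:
  assumes "open U" "Ck_on k U f" shows "Ck_on k {y. p + y \<in> U} (\<lambda>y. f (p + y))"
  using assms(2)
proof (induction k arbitrary: f)
  case 0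
  then have "continuous_on U f" by simp
  then have "continuous_on {y. p + y \<in> U} (\<lambda>y. f (p + y))"
    by (rule continuous_on_compose2) (auto intro: continuous_intros)
  then show ?case by simp
next
  case (Suc k)
  have o: "open {y. p + y \<in> U}"
    using open_vimage[OF assms(1), of "(+) p"] by (simp add: vimage_def continuous_on_add)
  show ?case
  proof (rule Ck_SucI[OF approachable_open[OF o]])
    show "((\<lambda>y. f (p + y)) has_derivative (\<lambda>v. dder U v f (p + x))) (at x within {y. p + y \<in> U})"
      if "x \<in> {y. p + y \<in> U}" for x
      by (rule has_derivative_in_compose2[where g=f and f="\<lambda>y. p + y" and t=U])
        (use that Suc.prems in \<open>auto simp: Ck_Suc intro!: derivative_eq_intros dder_has_derivative\<close>)
    show "Ck_on k {y. p + y \<in> U} (\<lambda>x. dder U v f (p + x))" for v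
      using Suc.prems[unfolded Ck_Suc] Suc.IH by blast
  qed
qed

text \<open>A type cannot depend on the base point. Translation to the origin lets germs at all
  points live in one ring type.\<close>

definition germ_at :: "'e::euclidean_space \<Rightarrow> ('e \<Rightarrow> real) \<Rightarrow> 'e germ" where
  "germ_at p f = abs_germ (\<lambda>y. f (p + y))"

context
  fixes U :: "'e::euclidean_space set" and p :: 'e
  assumes U: "open U" and p: "p \<in> U"
begin

lemma open_shift: "open {y. p + y \<in> U}" "0 \<in> {y. p + y \<in> U}"
  using open_vimage[OF U, of "(+) p"] p by (simp_all add: vimage_def continuous_on_add)

lemma smooth_near_shift: "smooth_on U f \<Longrightarrow> smooth_near (\<lambda>y. f (p + y))"
  unfolding smooth_near_def smooth_on_def using open_shift Ck_translate[OF U] by blast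

lemma germ_rel_shift: "smooth_on U f \<Longrightarrow> germ_rel (\<lambda>y. f (p + y)) (\<lambda>y. f (p + y))"
  by (simp add: germ_rel_def smooth_near_shift)

lemma abs_eq: "germ_rel f g \<Longrightarrow> abs_germ f = abs_germ g"
  using Quotient_germ Quotient_rel_abs by metis

lemma germ_at_cong: "smooth_on U f \<Longrightarrow> (\<And>x. x \<in> U \<Longrightarrow> f x = g x) \<Longrightarrow> germ_at p f = germ_at p g"
  unfolding germ_at_def
  using smooth_cong[of U f g] open_shift
  by (intro abs_eq germ_relI smooth_near_shift) (auto simp: eventually_nhds)

lemma germ_at_add: "smooth_on U f \<Longrightarrow> smooth_on U g \<Longrightarrow> germ_at p (\<lambda>x. f x + g x) = germ_at p f + germ_at p g"
  and germ_at_diff: "smooth_on U f \<Longrightarrow> smooth_on U g \<Longrightarrow> germ_at p (\<lambda>x. f x - g x) = germ_at p f - germ_at p g"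
  and germ_at_mult: "smooth_on U f \<Longrightarrow> smooth_on U g \<Longrightarrow> germ_at p (\<lambda>x. f x * g x) = germ_at p f * germ_at p g"
  and germ_at_minus: "smooth_on U f \<Longrightarrow> germ_at p (\<lambda>x. - f x) = - germ_at p f"
  and germ_at_0: "germ_at p (\<lambda>x. 0) = 0" and germ_at_1: "germ_at p (\<lambda>x. 1) = 1"
  unfolding germ_at_def
  by (simp_all add: plus_germ.abs_eq minus_germ.abs_eq times_germ.abs_eq uminus_germ.abs_eq
      zero_germ.abs_eq one_germ.abs_eq germ_rel_shift)

lemma germ_at_sum: "(\<And>i. i \<in> I \<Longrightarrow> smooth_on U (f i)) \<Longrightarrow> germ_at p (\<lambda>x. \<Sum>i\<in>I. f i x) = (\<Sum>i\<in>I. germ_at p (f i))"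
  by (induction I rule: infinite_finite_induct)
    (auto simp: germ_at_0 germ_at_add smooth_sum approachable_open U)

lemma ev_germ_at: "smooth_on U f \<Longrightarrow> ev (germ_at p f) = f p"
  by (simp add: germ_at_def ev.abs_eq germ_rel_shift)

lemma gD_germ_at:
  assumes "smooth_on U f" shows "gD v (germ_at p f) = germ_at p (dder U v f)"
proof -
  have "frechet_derivative (\<lambda>y. f (p + y)) (at x) v = dder U v f (p + x)" if "p + x \<in> U" for x
  proof -
    have "(f has_derivative (\<lambda>v. dder U v f (p + x))) (at (p + x))"
      using smooth_has_derivative[OF assms that] at_within_open[OF that U] by simp
    then have "((\<lambda>y. f (p + y)) has_derivative (\<lambda>v. dder U v f (p + x))) (at x)"
      by (rule has_derivative_compose[where f="\<lambda>y. p + y", rotated]) (auto intro!: derivative_eq_intros)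
    then show ?thesis by (simp add: frechet_derivative_at[symmetric])
  qed
  then have "germ_rel (\<lambda>x. frechet_derivative (\<lambda>y. f (p + y)) (at x) v) (\<lambda>x. dder U v f (p + x))"
    using open_shift assms
    by (intro germ_relI smooth_near_frechet smooth_near_shift smooth_dder) (auto simp: eventually_nhds)
  then show ?thesis
    unfolding germ_at_def using abs_eq by (simp add: gD.abs_eq germ_rel_shift assms)
qed

end

section \<open>The volume density\<close>

text \<open>Jacobi's formula, for an arbitrary derivation: write \<open>d A = W A\<close> and expand the determinant
  row by row.\<close>

lemma prod_replace:
  fixes f :: "'n::finite \<Rightarrow> 'r::comm_ring_1"
  assumes "derivation d"
  shows "d (\<Prod>i\<in>I. f i) = (\<Sum>k\<in>I. \<Prod>i\<in>I. if i = k then d (f i) else f i)"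
proof (induction I rule: infinite_finite_induct)
  case (insert x I)
  have "(\<Prod>i\<in>I. if i = x then d (f i) else f i) = (\<Prod>i\<in>I. f i)"
    by (rule prod.cong) (use insert in auto)
  moreover have "(\<Sum>k\<in>I. (if x = k then d (f x) else f x) * (\<Prod>i\<in>I. if i = k then d (f i) else f i))
    = f x * (\<Sum>k\<in>I. \<Prod>i\<in>I. if i = k then d (f i) else f i)"
    unfolding sum_distrib_left by (rule sum.cong) (use insert in auto)
  ultimately show ?case
    using insert by (simp add: derivationD[OF assms])
qed (simp_all add: derivationD[OF assms])

lemma derivation_det:
  fixes A :: "'r::comm_ring_1^'n::finite^'n"
  assumes "derivation d"
  shows "d (det A) = (\<Sum>k\<in>UNIV. det (\<chi> i. if i = k then (\<chi> j. d (A $ i $ j)) else A $ i))"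
proof -
  have o: "d (of_int z) = 0" for z
    by (cases z) (simp_all add: derivationD[OF assms] of_nat_derivation[OF assms] del: of_nat_Suc)
  have "d (det A) = (\<Sum>p | p permutes UNIV. of_int (sign p) * (\<Sum>k\<in>UNIV. \<Prod>i\<in>UNIV. if i = k then d (A $ i $ p i) else A $ i $ p i))"
    by (simp add: det_def derivationD[OF assms] o prod_replace[OF assms])
  also have "\<dots> = (\<Sum>k\<in>UNIV. \<Sum>p | p permutes UNIV. of_int (sign p) * (\<Prod>i\<in>UNIV. if i = k then d (A $ i $ p i) else A $ i $ p i))"
    unfolding sum_distrib_left by (rule sum.swap)
  also have "\<dots> = (\<Sum>k\<in>UNIV. det (\<chi> i. if i = k then (\<chi> j. d (A $ i $ j)) else A $ i))"
    unfolding det_def by (intro sum.cong refl arg_cong2[of _ _ _ _ "(*)"] prod.cong) auto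
  finally show ?thesis .
qed

lemma jacobi_formula:
  fixes A B :: "'r::comm_ring_1^'n::finite^'n"
  assumes d: "derivation d" and BA: "B ** A = mat 1"
  shows "d (det A) = det A * (SS i. SS j. B $ i $ j * d (A $ j $ i))"
proof -
  define W where "W k m = (SS j. d (A $ k $ j) * B $ j $ m)" for k m
  have row: "d (A $ k $ j) = (SS m. W k m * A $ m $ j)" for k j
  proof -
    have "(SS m. W k m * A $ m $ j) = (SS l. d (A $ k $ l) * (SS m. B $ l $ m * A $ m $ j))"
      unfolding W_def sum_distrib_left sum_distrib_right by (rule usum2) (simp add: mult_ac)
    moreover have "(SS m. B $ l $ m * A $ m $ j) = (if l = j then 1 else 0)" for l
      using arg_cong[OF BA, of "\<lambda>M. M $ l $ j"] by (simp add: matrix_matrix_mult_def mat_def)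
    ultimately show ?thesis by simp
  qed
  have "det (\<chi> i. if i = k then (\<chi> j. d (A $ i $ j)) else A $ i) = W k k * det A" for k
  proof -
    have "det (\<chi> i. if i = k then (\<chi> j. d (A $ i $ j)) else A $ i)
        = det ((\<chi> i. if i = k then sum (\<lambda>m. W k m *s A $ m) UNIV else A $ i))"
      by (rule arg_cong[where f=det]) (simp add: vec_eq_iff row)
    also have "\<dots> = (SS m. det (\<chi> i. if i = k then W k m *s A $ m else A $ i))"
      by (rule det_linear_row_sum) simp
    also have "\<dots> = (SS m. W k m * det (\<chi> i. if i = k then A $ m else A $ i))"
      by (simp add: det_row_mul)
    \<comment> \<open>Replacing row k by row m leaves two equal rows unless m = k, so only the
      diagonal of \<open>W\<close> contributes.\<close>
    also have "\<dots> = (SS m. W k m * (if m = k then det A else 0))"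
    proof (rule sum.cong[OF refl])
      fix m
      have "det (\<chi> i. if i = k then A $ m else A $ i) = 0" if "m \<noteq> k"
        by (rule det_identical_rows[OF that]) (simp add: row_def that vec_eq_iff)
      moreover have "(\<chi> i. if i = k then A $ k else A $ i) = A" by (simp add: vec_eq_iff)
      ultimately show "W k m * det (\<chi> i. if i = k then A $ m else A $ i) = W k m * (if m = k then det A else 0)"
        by auto
    qed
    also have "\<dots> = W k k * det A" by (simp add: if_distrib[of "\<lambda>x. _ * x"] cong: if_cong)
    finally show ?thesis .
  qed
  then have "d (det A) = (SS k. W k k) * det A"
    by (simp add: derivation_det[OF d] sum_distrib_right)
  also have "(SS k. W k k) = (SS i. SS j. B $ i $ j * d (A $ j $ i))"
    unfolding W_def by (rule usum2) (simp add: mult_ac)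
  finally show ?thesis by (simp add: mult.commute)
qed

section \<open>Derivatives of the Riemannian volume density\<close>

context levi_civita
begin

text \<open>\<open>W\<close> stands for the square root of det g. Jacobi's formula gives d (W W),
  and one factor \<open>W\<close> is cancelled with the help of the inverse \<open>Wi\<close>, as
  the ring has no division.\<close>

lemma derivation_volume:
  assumes d: "derivation d" and W: "W * W = det gm" "W * Wi = 1"
  shows "d W + d W = W * (SS i. SS j. h i j * d (g i j))"
proof -
  have "d (det gm) = det gm * (SS i. SS j. h i j * d (g i j))"
    unfolding jacobi_formula[OF d hm_gm] by (simp add: gm_def hm_def g_sym)
  then have "d W * W + W * d W = (W * W) * (SS i. SS j. h i j * d (g i j))"
    unfolding W(1)[symmetric] derivationD(2)[OF d] .
  then have "(d W * W + W * d W) * Wi = (W * W) * (SS i. SS j. h i j * d (g i j)) * Wi" by simp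
  moreover have "(d W * W + W * d W) * Wi = (d W + d W) * (W * Wi)" by (simp add: algebra_simps)
  moreover have "(W * W) * X * Wi = W * X * (W * Wi)" for X by (simp add: algebra_simps)
  ultimately show ?thesis by (simp only: W(2) mult_1_right)
qed

lemma D_volume:
  assumes W: "W * W = det gm" "W * Wi = 1"
  shows "D k W = W * (SS m. \<Gamma> m m k)"
proof -
  have "(SS i. SS j. h i j * D k (g i j)) = (SS m. \<Gamma> m m k) + (SS m. \<Gamma> m m k)"
  proof -
    have 1: "(SS i. SS j. h i j * (SS m. \<Gamma> m k i * g m j)) = (SS m. \<Gamma> m m k)"
    proof -
      have "(SS i. SS j. h i j * (SS m. \<Gamma> m k i * g m j)) = (SS i. SS m. \<Gamma> m k i * (SS j. h i j * g j m))"
        unfolding sum_distrib_left by (rule sum.cong[OF refl], rule usum2) (simp add: mult_ac g_sym)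
      then show ?thesis by (simp add: hg \<Gamma>_sym[of _ k])
    qed
    have "(SS i. SS j. h i j * (SS m. \<Gamma> m k j * g m i)) = (SS i. SS j. h i j * (SS m. \<Gamma> m k i * g m j))"
      by (rule usum2) (simp add: h_sym)
    with 1 show ?thesis by (simp add: Dg sum.distrib distrib_left)
  qed
  then have "D k W + D k W = W * (SS m. \<Gamma> m m k) + W * (SS m. \<Gamma> m m k)"
    using derivation_volume[OF D_deriv W] by (simp add: distrib_left)
  then show ?thesis by (rule two_cancel')
qed

lemma Lap_volume:
  assumes W: "W * W = det gm" "W * Wi = 1"
  shows "W * Lap y = (SS i. D i (W * grad y i))"
  by (simp add: Lap_div Div_def D_simps D_volume[OF W] distrib_left sum.distrib sum_distrib_left
      sum_distrib_right mult_ac)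

end

lemma (in ricci_flow_jet) T_volume:
  assumes W: "W * W = det gm" "W * Wi = 1"
  shows "T W = - (Scal * W)"
proof -
  have "(SS i. SS j. h i j * T (g i j)) = - (Scal + Scal)"
    by (simp only: Tg mult_minus_right sum_negf distrib_left sum.distrib Scal_def)
  then have "T W + T W = - (Scal * W) + - (Scal * W)"
    unfolding derivation_volume[OF T_deriv W] by (simp add: algebra_simps)
  then show ?thesis by (rule two_cancel')
qed

text \<open>The trace of a product of two positive semidefinite matrices is nonnegative; rank one pieces
  are split off \<open>h\<close> one row at a time.\<close>

lemma psd_pairing_nonneg:
  fixes h K :: "'n::finite \<Rightarrow> 'n \<Rightarrow> real"
  assumes "\<And>i j. h i j = h j i" "\<And>x. (SS i. SS j. x i * h i j * x j) \<ge> 0"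
    and K: "\<And>x. (SS i. SS j. x i * K i j * x j) \<ge> 0"
  shows "(SS i. SS j. h i j * K i j) \<ge> 0"
proof -
  have e0: "(SS j. F j * (s * of_bool (j = a))) = s * F a" "(SS j. s * of_bool (j = a) * F j) = s * F a"
    for F :: "'n \<Rightarrow> real" and s a
    by (simp_all add: of_bool_def if_distrib[of "\<lambda>x. _ * x"] if_distrib[of "\<lambda>x. x * _"] cong: if_cong)
  show ?thesis
  using assms(1,2)
\<comment> \<open>The measure is the number of nonzero diagonal entries. A semidefinite matrix whose
  diagonal vanishes is zero, and each split removes at least one entry.\<close>
proof (induction "card {i. h i i \<noteq> 0}" arbitrary: h rule: less_induct)
  case less
  have two: "(SS i. SS j. (s * of_bool (i = a) + r * of_bool (i = b)) * h i j * (s * of_bool (j = a) + r * of_bool (j = b)))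
     = s * s * h a a + 2 * s * r * h a b + r * r * h b b" if "\<And>i j. h i j = h j i"
     for s r :: real and a b and h :: "'n \<Rightarrow> 'n \<Rightarrow> real"
  proof -
    have e: "(SS j. F j * (s * of_bool (j = a) + r * of_bool (j = b))) = s * F a + r * F b"
       "(SS j. (s * of_bool (j = a) + r * of_bool (j = b)) * F j) = s * F a + r * F b" for F :: "'n \<Rightarrow> real" and s r a b
      by (simp_all add: e0 distrib_left distrib_right sum.distrib)
    have "(SS i. SS j. (s * of_bool (i = a) + r * of_bool (i = b)) * h i j * (s * of_bool (j = a) + r * of_bool (j = b)))
      = (SS i. (s * of_bool (i = a) + r * of_bool (i = b)) * (SS j. h i j * (s * of_bool (j = a) + r * of_bool (j = b))))"
      by (simp only: sum_distrib_left mult.assoc)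
    then show ?thesis unfolding e using that[of a b] by (simp add: algebra_simps)
  qed
  have two': "0 \<le> s * s * h a a + 2 * s * r * h a b + r * r * h b b" for s r a b
    using less.prems(2)[of "\<lambda>k. s * of_bool (k = a) + r * of_bool (k = b)"]
    unfolding two[OF less.prems(1), where s=s and r=r and a=a and b=b] .
  have diag: "h i i \<ge> 0" for i using two'[of 1 i 0 i] by simp
  have off: "h i j = 0" if "h i i = 0" for i j
  proof (rule ccontr)
    assume ne: "h i j \<noteq> 0"
    \<comment> \<open>With this s the quadratic form takes the value -1 at s e_i + e_j.\<close>
    define s where "s = - (h j j + 1) / (2 * h i j)"
    have "2 * s * h i j = - (h j j + 1)" using ne by (simp add: s_def)
    then show False
      using two'[of s i 1 j] that by simp
  qed
  show ?case
  proof (cases "\<exists>a. h a a \<noteq> 0")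
    case False
    then show ?thesis using off by simp
  next
    case True
    then obtain a where a: "h a a > 0" using diag by (metis order_le_less)
    \<comment> \<open>The Schur complement of the entry a a: subtracting this rank one matrix clears
      row and column a and keeps semidefiniteness.\<close>
    define h' where "h' i j = h i j - h i a * h j a / h a a" for i j
    have "(SS i. SS j. h' i j * K i j) \<ge> 0"
    proof (rule less.hyps)
      have "{i. h' i i \<noteq> 0} \<subset> {i. h i i \<noteq> 0}"
      proof
        show "{i. h' i i \<noteq> 0} \<subseteq> {i. h i i \<noteq> 0}" unfolding h'_def using off by fastforce
        have "h' a a = 0" unfolding h'_def using a by simp
        moreover have "h a a \<noteq> 0" using a by simp
        ultimately show "{i. h' i i \<noteq> 0} \<noteq> {i. h i i \<noteq> 0}" by blast
      qed
      then show "card {i. h' i i \<noteq> 0} < card {i. h i i \<noteq> 0}" by (intro psubset_card_mono) auto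
      show "h' i j = h' j i" for i j unfolding h'_def using less.prems(1)[of i j] by (simp add: mult.commute)
      show "(SS i. SS j. x i * h' i j * x j) \<ge> 0" for x
      proof -
        define b where "b = (SS i. x i * h i a)"
        \<comment> \<open>This c minimises the form of \<open>h\<close> along x + c e_a. The minimum
          is the value of the form of \<open>h'\<close> at x, which is therefore
          nonnegative.\<close>
        define c where "c = - b / h a a"
        let ?y = "\<lambda>i. x i + c * of_bool (i = a)"
        have "0 \<le> (SS i. SS j. ?y i * h i j * ?y j)" by (rule less.prems(2))
        also have "\<dots> = (SS i. ?y i * (SS j. h i j * ?y j))"
          by (simp only: sum_distrib_left mult.assoc)
        also have "\<dots> = (SS i. ?y i * ((SS j. h i j * x j) + c * h i a))"
          by (simp only: distrib_left sum.distrib e0)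
        also have "\<dots> = (SS i. x i * (SS j. h i j * x j)) + (SS i. c * (x i * h i a))
            + c * ((SS j. h a j * x j) + c * h a a)"
          by (simp only: distrib_left distrib_right sum.distrib e0) (simp add: mult_ac)
        also have "(SS j. h a j * x j) = b"
          unfolding b_def using less.prems(1)[of a] by (simp add: mult.commute)
        also have "(SS i. c * (x i * h i a)) = c * b" by (simp add: b_def sum_distrib_left)
        also have "(SS i. x i * (SS j. h i j * x j)) + c * b + c * (b + c * h a a)
            = (SS i. SS j. x i * h i j * x j) + c * b + c * (b + c * h a a)"
          by (simp add: sum_distrib_left mult.assoc)
        also have "\<dots> = (SS i. SS j. x i * h i j * x j) - b * b / h a a"
          using a by (simp add: c_def field_simps)
        also have "\<dots> = (SS i. SS j. x i * h' i j * x j)"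
          by (simp add: h'_def b_def algebra_simps sum_subtractf sum_distrib_left sum_distrib_right sum_divide_distrib)
             (rule usum_swap)?
        finally show ?thesis .
      qed
    qed
    moreover have "(SS i. SS j. h i a * h j a / h a a * K i j) \<ge> 0"
    proof -
      have "(SS i. SS j. h i a * h j a / h a a * K i j) = (SS i. SS j. h i a * K i j * h j a) / h a a"
        by (simp add: sum_divide_distrib mult_ac)
      then show ?thesis using K[of "\<lambda>i. h i a"] a by simp
    qed
    ultimately show ?thesis by (simp add: h'_def left_diff_distrib sum_subtractf)
  qed
qed
qed

section \<open>Ricci flow in one chart\<close>

text \<open>The segment from the identity to \<open>M\<close> consists of positive definite, hence
  invertible matrices. The determinant is continuous along it, starts at 1, and cannot change
  sign.\<close>

lemma posdef_det_pos:
  fixes M :: "real^'n^'n"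
  assumes "\<And>v. v \<noteq> 0 \<Longrightarrow> 0 < v \<bullet> (M *v v)"
  shows "det M > 0"
proof -
  define N where "N s = s *\<^sub>R M + (1 - s) *\<^sub>R mat 1" for s :: real
  have nz: "det (N s) \<noteq> 0" if s: "0 \<le> s" "s \<le> 1" for s
  proof
    assume "det (N s) = 0"
    then have "\<not> invertible (N s)" by (simp add: invertible_det_nz)
    then obtain v where v: "v \<noteq> 0" "N s *v v = 0"
      using invertible_left_inverse matrix_left_invertible_ker by metis
    have "N s *v v = s *\<^sub>R (M *v v) + (1 - s) *\<^sub>R v"
      by (simp add: N_def matrix_vector_mult_add_rdistrib flip: scaleR_matrix_vector_assoc)
    then have "v \<bullet> (N s *v v) = s * (v \<bullet> (M *v v)) + (1 - s) * (v \<bullet> v)"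
      by (simp add: inner_add_right)
    moreover have "s * (v \<bullet> (M *v v)) + (1 - s) * (v \<bullet> v) > 0"
    proof (cases "s = 0")
      case True then show ?thesis using v by simp
    next
      case False
      then have "s * (v \<bullet> (M *v v)) > 0" using s assms[OF v(1)] by simp
      then show ?thesis using s by (simp add: add_pos_nonneg)
    qed
    ultimately show False using v by simp
  qed
  have cont: "continuous_on {0..1} (\<lambda>s. det (N s))"
    unfolding N_def det_def by (intro continuous_intros)
  show ?thesis
  proof (rule ccontr)
    assume "\<not> det M > 0"
    then have "det (N 1) \<le> 0" "0 \<le> det (N 0)" by (simp_all add: N_def)
    then obtain s where "0 \<le> s" "s \<le> 1" "det (N s) = 0"
      using IVT2'[OF _ _ _ cont, of 0] by auto
    then show False using nz by blast
  qed
qed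

lemma ev_two: "ev 2 = 2"
proof -
  have "ev (1 + 1) = 1 + 1" by (simp only: ev_simps)
  then show ?thesis by simp
qed

text \<open>The directions \<open>e i\<close> are a parameter: with \<open>S\<close> a chart image
  they are the coordinate axes, with \<open>S\<close> a space-time slab they are the axes with time
  component zero, and the same formulas serve both. The inverse metric is given as data, tied to
  \<open>g\<close> by \<open>hg\<close>.\<close>

locale metric_on =
  fixes S :: "'e::euclidean_space set" and e :: "'n::finite \<Rightarrow> 'e" and g h :: "'n \<Rightarrow> 'n \<Rightarrow> 'e \<Rightarrow> real"
  assumes S: "approachable S"
    and g_smooth: "smooth_on S (g i j)" and h_smooth: "smooth_on S (h i j)"
    and g_sym: "p \<in> S \<Longrightarrow> g i j p = g j i p" and h_sym: "p \<in> S \<Longrightarrow> h i j p = h j i p"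
    and hg: "p \<in> S \<Longrightarrow> (SS k. h i k p * g k j p) = (if i = j then 1 else 0)"
    and g_pos: "p \<in> S \<Longrightarrow> v \<noteq> 0 \<Longrightarrow> 0 < v \<bullet> ((\<chi> i j. g i j p) *v v)"
begin

abbreviation "d i \<equiv> dder S (e i)"

definition "chr k i j p = (SS l. h k l p * (d i (g j l) p + d j (g i l) p - d l (g i j) p)) / 2"
definition "riem l k i j p = d i (chr l j k) p - d j (chr l i k) p
   + (SS m. chr l i m p * chr m j k p - chr l j m p * chr m i k p)"
definition "ric j k p = (SS i. riem i k i j p)"
definition "scal p = (SS i. SS j. h i j p * ric i j p)"
definition "hss u i j p = d i (d j u) p - (SS k. chr k i j p * d k u p)"
definition "lap u p = (SS i. SS j. h i j p * hss u i j p)"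
definition "nrm u p = (SS i. SS j. h i j p * (d i u p * d j u p))"
definition "vol p = sqrt (det (\<chi> i j. g i j p))"

lemmas sm = smooth_add[OF S] smooth_diff[OF S] smooth_mult[OF S] smooth_minus[OF S] smooth_sum[OF S]
  smooth_const[OF S] smooth_dder g_smooth h_smooth

lemma smooth_chr: "smooth_on S (chr k i j)"
  unfolding chr_def[abs_def] divide_inverse by (intro sm)

lemma smooth_riem: "smooth_on S (riem l k i j)"
  unfolding riem_def[abs_def] by (intro sm smooth_chr)

lemma smooth_ric: "smooth_on S (ric i j)"
  unfolding ric_def[abs_def] by (intro sm smooth_riem)

lemma smooth_scal: "smooth_on S scal"
  unfolding scal_def[abs_def] by (intro sm smooth_ric)

lemma smooth_hss: "smooth_on S u \<Longrightarrow> smooth_on S (hss u i j)"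
  unfolding hss_def[abs_def] by (intro sm smooth_chr)

lemma smooth_lap: "smooth_on S u \<Longrightarrow> smooth_on S (lap u)"
  unfolding lap_def[abs_def] by (intro sm smooth_hss)

lemma smooth_nrm: "smooth_on S u \<Longrightarrow> smooth_on S (nrm u)"
  unfolding nrm_def[abs_def] by (intro sm)

lemma det_pos: "p \<in> S \<Longrightarrow> det (\<chi> i j. g i j p) > 0"
  by (rule posdef_det_pos[OF g_pos])

lemma vol_pos: "p \<in> S \<Longrightarrow> vol p > 0"
  by (simp add: vol_def det_pos)

lemma smooth_vol: "smooth_on S vol"
  unfolding vol_def[abs_def]
  by (intro smooth_sqrt[OF S] smooth_det[OF S] det_pos) (simp_all add: g_smooth)

lemmas sms = sm smooth_chr smooth_riem smooth_ric smooth_scal smooth_hss smooth_lap smooth_nrm smooth_vol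

lemma d_g_sym: "p \<in> S \<Longrightarrow> d k (g i j) p = d k (g j i) p"
  by (rule dder_cong) (auto simp: g_sym)

lemma chr_sym: "p \<in> S \<Longrightarrow> chr k i j p = chr k j i p"
  unfolding chr_def by (simp add: d_g_sym[of p _ i j] algebra_simps)

lemma chr_lower:
  assumes p: "p \<in> S"
  shows "(SS m. chr m k i p * g m j p) = (d k (g i j) p + d i (g k j) p - d j (g k i) p) / 2"
proof -
  define X where "X l = (d k (g i l) p + d i (g k l) p - d l (g k i) p) / 2" for l
  have "(SS m. chr m k i p * g m j p) = (SS m. SS l. X l * (h l m p * g m j p))"
    unfolding chr_def X_def sum_divide_distrib sum_distrib_right
    by (simp add: h_sym[OF p] mult_ac)
  also have "\<dots> = (SS l. X l * (SS m. h l m p * g m j p))"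
    unfolding sum_distrib_left by (rule usum_swap)
  also have "\<dots> = X j" by (simp add: hg[OF p])
  finally show ?thesis by (simp add: X_def)
qed

lemma d_g: "p \<in> S \<Longrightarrow> d k (g i j) p = (SS m. chr m k i p * g m j p + chr m k j p * g m i p)"
  unfolding sum.distrib chr_lower by (simp add: d_g_sym[of p k j i] d_g_sym[of p i j k] d_g_sym[of p j i k] field_simps)

text \<open>The form of \<open>h\<close> at x is the form of \<open>g\<close> at y = h x.\<close>

lemma h_psd:
  assumes p: "p \<in> S"
  shows "(SS i. SS j. x i * h i j p * x j) \<ge> 0"
proof -
  define y where "y = (\<chi> i. SS j. h i j p * x j)"
  have gy: "((\<chi> i j. g i j p) *v y) $ i = x i" for i
  proof -
    have "((\<chi> i j. g i j p) *v y) $ i = (SS k. SS j. g i k p * h k j p * x j)"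
      by (simp add: matrix_vector_mult_def y_def sum_distrib_left mult.assoc)
    also have "\<dots> = (SS j. (SS k. h j k p * g k i p) * x j)"
      unfolding sum_distrib_right by (rule usum2) (simp add: g_sym[OF p] h_sym[OF p] mult_ac)
    finally show ?thesis by (simp add: hg[OF p])
  qed
  have "y \<bullet> ((\<chi> i j. g i j p) *v y) \<ge> 0"
    using g_pos[OF p, of y] by (cases "y = 0") auto
  moreover have "y \<bullet> ((\<chi> i j. g i j p) *v y) = (SS i. SS j. x i * h i j p * x j)"
    by (simp add: inner_vec_def gy) (simp add: y_def sum_distrib_left sum_distrib_right mult_ac)
  ultimately show ?thesis by simp
qed

context
  fixes p assumes p: "p \<in> interior S"
begin

abbreviation "gm \<equiv> germ_at p"

lemma pS: "p \<in> S" using p interior_subset by blast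

lemma sint: "smooth_on S f \<Longrightarrow> smooth_on (interior S) f"
  by (rule smooth_open_subset[OF _ open_interior interior_subset])

lemma gm_simps:
  assumes "smooth_on S f" "smooth_on S f'"
  shows "gm (\<lambda>x. f x + f' x) = gm f + gm f'" "gm (\<lambda>x. f x - f' x) = gm f - gm f'"
    "gm (\<lambda>x. f x * f' x) = gm f * gm f'"
  using assms by (simp_all add: germ_at_add[OF open_interior p] germ_at_diff[OF open_interior p]
    germ_at_mult[OF open_interior p] sint)

lemma gm_minus: "smooth_on S f \<Longrightarrow> gm (\<lambda>x. - f x) = - gm f"
  by (simp add: germ_at_minus[OF open_interior p] sint)

lemma gm_sum: "(\<And>i. i \<in> I \<Longrightarrow> smooth_on S (f i)) \<Longrightarrow> gm (\<lambda>x. \<Sum>i\<in>I. f i x) = (\<Sum>i\<in>I. gm (f i))"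
  by (rule germ_at_sum[OF open_interior p]) (rule sint)

lemma gm_cong: "smooth_on S f \<Longrightarrow> (\<And>x. x \<in> S \<Longrightarrow> f x = f' x) \<Longrightarrow> gm f = gm f'"
  using interior_subset by (intro germ_at_cong[OF open_interior p] sint) auto

text \<open>At interior points the derivative within \<open>S\<close> is the ordinary derivative, so
  the derivations on germs compute it.\<close>

lemma gm_dder:
  assumes "smooth_on S f" shows "gm (dder S v f) = gD v (gm f)"
proof -
  have "gm (dder S v f) = gm (dder (interior S) v f)"
    using dder_open_subset(1)[OF open_interior interior_subset, of _ S v f]
    by (intro germ_at_cong[OF open_interior p] sint smooth_dder assms) auto
  then show ?thesis by (simp add: gD_germ_at[OF open_interior p sint[OF assms]])
qed

lemma ev_gm: "smooth_on S f \<Longrightarrow> ev (gm f) = f p"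
  by (rule ev_germ_at[OF open_interior p sint])

lemma gm_const: "gm (\<lambda>x. 0) = 0" "gm (\<lambda>x. 1) = 1"
  by (simp_all add: germ_at_0[OF open_interior p] germ_at_1[OF open_interior p])

lemma gm_two: "gm (\<lambda>x. 2) = 2"
  using gm_simps(1)[of "\<lambda>_. 1" "\<lambda>_. 1"] by (simp add: gm_const smooth_const[OF S])

lemmas gms = gm_two gm_simps gm_minus gm_sum gm_dder gm_const

lemma germ_levi_civita:
  "levi_civita (\<lambda>i. gD (e i)) (\<lambda>i j. gm (g i j)) (\<lambda>i j. gm (h i j)) (\<lambda>k i j. gm (chr k i j))"
proof
  show "derivation (gD (e i))" for i by (rule derivation_gD)
  show "gD (e i) (gD (e j) a) = gD (e j) (gD (e i) a)" for i j a by (rule gD_commute)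
  show "a + a = 0 \<Longrightarrow> a = 0" for a :: "'e germ" by (rule germ_two_cancel)
  show "gm (g i j) = gm (g j i)" for i j by (rule gm_cong[OF g_smooth g_sym])
  show "gm (h i j) = gm (h j i)" for i j by (rule gm_cong[OF h_smooth h_sym])
  show "gm (chr k i j) = gm (chr k j i)" for k i j by (rule gm_cong[OF smooth_chr chr_sym])
  show "(SS k. gm (h i k) * gm (g k j)) = (if i = j then 1 else 0)" for i j
  proof -
    have "(SS k. gm (h i k) * gm (g k j)) = gm (\<lambda>p. SS k. h i k p * g k j p)"
      by (simp add: gms sms)
    also have "\<dots> = gm (\<lambda>p. if i = j then 1 else 0)"
      by (rule gm_cong) (simp_all add: sms hg)
    finally show ?thesis by (simp add: gm_const)
  qed
  show "gD (e k) (gm (g i j)) = (SS m. gm (chr m k i) * gm (g m j) + gm (chr m k j) * gm (g m i))" for k i j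
  proof -
    have "gD (e k) (gm (g i j)) = gm (d k (g i j))" by (simp add: gms sms)
    also have "\<dots> = gm (\<lambda>p. SS m. chr m k i p * g m j p + chr m k j p * g m i p)"
      by (rule gm_cong) (simp_all add: sms d_g)
    finally show ?thesis by (simp add: gms sms)
  qed
qed


interpretation L: levi_civita "\<lambda>i. gD (e i)" "\<lambda>i j. gm (g i j)" "\<lambda>i j. gm (h i j)" "\<lambda>k i j. gm (chr k i j)"
  by (rule germ_levi_civita)

lemma gm_riem: "gm (riem l k i j) = L.curv i j $ l $ k"
  unfolding riem_def[abs_def]
  by (simp add: gms sms L.curv_def dmat_def matrix_matrix_mult_def L.gam_def sum_subtractf)

lemma gm_ric: "gm (ric i j) = L.Ric i j"
  unfolding ric_def[abs_def] by (simp add: gms sms gm_riem L.Ric_def)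

lemma gm_scal: "gm scal = L.Scal"
  unfolding scal_def[abs_def] by (simp add: gms sms gm_ric L.Scal_def)

lemma gm_hss: "smooth_on S u \<Longrightarrow> gm (hss u i j) = L.hess (gm u) i j"
  unfolding hss_def[abs_def] by (simp add: gms sms L.hess_def)

lemma gm_lap: "smooth_on S u \<Longrightarrow> gm (lap u) = L.Lap (gm u)"
  unfolding lap_def[abs_def] by (simp add: gms sms gm_hss L.Lap_def)

lemma gm_nrm: "smooth_on S u \<Longrightarrow> gm (nrm u) = L.N (gm u)"
  unfolding nrm_def[abs_def] by (simp add: gms sms L.N_def)

lemma gm_det: "gm (\<lambda>x. det (\<chi> i j. g i j x)) = det L.gm"
proof -
  have c: "gm (\<lambda>x. of_int z * F x) = of_int z * gm F" if "smooth_on S F" "z = 1 \<or> z = -1" for z F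
    using that by (auto simp: gms)
  have pr: "gm (\<lambda>x. \<Prod>i\<in>I. F i x) = (\<Prod>i\<in>I. gm (F i)) \<and> smooth_on S (\<lambda>x. \<Prod>i\<in>I. F i x)"
    if "\<And>i. smooth_on S (F i)" for F and I :: "'n set"
    by (induction I rule: infinite_finite_induct) (simp_all add: gms sm that)
  have sg: "sign q = 1 \<or> sign q = -1" for q :: "'n \<Rightarrow> 'n" by (simp add: sign_def)
  have "gm (\<lambda>x. \<Sum>q | q permutes UNIV. of_int (sign q) * (\<Prod>i\<in>UNIV. g i (q i) x))
      = (\<Sum>q | q permutes UNIV. gm (\<lambda>x. of_int (sign q) * (\<Prod>i\<in>UNIV. g i (q i) x)))"
    by (rule gm_sum) (use pr[of "\<lambda>i. g i (q i)" UNIV for q] in \<open>simp add: sms\<close>)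
  also have "\<dots> = (\<Sum>q | q permutes UNIV. of_int (sign q) * gm (\<lambda>x. \<Prod>i\<in>UNIV. g i (q i) x))"
    using pr[of "\<lambda>i. g i (q i)" UNIV for q] by (intro sum.cong refl c sg) (simp add: sms)
  also have "\<dots> = det L.gm"
    using pr[of "\<lambda>i. g i (q i)" UNIV for q] by (simp add: det_def L.gm_def sms)
  finally show ?thesis by (simp add: det_def)
qed

lemma gm_vol: "gm vol * gm vol = det L.gm" "gm vol * gm (\<lambda>x. inverse (vol x)) = 1"
proof -
  have "gm vol * gm vol = gm (\<lambda>x. vol x * vol x)" by (simp add: gms sms)
  also have "\<dots> = gm (\<lambda>x. det (\<chi> i j. g i j x))"
    using det_pos by (intro gm_cong sms) (simp add: vol_def less_imp_le)
  finally show "gm vol * gm vol = det L.gm" by (simp add: gm_det)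
  have i: "smooth_on S (\<lambda>x. inverse (vol x))"
    using vol_pos by (intro smooth_inverse[OF S] smooth_vol) force
  have "gm vol * gm (\<lambda>x. inverse (vol x)) = gm (\<lambda>x. vol x * inverse (vol x))" by (simp add: gms sms i)
  also have "\<dots> = gm (\<lambda>x. 1)"
    using vol_pos by (intro gm_cong sms i) force
  finally show "gm vol * gm (\<lambda>x. inverse (vol x)) = 1" by (simp add: gm_const)
qed

text \<open>\<open>Lap_volume\<close>, read at the point p. In this form the Laplacian times the
  volume density is a sum of partial derivatives and can be integrated away.\<close>

lemma divergence_form:
  assumes y: "smooth_on S y"
  shows "vol p * lap y p = (SS i. d i (\<lambda>x. vol x * (SS j. h i j x * d j y x)) p)"
proof -
  have "gD (e i) (gm vol * L.grad (gm y) i) = gm (d i (\<lambda>x. vol x * (SS j. h i j x * d j y x)))" for i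
    by (simp add: gms sms y L.grad_def)
  then have "gm vol * gm (lap y) = (SS i. gm (d i (\<lambda>x. vol x * (SS j. h i j x * d j y x))))"
    by (simp add: gm_lap[OF y] L.Lap_volume[OF gm_vol])
  then have "ev (gm vol * gm (lap y)) = (SS i. ev (gm (d i (\<lambda>x. vol x * (SS j. h i j x * d j y x)))))"
    by (simp add: ev_sum)
  then show ?thesis by (simp add: ev_simps ev_gm sms y)
qed

text \<open>With q the matrix of values of \<open>Q\<close> and H that of \<open>h\<close>, the
  quantity is the entrywise pairing of H with q H q. Both matrices are positive semidefinite, so
  \<open>psd_pairing_nonneg\<close> applies.\<close>

lemma sq_nonneg:
  assumes Q: "\<And>i j. Q i j = Q j i"
  shows "ev (L.sq Q Q) \<ge> 0"
proof -
  define q where "q i j = ev (Q i j)" for i j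
  define H where "H i j = h i j p" for i j
  have evh: "ev (gm (h i j)) = H i j" for i j by (simp add: ev_gm h_smooth H_def)
  have Hs: "H i j = H j i" for i j by (simp add: H_def h_sym[OF pS])
  have qs: "q i j = q j i" for i j by (simp add: q_def Q[of i])
  define K where "K a b = (SS k. SS l. q a k * H k l * q l b)" for a b
  have "ev (L.sq Q Q) = (SS i. SS j. (SS a. H i a * q a j) * (SS b. H j b * q b i))"
    by (simp add: L.sq_def L.up_def ev_sum ev_simps evh q_def)
  also have "\<dots> = (SS i. SS j. SS a. SS b. H i a * (q a j * H j b * q b i))"
    by (simp add: sum_product mult_ac)
  also have "\<dots> = (SS i. SS a. SS j. SS b. H i a * (q a j * H j b * q b i))"
    by (rule sum.cong[OF refl], rule usum_swap)
  also have "\<dots> = (SS i. SS a. H i a * K a i)"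
    by (simp add: K_def sum_distrib_left)
  also have "\<dots> = (SS i. SS j. H i j * K i j)"
    by (rule usum2) (simp add: Hs)
  also have "\<dots> \<ge> 0"
  proof (rule psd_pairing_nonneg)
    show "H i j = H j i" for i j by (rule Hs)
    show psdH: "(SS i. SS j. x i * H i j * x j) \<ge> 0" for x unfolding H_def by (rule h_psd[OF pS])
    show "(SS i. SS j. x i * K i j * x j) \<ge> 0" for x
    proof -
      define z where "z k = (SS a. x a * q a k)" for k
      have "(SS i. SS j. x i * K i j * x j) = (SS i. SS j. SS k. SS l. (x i * q i k) * H k l * (x j * q j l))"
        by (simp add: K_def sum_distrib_left sum_distrib_right mult_ac qs)
      also have "\<dots> = (SS i. SS k. SS l. SS j. (x i * q i k) * H k l * (x j * q j l))"
        by (rule sum.cong[OF refl], rule usum3_231) simp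
      also have "\<dots> = (SS i. SS k. SS l. (x i * q i k) * H k l * z l)"
        by (simp add: z_def sum_distrib_left)
      also have "\<dots> = (SS k. SS l. SS i. (x i * q i k) * H k l * z l)"
        by (rule usum3_231) simp
      also have "\<dots> = (SS k. SS l. z k * H k l * z l)"
        by (simp add: z_def sum_distrib_right)
      finally show ?thesis using psdH by simp
    qed
  qed
  finally show ?thesis .
qed

end

end

section \<open>Perelman's inequality at interior points of space-time\<close>

locale ricci_flow_on = metric_on S e g h
  for S :: "'e::euclidean_space set" and e :: "'n::finite \<Rightarrow> 'e" and g h +
  fixes \<tau> :: 'e and u :: "'e \<Rightarrow> real"
  assumes flow: "p \<in> S \<Longrightarrow> dder S \<tau> (g i j) p = - 2 * ric i j p"
    and u: "smooth_on S u" and u_pos: "p \<in> S \<Longrightarrow> u p > 0"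
    and heat: "p \<in> S \<Longrightarrow> dder S \<tau> (\<lambda>x. u x * vol x) p = - (lap u p * vol p)"
begin

definition "pot x = - ln (u x)"
definition "perelman x = (2 * lap pot x - nrm pot x + scal x) * u x"

lemma smooth_pot: "smooth_on S pot"
  unfolding pot_def[abs_def] by (intro smooth_minus[OF S] smooth_ln[OF S] u u_pos)

lemma smooth_perelman: "smooth_on S perelman"
  unfolding perelman_def[abs_def] by (intro sms smooth_pot u)

lemma dder_pot:
  assumes p: "p \<in> S" shows "dder S v u p = - (u p * dder S v pot p)"
proof -
  have "(pot has_derivative (\<lambda>v. - (dder S v u p * inverse (u p)))) (at p within S)"
    unfolding pot_def[abs_def]
    by (rule derivative_eq_intros smooth_has_derivative[OF u p] refl u_pos[OF p])+
  from dder_eq[OF S p this] show ?thesis using u_pos[OF p] by simp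
qed

text \<open>By \<open>T_volume\<close> the left-hand side of \<open>perelman_identity\<close>,
  multiplied by the volume density, is the time derivative of the product in the statement. The
  square on the right-hand side is discarded by \<open>sq_nonneg\<close>. The assumptions on
  \<open>f\<close> and \<open>u\<close> in the identity are recovered from the flow and the heat
  equation of densities.\<close>

lemma perelman_inequality:
  assumes p: "p \<in> interior S"
  shows "dder S \<tau> (\<lambda>x. perelman x * vol x) p \<ge> - (vol p * lap perelman p)"
proof -
  note pS = pS[OF p] and gms = gms[OF p] and gm_cong = gm_cong[OF p] and gm_vol = gm_vol[OF p]
  interpret L: levi_civita "\<lambda>i. gD (e i)" "\<lambda>i j. gm p (g i j)" "\<lambda>i j. gm p (h i j)" "\<lambda>k i j. gm p (chr k i j)"
    by (rule germ_levi_civita[OF p])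
  interpret J: ricci_flow_jet "\<lambda>i. gD (e i)" "\<lambda>i j. gm p (g i j)" "\<lambda>i j. gm p (h i j)" "\<lambda>k i j. gm p (chr k i j)" "gD \<tau>"
  proof
    show "derivation (gD \<tau>)" by (rule derivation_gD)
    show "gD \<tau> (gD (e i) a) = gD (e i) (gD \<tau> a)" for i a by (rule gD_commute)
    show "gD \<tau> (gm p (g i j)) = - (L.Ric i j + L.Ric i j)" for i j
    proof -
      have "gD \<tau> (gm p (g i j)) = gm p (dder S \<tau> (g i j))" by (simp add: gms sms)
      also have "\<dots> = gm p (\<lambda>x. - (ric i j x + ric i j x))"
        by (rule gm_cong) (simp_all add: sms flow)
      finally show ?thesis by (simp only: gms sms gm_ric[OF p])
    qed
  qed
  let ?f = "gm p pot" and ?u = "gm p u" and ?W = "gm p vol"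
  have Du: "gD v ?u = - (?u * gD v ?f)" for v
  proof -
    have "gD v ?u = gm p (dder S v u)" by (simp add: gms u)
    also have "\<dots> = gm p (\<lambda>x. - (u x * dder S v pot x))"
      by (rule gm_cong) (simp_all add: sms u dder_pot)
    finally show ?thesis by (simp add: gms sms u smooth_pot)
  qed
  have "gD \<tau> (?u * ?W) = gm p (dder S \<tau> (\<lambda>x. u x * vol x))" by (simp add: gms sms u)
  also have "\<dots> = gm p (\<lambda>x. - (lap u x * vol x))"
    by (rule gm_cong) (simp_all add: sms u heat)
  finally have "gD \<tau> (?u * ?W) = - (L.Lap ?u * ?W)" by (simp add: gms sms u gm_lap[OF p])
  then have "gD \<tau> ?u * ?W - ?u * (L.Scal * ?W) = - (L.Lap ?u * ?W)"
    by (simp add: J.T_simps J.T_volume[OF gm_vol])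
  \<comment> \<open>Multiplication by the germ of 1 / vol isolates the evolution equation of
    u.\<close>
  then have "(gD \<tau> ?u * ?W - ?u * (L.Scal * ?W)) * gm p (\<lambda>x. inverse (vol x)) = - (L.Lap ?u * ?W) * gm p (\<lambda>x. inverse (vol x))"
    by simp
  then have "(gD \<tau> ?u - ?u * L.Scal) * (?W * gm p (\<lambda>x. inverse (vol x))) = - L.Lap ?u * (?W * gm p (\<lambda>x. inverse (vol x)))"
    by (simp add: algebra_simps)
  then have Tu: "gD \<tau> ?u = ?u * L.Scal - L.Lap ?u"
    unfolding gm_vol by (simp add: algebra_simps)
  have hu: "L.hess ?u i j = - (?u * L.hess ?f i j) + ?u * (gD (e i) ?f * gD (e j) ?f)" for i j
    by (simp add: L.hess_def Du L.D_simps algebra_simps sum_distrib_left sum_negf)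
  have Lapu: "L.Lap ?u = - (?u * L.Lap ?f) + ?u * L.N ?f"
    unfolding L.Lap_def L.N_def hu
    by (simp add: right_diff_distrib sum_subtractf distrib_left sum.distrib sum_distrib_left sum_negf mult_ac)
  \<comment> \<open>The germ of u is a unit, so the evolution of the potential f = - ln u can be
    solved from that of u.\<close>
  have ui: "?u * gm p (\<lambda>x. inverse (u x)) = 1"
  proof -
    have i: "smooth_on S (\<lambda>x. inverse (u x))"
      using u_pos by (intro smooth_inverse[OF S] u) force
    have "?u * gm p (\<lambda>x. inverse (u x)) = gm p (\<lambda>x. u x * inverse (u x))" by (simp add: gms sms i u)
    also have "\<dots> = gm p (\<lambda>x. 1)"
      using u_pos by (intro gm_cong sms i u) force
    finally show ?thesis by (simp add: gms)
  qed
  have "?u * gD \<tau> ?f = ?u * (- L.Lap ?f + L.N ?f - L.Scal)"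
  proof -
    have "- (?u * gD \<tau> ?f) = ?u * L.Scal - L.Lap ?u" using Tu Du[of \<tau>] by simp
    then have "?u * gD \<tau> ?f = L.Lap ?u - ?u * L.Scal" by (simp add: minus_equation_iff[of "_ * _"] eq_commute)
    then show ?thesis unfolding Lapu by (simp add: algebra_simps)
  qed
  then have "gm p (\<lambda>x. inverse (u x)) * (?u * gD \<tau> ?f) = gm p (\<lambda>x. inverse (u x)) * (?u * (- L.Lap ?f + L.N ?f - L.Scal))"
    by (simp only:)
  then have "(?u * gm p (\<lambda>x. inverse (u x))) * gD \<tau> ?f = (?u * gm p (\<lambda>x. inverse (u x))) * (- L.Lap ?f + L.N ?f - L.Scal)"
    by (simp only: mult_ac)
  then have Tf: "gD \<tau> ?f = - L.Lap ?f + L.N ?f - L.Scal" unfolding ui by simp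
  let ?w = "2 * L.Lap ?f - L.N ?f + L.Scal"
  let ?Q = "\<lambda>i j. L.Ric i j + L.hess ?f i j"
  have P: "gm p perelman = ?w * ?u"
  proof -
    have "gm p perelman = gm p (\<lambda>x. (2 * lap pot x - nrm pot x + scal x) * u x)"
      by (rule gm_cong) (simp_all add: smooth_perelman perelman_def)
    then show ?thesis by (simp add: gms sms u smooth_pot gm_lap[OF p] gm_nrm[OF p] gm_scal[OF p])
  qed
  have id: "gD \<tau> (?w * ?u) - L.Scal * (?w * ?u) = 2 * L.sq ?Q ?Q * ?u - L.Lap (?w * ?u)"
    by (rule J.perelman_identity[OF Tf Du Du])
  have "dder S \<tau> (\<lambda>x. perelman x * vol x) p = ev (gm p (dder S \<tau> (\<lambda>x. perelman x * vol x)))"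
    by (simp add: ev_gm[OF p] sms smooth_perelman)
  also have "gm p (dder S \<tau> (\<lambda>x. perelman x * vol x)) = gD \<tau> ((?w * ?u) * ?W)"
    by (simp only: gms sms smooth_perelman P)
  also have "\<dots> = (gD \<tau> (?w * ?u) - L.Scal * (?w * ?u)) * ?W"
    unfolding J.T_simps(2)[of "?w * ?u"] J.T_volume[OF gm_vol] by (simp add: algebra_simps)
  also have "\<dots> = (2 * L.sq ?Q ?Q * ?u - L.Lap (?w * ?u)) * ?W" unfolding id ..
  also have "\<dots> = (L.sq ?Q ?Q + L.sq ?Q ?Q) * ?u * ?W - gm p (lap perelman) * ?W"
    by (simp only: gm_lap[OF p smooth_perelman] P) (simp add: algebra_simps)
  also have "ev \<dots> = (ev (L.sq ?Q ?Q) + ev (L.sq ?Q ?Q)) * u p * vol p - lap perelman p * vol p"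
    by (simp add: ev_simps ev_two ev_gm[OF p] sms u smooth_perelman)
  finally have "dder S \<tau> (\<lambda>x. perelman x * vol x) p
      = (ev (L.sq ?Q ?Q) + ev (L.sq ?Q ?Q)) * u p * vol p - lap perelman p * vol p" .
  moreover have "ev (L.sq ?Q ?Q) \<ge> 0"
    by (rule sq_nonneg[OF p]) (simp add: J.Ric_sym[of i for i] L.hess_sym[of _ i for i])
  ultimately show ?thesis
    using u_pos[OF pS] vol_pos[OF pS] by (simp add: mult.commute)
qed

end

section \<open>The Riemannian volume measure\<close>

text \<open>The change of variables theorem of the library needs a well-ordered index type.\<close>

typedef 'n wo = "UNIV :: 'n set" ..

instance wo :: (finite) finite
proof
  have "finite (Abs_wo ` (UNIV :: 'a set))" by simp
  moreover have "Abs_wo ` (UNIV :: 'a set) = UNIV"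
    by (metis Rep_wo_inverse UNIV_eq_I rangeI)
  ultimately show "finite (UNIV :: 'a wo set)" by simp
qed

definition wo_index :: "'n::finite wo \<Rightarrow> nat" where
  "wo_index = (SOME f. inj f)"

lemma inj_wo_index: "inj (wo_index :: 'n::finite wo \<Rightarrow> nat)"
proof -
  have "\<exists>f :: 'n wo \<Rightarrow> nat. inj f"
    using finite_imp_inj_to_nat_seg[of "UNIV :: 'n wo set"] by auto
  then show ?thesis unfolding wo_index_def by (rule someI_ex)
qed

instantiation wo :: (finite) wellorder
begin
definition less_eq_wo :: "'a wo \<Rightarrow> 'a wo \<Rightarrow> bool" where "less_eq_wo a b \<longleftrightarrow> wo_index a \<le> wo_index b"
definition less_wo :: "'a wo \<Rightarrow> 'a wo \<Rightarrow> bool" where "less_wo a b \<longleftrightarrow> wo_index a < wo_index b"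
instance
proof
  fix P :: "'a wo \<Rightarrow> bool" and a :: "'a wo"
  assume step: "\<And>x :: 'a wo. (\<And>y. y < x \<Longrightarrow> P y) \<Longrightarrow> P x"
  show "P a"
  proof (rule measure_induct_rule[where f=wo_index])
    fix x :: "'a wo" assume "\<And>y. wo_index y < wo_index x \<Longrightarrow> P y"
    then show "P x" unfolding less_wo_def[symmetric] by (rule step)
  qed
qed (auto simp: less_eq_wo_def less_wo_def dest: injD[OF inj_wo_index])
end

definition to_wo :: "real^'n::finite \<Rightarrow> real^'n wo" where "to_wo x = (\<chi> i. x $ Rep_wo i)"
definition of_wo :: "real^'n wo \<Rightarrow> real^'n::finite" where "of_wo x = (\<chi> i. x $ Abs_wo i)"

lemma to_of_wo [simp]: "to_wo (of_wo x) = x" "of_wo (to_wo y) = y"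
  by (simp_all add: to_wo_def of_wo_def vec_eq_iff Rep_wo_inverse Abs_wo_inverse)

lemma bij_Abs_wo: "bij (Abs_wo :: 'n \<Rightarrow> 'n wo)"
  by (rule bij_betw_byWitness[where f' = Rep_wo]) (auto simp: Rep_wo_inverse Abs_wo_inverse)

lemma linear_wo: "linear to_wo" "linear of_wo"
  by (simp_all add: linear_iff to_wo_def of_wo_def vec_eq_iff)

lemmas has_derivative_wo = linear_imp_has_derivative[OF linear_wo(1)] linear_imp_has_derivative[OF linear_wo(2)]

lemma continuous_wo: "continuous_on S to_wo" "continuous_on T of_wo"
  by (intro linear_continuous_on linear_linear[THEN iffD2] linear_wo)+

lemma measurable_wo [measurable]: "to_wo \<in> borel_measurable borel" "of_wo \<in> borel_measurable borel"
  by - (rule borel_measurable_continuous_onI, rule continuous_wo)+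

text \<open>Relabelling the coordinates maps boxes to boxes with the same side lengths, and Lebesgue
  measure is determined by its values on boxes.\<close>

lemma distr_of_wo: "distr lborel borel of_wo = (lborel :: (real^'n::finite) measure)"
proof (rule lborel_eqI[symmetric])
  fix l u :: "real^'n" assume le: "\<And>b. b \<in> Basis \<Longrightarrow> l \<bullet> b \<le> u \<bullet> b"
  have lu: "l $ i \<le> u $ i" for i using le[of "axis i 1"] by (simp add: inner_axis)
  have cart: "(\<Prod>b\<in>Basis. (y - x) \<bullet> b) = (\<Prod>i\<in>UNIV. (y - x) $ i)" for x y :: "real^'k::finite"
  proof -
    have B: "Basis = (\<lambda>i. axis i (1::real)) ` (UNIV :: 'k set)" by (auto simp: Basis_vec_def)
    have i: "inj (\<lambda>i::'k. axis i (1::real))" by (simp add: inj_def axis_eq_axis)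
    show ?thesis unfolding B prod.reindex[OF i] by (simp add: inner_axis)
  qed
  have "of_wo -` box l u \<inter> space lborel = box (to_wo l) (to_wo u)"
    by (auto simp: mem_box_cart to_wo_def of_wo_def) (metis Rep_wo_inverse Abs_wo_inverse UNIV_I)+
  then have "emeasure (distr lborel borel of_wo) (box l u) = emeasure lborel (box (to_wo l) (to_wo u))"
    by (simp add: emeasure_distr)
  also have "\<dots> = (\<Prod>b\<in>Basis. (to_wo u - to_wo l) \<bullet> b)"
    using lu by (intro emeasure_lborel_box) (auto simp: Basis_vec_def inner_axis to_wo_def)
  also have "(\<Prod>b\<in>Basis. (to_wo u - to_wo l) \<bullet> b) = (\<Prod>b\<in>Basis. (u - l) \<bullet> b)"
  proof -
    have "(\<Prod>i\<in>UNIV. (u - l) $ i) = (\<Prod>i\<in>UNIV. (to_wo u - to_wo l) $ i)"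
      by (rule prod.reindex_bij_witness[of _ Rep_wo Abs_wo])
        (auto simp: to_wo_def Rep_wo_inverse Abs_wo_inverse)
    then show ?thesis unfolding cart by simp
  qed
  finally show "emeasure (distr lborel borel of_wo) (box l u) = ennreal (\<Prod>b\<in>Basis. (u - l) \<bullet> b)" .
qed simp

lemma nn_integral_of_wo:
  fixes f :: "real^'n::finite \<Rightarrow> ennreal"
  assumes "f \<in> borel_measurable borel"
  shows "(\<integral>\<^sup>+x. f x \<partial>lborel) = (\<integral>\<^sup>+x. f (of_wo x) \<partial>lborel)"
  unfolding distr_of_wo[symmetric, where 'n='n] using assms by (subst nn_integral_distr) auto

lemma det_wo:
  fixes M :: "real^'n::finite^'n"
  shows "det (\<chi> i j. M $ Rep_wo i $ Rep_wo j) = det M"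
proof -
  let ?m = "map_permutation UNIV (Abs_wo :: 'n \<Rightarrow> 'n wo)"
  have bij: "bij_betw (Abs_wo :: 'n \<Rightarrow> 'n wo) UNIV UNIV" by (rule bij_Abs_wo)
  have inj: "inj (Abs_wo :: 'n \<Rightarrow> 'n wo)" "inj (Rep_wo :: 'n wo \<Rightarrow> 'n)"
    using bij_is_inj[OF bij_Abs_wo] by (auto simp: Rep_wo_inject intro: injI)
  have app: "?m p (Abs_wo i) = Abs_wo (p i)" for p i
    by (rule map_permutation_apply[OF inj(1)]) simp
  let ?m' = "map_permutation UNIV (Rep_wo :: 'n wo \<Rightarrow> 'n)"
  have app': "?m' p (Rep_wo i) = Rep_wo (p i)" for p i
    by (rule map_permutation_apply[OF inj(2)]) simp
  have bij': "bij_betw (Rep_wo :: 'n wo \<Rightarrow> 'n) UNIV UNIV"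
    by (rule bij_betw_byWitness[where f' = Abs_wo]) (auto simp: Rep_wo_inverse Abs_wo_inverse)
  show ?thesis unfolding det_def
  proof (rule sum.reindex_bij_witness[of _ ?m ?m'])
    fix p assume p: "p \<in> {p. p permutes (UNIV :: 'n wo set)}"
    show "?m (?m' p) = p"
    proof
      fix i show "?m (?m' p) i = p i"
        using app[of "?m' p" "Rep_wo i"] by (simp add: app' Rep_wo_inverse)
    qed
    show "?m' p \<in> {p. p permutes (UNIV :: 'n set)}" using p map_permutation_permutes[OF bij', of p] by blast
    have "(\<Prod>i\<in>UNIV. M $ i $ ?m' p i) = (\<Prod>i\<in>UNIV. (\<chi> i j. M $ Rep_wo i $ Rep_wo j) $ i $ p i)"
      using prod.reindex_bij_betw[OF bij', of "\<lambda>i. M $ i $ ?m' p i"] by (simp add: app')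
    moreover have "sign (?m' p) = sign p"
      by (rule sign_map_permutation[OF inj(2)]) (use p in simp_all)
    ultimately show "of_int (sign (?m' p)) * (\<Prod>i\<in>UNIV. M $ i $ ?m' p i) =
       of_int (sign p) * (\<Prod>i\<in>UNIV. (\<chi> i j. M $ Rep_wo i $ Rep_wo j) $ i $ p i)" by simp
  next
    fix p assume p: "p \<in> {p. p permutes (UNIV :: 'n set)}"
    show "?m' (?m p) = p"
    proof
      fix i show "?m' (?m p) i = p i"
        using app'[of "?m p" "Abs_wo i"] by (simp add: app Abs_wo_inverse)
    qed
    show "?m p \<in> {p. p permutes (UNIV :: 'n wo set)}" using p map_permutation_permutes[OF bij, of p] by blast
  qed
qed

text \<open>Absolute integrability turns the change of variables theorem into a statement about
  finite values: each finite b is the value of one side iff it is the value of the other. Hence both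
  sides are also infinite together. Integrands pass through \<open>real^1\<close>, the vector-valued
  form of the theorem.\<close>

lemma nn_change_of_variables_wo:
  fixes f :: "real^'m::{finite,wellorder} \<Rightarrow> real" and \<phi> :: "real^'m::_ \<Rightarrow> real^'m::_"
  assumes W: "W \<in> sets borel" "\<phi> ` W \<in> sets borel"
    and der: "\<And>x. x \<in> W \<Longrightarrow> (\<phi> has_derivative \<phi>' x) (at x within W)" and inj: "inj_on \<phi> W"
    and f: "\<And>y. 0 \<le> f y" "(\<lambda>y. f y * indicator (\<phi> ` W) y) \<in> borel_measurable borel"
      "(\<lambda>x. \<bar>det (matrix (\<phi>' x))\<bar> * f (\<phi> x) * indicator W x) \<in> borel_measurable borel"
  shows "(\<integral>\<^sup>+y. ennreal (f y * indicator (\<phi> ` W) y) \<partial>lborel)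
       = (\<integral>\<^sup>+x. ennreal (\<bar>det (matrix (\<phi>' x))\<bar> * f (\<phi> x) * indicator W x) \<partial>lborel)"
proof -
  have cov: "((\<lambda>x. \<bar>det (matrix (\<phi>' x))\<bar> * f (\<phi> x)) has_integral b) W \<longleftrightarrow> (f has_integral b) (\<phi> ` W)" for b
  proof -
    have nn: "(h has_integral b) T \<longleftrightarrow> h absolutely_integrable_on T \<and> integral T h = b" if "\<And>x. 0 \<le> h x"
      for h :: "real^'m::_ \<Rightarrow> real" and T
      using that nonnegative_absolutely_integrable_1[of h T] set_lebesgue_integral_eq_integral(1)[of T h]
      by (auto simp: has_integral_iff)
    have "W \<in> sets lebesgue" using W(1) by simp
    from has_absolute_integral_change_of_variables[OF this der inj, of "\<lambda>x. vec (f x) :: real^1" "vec b"]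
    have "(\<lambda>x. \<bar>det (matrix (\<phi>' x))\<bar> * f (\<phi> x)) absolutely_integrable_on W \<and>
        integral W (\<lambda>x. \<bar>det (matrix (\<phi>' x))\<bar> * f (\<phi> x)) = b \<longleftrightarrow>
        f absolutely_integrable_on \<phi> ` W \<and> integral (\<phi> ` W) f = b"
      by (simp add: absolutely_integrable_on_1_iff integral_on_1_eq)
    then show ?thesis using f(1) by (subst (1 2) nn) auto
  qed
  have conv: "(\<integral>\<^sup>+y. ennreal (h y * indicator T y) \<partial>lborel) = ennreal b \<longleftrightarrow> (h has_integral b) T"
    if "b \<ge> 0" "\<And>x. 0 \<le> h x" "(\<lambda>y. h y * indicator T y) \<in> borel_measurable borel"
    for h :: "real^'m::_ \<Rightarrow> real" and T b
  proof -
    have "(h has_integral b) T \<longleftrightarrow> ((\<lambda>y. h y * indicator T y) has_integral b) UNIV"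
      by (subst has_integral_restrict_UNIV[symmetric])
        (intro arg_cong[where f="\<lambda>h. (h has_integral b) UNIV"], auto simp: indicator_def)
    also have "\<dots> \<longleftrightarrow> (\<integral>\<^sup>+y. ennreal (h y * indicator T y) \<partial>lebesgue) = ennreal b"
      using that by (subst has_integral_iff_nn_integral_lebesgue) (auto intro: measurable_completion)
    finally show ?thesis by (simp add: nn_integral_completion)
  qed
  let ?A = "(\<integral>\<^sup>+y. ennreal (f y * indicator (\<phi> ` W) y) \<partial>lborel)"
  let ?B = "(\<integral>\<^sup>+x. ennreal (\<bar>det (matrix (\<phi>' x))\<bar> * f (\<phi> x) * indicator W x) \<partial>lborel)"
  have "?A = ennreal b \<longleftrightarrow> ?B = ennreal b" if "b \<ge> 0" for b
    using conv[OF that f(1,2)] conv[OF that, of "\<lambda>x. \<bar>det (matrix (\<phi>' x))\<bar> * f (\<phi> x)" W] f cov by simp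
  then have eq: "?A = ennreal b \<longleftrightarrow> ?B = ennreal b" if "b \<ge> 0" for b using that by blast
  show ?thesis
  proof (cases ?A)
    case (real r) then show ?thesis using eq by simp
  next
    case A: top
    show ?thesis
    proof (cases ?B)
      case (real r) then show ?thesis using eq by simp
    next
      case top then show ?thesis using A by simp
    qed
  qed
qed

theorem nn_change_of_variables:
  fixes f :: "real^'n::finite \<Rightarrow> real" and \<phi> :: "real^'n \<Rightarrow> real^'n"
  assumes W: "W \<in> sets borel" "\<phi> ` W \<in> sets borel"
    and der: "\<And>x. x \<in> W \<Longrightarrow> (\<phi> has_derivative \<phi>' x) (at x within W)" and inj: "inj_on \<phi> W"
    and f: "\<And>y. 0 \<le> f y" "(\<lambda>y. f y * indicator (\<phi> ` W) y) \<in> borel_measurable borel"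
      "(\<lambda>x. \<bar>det (matrix (\<phi>' x))\<bar> * f (\<phi> x) * indicator W x) \<in> borel_measurable borel"
  shows "(\<integral>\<^sup>+y. ennreal (f y * indicator (\<phi> ` W) y) \<partial>lborel)
       = (\<integral>\<^sup>+x. ennreal (\<bar>det (matrix (\<phi>' x))\<bar> * f (\<phi> x) * indicator W x) \<partial>lborel)"
proof -
  define \<psi> where "\<psi> = (\<lambda>x. to_wo (\<phi> (of_wo x)))"
  define \<psi>' where "\<psi>' = (\<lambda>x v. to_wo (\<phi>' (of_wo x) (of_wo v)))"
  define V where "V = to_wo ` W"
  have im: "to_wo ` T = of_wo -` T" for T :: "(real^'n) set"
  proof
    show "of_wo -` T \<subseteq> to_wo ` T" using to_of_wo(1) by (metis image_eqI subsetI vimageE)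
  qed auto
  have V: "V = of_wo -` W" by (simp add: V_def im)
  have "\<psi> ` V = to_wo ` \<phi> ` W" by (simp add: \<psi>_def V_def image_image)
  then have \<psi>V: "\<psi> ` V = of_wo -` (\<phi> ` W)" by (simp add: im)
  have ind1: "indicator W (of_wo x) = (indicator V x :: real)" for x
    unfolding V by (simp add: indicator_def)
  have ind2: "indicator (\<phi> ` W) (of_wo x) = (indicator (\<psi> ` V) x :: real)" for x
    unfolding \<psi>V by (simp add: indicator_def)
  note ind = ind1 ind2
  have pre: "of_wo -` T \<in> sets borel" if "T \<in> sets borel" for T :: "(real^'n) set"
    using measurable_sets[OF measurable_wo(2) that] by simp
  have detm: "det (matrix (\<psi>' x)) = det (matrix (\<phi>' (of_wo x)))" for x
  proof -
    have "matrix (\<psi>' x) = (\<chi> i j. matrix (\<phi>' (of_wo x)) $ Rep_wo i $ Rep_wo j)"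
    proof -
      have ax: "of_wo (axis j 1 :: real^'n wo) = axis (Rep_wo j) 1" for j
        by (simp add: of_wo_def axis_def vec_eq_iff) (metis Abs_wo_inverse Rep_wo_inverse UNIV_I)
      show ?thesis unfolding matrix_def \<psi>'_def ax by (simp add: to_wo_def)
    qed
    then show ?thesis by (simp add: det_wo)
  qed
  have m1: "(\<lambda>y. f (of_wo y) * indicator (\<psi> ` V) y) \<in> borel_measurable borel"
    using measurable_compose[OF measurable_wo(2) f(2)] by (simp add: ind)
  have m2: "(\<lambda>x. \<bar>det (matrix (\<psi>' x))\<bar> * f (of_wo (\<psi> x)) * indicator V x) \<in> borel_measurable borel"
    using measurable_compose[OF measurable_wo(2) f(3)] by (simp add: ind detm \<psi>_def)
  have "(\<integral>\<^sup>+y. ennreal (f y * indicator (\<phi> ` W) y) \<partial>lborel) = (\<integral>\<^sup>+y. ennreal (f (of_wo y) * indicator (\<psi> ` V) y) \<partial>lborel)"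
    using f(2) by (subst nn_integral_of_wo) (auto simp: ind)
  also have "\<dots> = (\<integral>\<^sup>+x. ennreal (\<bar>det (matrix (\<psi>' x))\<bar> * f (of_wo (\<psi> x)) * indicator V x) \<partial>lborel)"
  proof (rule nn_change_of_variables_wo)
    show "V \<in> sets borel" unfolding V by (rule pre[OF W(1)])
    show "\<psi> ` V \<in> sets borel" unfolding \<psi>V by (rule pre[OF W(2)])
    show "inj_on \<psi> V"
    proof (rule inj_onI)
      fix x y assume "x \<in> V" "y \<in> V" "\<psi> x = \<psi> y"
      then have "of_wo x \<in> W" "of_wo y \<in> W" "to_wo (\<phi> (of_wo x)) = to_wo (\<phi> (of_wo y))"
        by (simp_all add: V \<psi>_def)
      then have "of_wo x = of_wo y" using inj to_of_wo(2) by (metis inj_onD)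
      then show "x = y" by (metis to_of_wo(1))
    qed
    show "(\<psi> has_derivative \<psi>' x) (at x within V)" if "x \<in> V" for x
      unfolding \<psi>_def \<psi>'_def
    proof (rule has_derivative_compose[OF _ has_derivative_wo(1)])
      show "((\<lambda>x. \<phi> (of_wo x)) has_derivative (\<lambda>v. \<phi>' (of_wo x) (of_wo v))) (at x within V)"
        by (rule has_derivative_in_compose2[where g=\<phi> and g'=\<phi>' and f=of_wo and t=W, OF der])
          (use that in \<open>auto simp: V intro: has_derivative_wo\<close>)
    qed
  qed (use f(1) m1 m2 in auto)
  also have "\<dots> = (\<integral>\<^sup>+x. ennreal (\<bar>det (matrix (\<phi>' x))\<bar> * f (\<phi> x) * indicator W x) \<partial>lborel)"
    using nn_integral_of_wo[of "\<lambda>x. ennreal (\<bar>det (matrix (\<phi>' x))\<bar> * f (\<phi> x) * indicator W x)"] f(3)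
    by (simp add: ind detm \<psi>_def)
  finally show ?thesis .
qed

section \<open>Charts and Borel sets of a closed manifold\<close>

locale closed_mfd =
  fixes X :: "'a topology" and A :: "('a, 'n::finite) chart set"
  assumes mfd: "closed_manifold X A"
begin

lemma chart: "c \<in> A \<Longrightarrow> is_chart X c"
  using mfd by (simp add: closed_manifold_def smooth_atlas_def)

lemma charts_cover: "(\<Union>c\<in>A. chart_dom c) = topspace X"
  using mfd by (simp add: closed_manifold_def smooth_atlas_def)

lemma dom_open: "c \<in> A \<Longrightarrow> openin X (chart_dom c)"
  and img_open: "c \<in> A \<Longrightarrow> open (chart_img c)"
  and chart_homeo: "c \<in> A \<Longrightarrow> homeomorphic_map (subtopology X (chart_dom c)) (top_of_set (chart_img c)) (chart_map c)"
  using chart by (simp_all add: is_chart_def)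

lemma dom_sub: "c \<in> A \<Longrightarrow> chart_dom c \<subseteq> topspace X"
  using dom_open openin_subset by blast

lemma chart_inj: "c \<in> A \<Longrightarrow> inj_on (chart_map c) (chart_dom c)"
  using chart_homeo[of c] dom_sub[of c] by (simp add: homeomorphic_map_def inf.absorb2)

lemma inv_map [simp]: "c \<in> A \<Longrightarrow> p \<in> chart_dom c \<Longrightarrow> chart_inv c (chart_map c p) = p"
  by (simp add: chart_inv_def chart_inj)

lemma map_inv [simp]: "x \<in> chart_img c \<Longrightarrow> chart_map c (chart_inv c x) = x"
  by (simp add: chart_inv_def chart_img_def f_inv_into_f)

lemma inv_dom [simp]: "x \<in> chart_img c \<Longrightarrow> chart_inv c x \<in> chart_dom c"
  by (simp add: chart_inv_def chart_img_def inv_into_into)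

lemma map_img [simp]: "p \<in> chart_dom c \<Longrightarrow> chart_map c p \<in> chart_img c"
  by (simp add: chart_img_def)

lemma map_image_eq: "c \<in> A \<Longrightarrow> chart_map c ` (B \<inter> chart_dom c) = {x \<in> chart_img c. chart_inv c x \<in> B}"
proof -
  assume c: "c \<in> A"
  have "x \<in> chart_map c ` (B \<inter> chart_dom c)" if "x \<in> chart_img c" "chart_inv c x \<in> B" for x
    using that by (intro image_eqI[of _ _ "chart_inv c x"]) auto
  then show ?thesis using c by auto
qed

lemma open_map_image:
  assumes "c \<in> A" "openin X O'" shows "open (chart_map c ` (O' \<inter> chart_dom c))"
proof -
  have "openin (subtopology X (chart_dom c)) (O' \<inter> chart_dom c)"
    using assms by (auto simp: openin_subtopology)
  then have "openin (top_of_set (chart_img c)) (chart_map c ` (O' \<inter> chart_dom c))"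
    using chart_homeo[OF assms(1)] homeomorphic_imp_open_map open_map_def by blast
  then show ?thesis using img_open[OF assms(1)] openin_open_trans by blast
qed

lemma open_inv_image:
  assumes "c \<in> A" "open W" shows "openin X {p \<in> chart_dom c. chart_map c p \<in> W}"
proof -
  have "continuous_map (subtopology X (chart_dom c)) (top_of_set (chart_img c)) (chart_map c)"
    using chart_homeo[OF assms(1)] homeomorphic_imp_continuous_map by blast
  moreover have "openin (top_of_set (chart_img c)) (W \<inter> chart_img c)"
    using assms(2) by (metis Int_commute openin_open)
  ultimately have "openin (subtopology X (chart_dom c)) {p \<in> topspace (subtopology X (chart_dom c)). chart_map c p \<in> W \<inter> chart_img c}"
    using openin_continuous_map_preimage by blast
  moreover have "{p \<in> topspace (subtopology X (chart_dom c)). chart_map c p \<in> W \<inter> chart_img c} = {p \<in> chart_dom c. chart_map c p \<in> W}"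
    using dom_sub[OF assms(1)] by auto
  ultimately show ?thesis using openin_trans_full dom_open[OF assms(1)] by metis
qed

definition "MX = sigma (topspace X) {U. openin X U}"

lemma open_Pow: "{U. openin X U} \<subseteq> Pow (topspace X)"
  using openin_subset by auto

lemma space_MX [simp]: "space MX = topspace X"
  by (simp add: MX_def space_measure_of open_Pow)

lemma sets_MX: "sets MX = sigma_sets (topspace X) {U. openin X U}"
  by (simp add: MX_def sets_measure_of open_Pow)

lemma open_MX [intro]: "openin X U \<Longrightarrow> U \<in> sets MX"
  by (simp add: sets_MX sigma_sets.Basic)

lemma inv_measurable: "c \<in> A \<Longrightarrow> chart_inv c \<in> restrict_space borel (chart_img c) \<rightarrow>\<^sub>M MX"
  unfolding MX_def
proof (rule measurable_measure_of[OF open_Pow])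
  assume c: "c \<in> A"
  show "chart_inv c \<in> space (restrict_space borel (chart_img c)) \<rightarrow> topspace X"
    using dom_sub[OF c] inv_dom by (auto simp: space_restrict_space)
  fix O' assume "O' \<in> {U. openin X U}"
  then have "open (chart_map c ` (O' \<inter> chart_dom c))" using open_map_image[OF c] by simp
  moreover have "chart_inv c -` O' \<inter> space (restrict_space borel (chart_img c)) = chart_map c ` (O' \<inter> chart_dom c)"
    by (auto simp: space_restrict_space map_image_eq[OF c])
  moreover have "chart_map c ` (O' \<inter> chart_dom c) \<subseteq> chart_img c" by auto
  ultimately show "chart_inv c -` O' \<inter> space (restrict_space borel (chart_img c)) \<in> sets (restrict_space borel (chart_img c))"
    using img_open[OF c] by (simp add: sets_restrict_space_iff)
qed

lemma map_measurable: "c \<in> A \<Longrightarrow> chart_map c \<in> restrict_space MX (chart_dom c) \<rightarrow>\<^sub>M borel"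
proof (rule borel_measurableI)
  fix W :: "(real^'n) set" assume c: "c \<in> A" and W: "open W"
  have "chart_map c -` W \<inter> space (restrict_space MX (chart_dom c)) = {p \<in> chart_dom c. chart_map c p \<in> W}"
    using dom_sub[OF c] by (auto simp: space_restrict_space)
  then show "chart_map c -` W \<inter> space (restrict_space MX (chart_dom c)) \<in> sets (restrict_space MX (chart_dom c))"
    using open_inv_image[OF c W] dom_open[OF c] by (subst sets_restrict_space_iff) auto
qed

lemma borel_image:
  assumes "c \<in> A" "B \<in> sets MX" shows "chart_map c ` (B \<inter> chart_dom c) \<in> sets borel"
proof -
  have "chart_inv c -` B \<inter> space (restrict_space borel (chart_img c)) \<in> sets (restrict_space borel (chart_img c))"
    by (rule measurable_sets[OF inv_measurable[OF assms(1)] assms(2)])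
  moreover have "chart_inv c -` B \<inter> space (restrict_space borel (chart_img c)) = chart_map c ` (B \<inter> chart_dom c)"
    by (auto simp: space_restrict_space map_image_eq[OF assms(1)])
  ultimately show ?thesis
    using img_open[OF assms(1)] by (simp add: sets_restrict_space_iff)
qed

lemma transition_smooth:
  assumes "c \<in> A" "d \<in> A"
  shows "smooth_on (chart_map c ` (chart_dom c \<inter> chart_dom d)) (transition c d)"
    "open (chart_map c ` (chart_dom c \<inter> chart_dom d))"
  using mfd assms open_map_image[OF assms(1) dom_open[OF assms(2)]]
  by (auto simp: closed_manifold_def smooth_atlas_def Int_commute)

end

section \<open>Existence and uniqueness of the Riemannian volume\<close>

locale riemannian_mfd = closed_mfd X A for X :: "'a topology" and A :: "('a, 'n::finite) chart set" +
  fixes g :: "('a, 'n) tensor2"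
  assumes metric: "riemannian_metric A g"
begin

definition "dens c x = sqrt (det (g c x))"

lemma metric_smooth: "c \<in> A \<Longrightarrow> smooth_on (chart_img c) (\<lambda>x. g c x $ i $ j)"
proof -
  assume c: "c \<in> A"
  have "bounded_linear (\<lambda>M::real^'n^'n. M $ i $ j)"
    by (intro bounded_linear_compose[OF bounded_linear_vec_nth bounded_linear_vec_nth])
  then show ?thesis
    using metric c smooth_linear[OF approachable_open[OF img_open[OF c]], of "\<lambda>M. M $ i $ j" "g c"]
    by (simp add: riemannian_metric_def)
qed

lemma metric_sym: "c \<in> A \<Longrightarrow> x \<in> chart_img c \<Longrightarrow> g c x $ i $ j = g c x $ j $ i"
proof -
  assume "c \<in> A" "x \<in> chart_img c"
  then have "transpose (g c x) = g c x" using metric by (simp add: riemannian_metric_def)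
  from arg_cong[OF this, of "\<lambda>M. M $ j $ i"] show ?thesis by (simp add: transpose_def)
qed

lemma metric_pos: "c \<in> A \<Longrightarrow> x \<in> chart_img c \<Longrightarrow> v \<noteq> 0 \<Longrightarrow> 0 < v \<bullet> (g c x *v v)"
  using metric by (simp add: riemannian_metric_def)

lemma metric_det_pos: "c \<in> A \<Longrightarrow> x \<in> chart_img c \<Longrightarrow> 0 < det (g c x)"
  by (rule posdef_det_pos[OF metric_pos])

lemma dens_pos: "c \<in> A \<Longrightarrow> x \<in> chart_img c \<Longrightarrow> 0 < dens c x"
  by (simp add: dens_def metric_det_pos)

lemma dens_continuous: "c \<in> A \<Longrightarrow> continuous_on (chart_img c) (dens c)"
  unfolding dens_def[abs_def] det_def
  by (intro continuous_intros smooth_continuous[OF metric_smooth])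

lemma dens_measurable: "c \<in> A \<Longrightarrow> dens c \<in> borel_measurable (restrict_space borel (chart_img c))"
  by (rule borel_measurable_continuous_on_restrict[OF dens_continuous])

lemma metric_change:
  assumes "c \<in> A" "d \<in> A" "p \<in> chart_dom c" "p \<in> chart_dom d"
  defines "J \<equiv> jacobian (transition c d) (at (chart_map c p))"
  shows "g c (chart_map c p) = transpose J ** g d (chart_map d p) ** J"
  using metric assms unfolding riemannian_metric_def tensor_transforms_def Let_def by blast

lemma dens_change:
  assumes "c \<in> A" "d \<in> A" "p \<in> chart_dom c" "p \<in> chart_dom d"
  shows "dens c (chart_map c p) = \<bar>det (jacobian (transition c d) (at (chart_map c p)))\<bar> * dens d (chart_map d p)"
  unfolding dens_def metric_change[OF assms]
  by (simp add: det_mul real_sqrt_mult)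

text \<open>The volume of one chart domain, regarded as a measure on the whole manifold that
  vanishes outside the domain.\<close>

definition "chart_measure c = distr (density (restrict_space lborel (chart_img c)) (\<lambda>x. ennreal (dens c x))) MX (chart_inv c)"

lemma emeasure_chart_measure:
  assumes c: "c \<in> A" and B: "B \<in> sets MX"
  shows "emeasure (chart_measure c) B = (\<integral>\<^sup>+x\<in>chart_map c ` (B \<inter> chart_dom c). ennreal (dens c x) \<partial>lborel)"
proof -
  let ?V = "chart_img c"
  have V: "?V \<inter> space lborel \<in> sets lborel" using img_open[OF c] by simp
  have sets: "sets (restrict_space lborel ?V) = sets (restrict_space borel ?V)" by (simp add: sets_restrict_space)
  have inv: "chart_inv c \<in> density (restrict_space lborel ?V) (\<lambda>x. ennreal (dens c x)) \<rightarrow>\<^sub>M MX"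
    using inv_measurable[OF c] by (simp cong: measurable_cong_sets add: sets)
  have dm: "(\<lambda>x. ennreal (dens c x)) \<in> borel_measurable (restrict_space lborel ?V)"
    using dens_measurable[OF c] by (simp cong: measurable_cong_sets add: sets)
  have pre: "chart_inv c -` B \<inter> ?V = chart_map c ` (B \<inter> chart_dom c)"
    by (auto simp: map_image_eq[OF c])
  have W: "chart_map c ` (B \<inter> chart_dom c) \<in> sets borel" "chart_map c ` (B \<inter> chart_dom c) \<subseteq> ?V"
    using borel_image[OF c B] by auto
  have Ws: "chart_map c ` (B \<inter> chart_dom c) \<in> sets (restrict_space lborel ?V)"
    using W V by (subst sets_restrict_space_iff) auto
  have "emeasure (chart_measure c) B = (\<integral>\<^sup>+x. ennreal (dens c x) * indicator (chart_map c ` (B \<inter> chart_dom c)) x \<partial>restrict_space lborel ?V)"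
    unfolding chart_measure_def using Ws dm
    by (subst emeasure_distr[OF inv B]) (simp add: space_restrict_space pre emeasure_density)
  also have "\<dots> = (\<integral>\<^sup>+x. ennreal (dens c x) * indicator (chart_map c ` (B \<inter> chart_dom c)) x * indicator ?V x \<partial>lborel)"
    by (rule nn_integral_restrict_space[OF V])
  also have "\<dots> = (\<integral>\<^sup>+x\<in>chart_map c ` (B \<inter> chart_dom c). ennreal (dens c x) \<partial>lborel)"
    by (rule nn_integral_cong) (use W(2) in \<open>auto simp: indicator_def\<close>)
  finally show ?thesis .
qed

lemma sets_chart_measure [simp]: "sets (chart_measure c) = sets MX" "space (chart_measure c) = topspace X"
  by (simp_all add: chart_measure_def)

text \<open>The change of variables formula for the transition map, whose Jacobian determinant is
  the factor by which \<open>dens_change\<close> relates the two densities.\<close>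

lemma chart_measure_agree:
  assumes c: "c \<in> A" and d: "d \<in> A" and B: "B \<in> sets MX" "B \<subseteq> chart_dom c" "B \<subseteq> chart_dom d"
  shows "emeasure (chart_measure c) B = emeasure (chart_measure d) B"
proof -
  let ?Oc = "chart_map c ` (chart_dom c \<inter> chart_dom d)" and ?T = "transition c d"
  let ?W = "chart_map c ` B"
  have Bc: "B \<inter> chart_dom c = B" "B \<inter> chart_dom d = B" using B by auto
  have W: "?W \<in> sets borel" "chart_map d ` B \<in> sets borel"
    using borel_image[OF c B(1)] borel_image[OF d B(1)] Bc by auto
  have T: "?T (chart_map c p) = chart_map d p" if "p \<in> B" for p
    using that B c by (auto simp: transition_def)
  have TW: "?T ` ?W = chart_map d ` B" unfolding image_image by (rule image_cong[OF refl T])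
  have der: "(?T has_derivative frechet_derivative ?T (at x)) (at x)" if "x \<in> ?W" for x
  proof -
    have "x \<in> ?Oc" using that B by auto
    then have "?T differentiable at x"
      using smooth_differentiable[OF transition_smooth(1)[OF c d]]
      unfolding differentiable_on_eq_differentiable_at[OF transition_smooth(2)[OF c d]] by blast
    then show ?thesis by (simp add: frechet_derivative_works)
  qed
  \<comment> \<open>Outside the chart image the square root of the determinant may be negative, and
    the change of variables asks for a function that is nonnegative everywhere.\<close>
  define f where "f y = (if y \<in> chart_img d then dens d y else 0)" for y
  have meas: "(\<lambda>y. dens c' y * indicator (chart_map c' ` B) y) \<in> borel_measurable borel" if "c' \<in> A" "B \<subseteq> chart_dom c'" for c'
  proof -
    have "(\<lambda>x. dens c' x * indicator (chart_map c' ` B) x) \<in> borel_measurable (restrict_space borel (chart_img c'))"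
      using dens_measurable[OF that(1)] borel_image[OF that(1) B(1)] that(2)
      by (intro borel_measurable_times) (auto simp: Int_absorb2 intro!: measurable_restrict_space1)
    then have "(\<lambda>x. indicator (chart_img c') x *\<^sub>R (dens c' x * indicator (chart_map c' ` B) x)) \<in> borel_measurable borel"
      using img_open[OF that(1)] by (subst (asm) borel_measurable_restrict_space_iff) auto
    moreover have e: "indicator (chart_img c') x *\<^sub>R (dens c' x * indicator (chart_map c' ` B) x) = dens c' x * indicator (chart_map c' ` B) x" for x
      using that(2) by (auto simp: indicator_def)
    ultimately show ?thesis unfolding e by simp
  qed
  have eq: "\<bar>det (matrix (frechet_derivative ?T (at x)))\<bar> * f (?T x) * indicator ?W x = dens c x * indicator ?W x" for x
  proof (cases "x \<in> ?W")
    case True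
    then obtain p where p: "p \<in> B" "x = chart_map c p" by auto
    then have "p \<in> chart_dom c" "p \<in> chart_dom d" using B by auto
    then show ?thesis
      using dens_change[OF c d] p T[OF p(1)] by (simp add: f_def jacobian_def)
  qed simp
  have "(\<integral>\<^sup>+y. ennreal (f y * indicator (?T ` ?W) y) \<partial>lborel)
     = (\<integral>\<^sup>+x. ennreal (\<bar>det (matrix (frechet_derivative ?T (at x)))\<bar> * f (?T x) * indicator ?W x) \<partial>lborel)"
  proof (rule nn_change_of_variables)
    show "inj_on ?T ?W"
    proof (rule inj_onI)
      fix x y assume "x \<in> ?W" "y \<in> ?W" "?T x = ?T y"
      then obtain p q where pq: "p \<in> B" "q \<in> B" "x = chart_map c p" "y = chart_map c q" by blast
      then have "chart_map d p = chart_map d q" using T \<open>?T x = ?T y\<close> by simp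
      then have "p = q" using pq B chart_inj[OF d] by (meson inj_onD subsetD)
      then show "x = y" using pq by simp
    qed
    show "0 \<le> f y" for y using dens_pos[OF d, of y] by (auto simp: f_def)
    have "f y * indicator (?T ` ?W) y = dens d y * indicator (chart_map d ` B) y" for y
      using B by (auto simp: TW f_def indicator_def)
    then show "(\<lambda>y. f y * indicator (?T ` ?W) y) \<in> borel_measurable borel" using meas[OF d B(3)] by simp
    show "(\<lambda>x. \<bar>det (matrix (frechet_derivative ?T (at x)))\<bar> * f (?T x) * indicator ?W x) \<in> borel_measurable borel"
      unfolding eq by (rule meas[OF c B(2)])
    show "(?T has_derivative frechet_derivative ?T (at x)) (at x within ?W)" if "x \<in> ?W" for x
      by (rule has_derivative_at_withinI[OF der[OF that]])
    show "?W \<in> sets borel" "?T ` ?W \<in> sets borel" using W TW by auto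
  qed
  moreover have "ennreal (f y * indicator (?T ` ?W) y) = ennreal (dens d y) * indicator (chart_map d ` B) y" for y
    using B by (auto simp: TW f_def indicator_def)
  moreover have "ennreal (dens c x * indicator ?W x) = ennreal (dens c x) * indicator ?W x" for x
    by (auto simp: indicator_def)
  ultimately show ?thesis
    by (simp add: emeasure_chart_measure[OF c B(1)] emeasure_chart_measure[OF d B(1)] Bc eq)
qed

text \<open>From a finite subcover by chart domains, each domain loses the points of the earlier
  ones. The result is a finite Borel partition subordinate to charts, so that measures can be
  compared and built piece by piece.\<close>

lemma pieces:
  obtains N :: nat and cc E where "\<And>k. k < N \<Longrightarrow> cc k \<in> A" "\<And>k. k < N \<Longrightarrow> E k \<in> sets MX"
    "\<And>k. k < N \<Longrightarrow> E k \<subseteq> chart_dom (cc k)" "disjoint_family_on E {..<N}" "(\<Union>k<N. E k) = topspace X"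
proof -
  have "compact_space X" using mfd by (simp add: closed_manifold_def)
  then obtain F where F: "finite F" "F \<subseteq> chart_dom ` A" "topspace X \<subseteq> \<Union>F"
    unfolding compact_space using dom_open charts_cover by (metis (no_types, lifting) image_iff subset_refl)
  then obtain C where C: "finite C" "C \<subseteq> A" "F = chart_dom ` C" by (metis finite_subset_image)
  obtain cs where cs: "set cs = C" using finite_list[OF C(1)] by blast
  define cc where "cc k = cs ! k" for k
  define E where "E k = chart_dom (cc k) - (\<Union>j<k. chart_dom (cc j))" for k
  have A: "cc k \<in> A" if "k < length cs" for k using that C(2) cs nth_mem unfolding cc_def by blast
  show ?thesis
  proof
    show "cc k \<in> A" if "k < length cs" for k using A that .
    show "E k \<in> sets MX" if "k < length cs" for k
      unfolding E_def using A that by (intro sets.Diff sets.finite_UN open_MX dom_open) auto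
    show "E k \<subseteq> chart_dom (cc k)" if "k < length cs" for k by (auto simp: E_def)
    show "disjoint_family_on E {..<length cs}"
      unfolding disjoint_family_on_def
    proof (intro ballI impI)
      fix m n :: nat assume "m \<noteq> n"
      then show "E m \<inter> E n = {}" by (cases m n rule: linorder_cases) (auto simp: E_def)
    qed
    show "(\<Union>k<length cs. E k) = topspace X"
    proof
      show "(\<Union>k<length cs. E k) \<subseteq> topspace X" unfolding E_def using A dom_sub by blast
      show "topspace X \<subseteq> (\<Union>k<length cs. E k)"
      proof
        fix p assume "p \<in> topspace X"
        then obtain c where "c \<in> C" "p \<in> chart_dom c" using F C by blast
        then have ex: "\<exists>k. k < length cs \<and> p \<in> chart_dom (cc k)" unfolding cc_def by (metis cs in_set_conv_nth)
        define k where "k = (LEAST k. k < length cs \<and> p \<in> chart_dom (cc k))"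
        have k: "k < length cs" "p \<in> chart_dom (cc k)" using LeastI_ex[OF ex] by (simp_all add: k_def)
        have "p \<notin> chart_dom (cc j)" if "j < k" for j
          using not_less_Least[of j "\<lambda>k. k < length cs \<and> p \<in> chart_dom (cc k)"] that k by (simp add: k_def)
        then show "p \<in> (\<Union>k<length cs. E k)" using k by (auto simp: E_def)
      qed
    qed
  qed
qed

lemma is_volume_iff:
  "is_riemannian_volume X A g \<nu> \<longleftrightarrow> sets \<nu> = sets MX \<and>
     (\<forall>c\<in>A. \<forall>B\<in>sets MX. B \<subseteq> chart_dom c \<longrightarrow> emeasure \<nu> B = emeasure (chart_measure c) B)"
proof -
  have "space \<nu> = topspace X" if "sets \<nu> = sets MX" using sets_eq_imp_space_eq[OF that] by simp
  then show ?thesis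
    unfolding is_riemannian_volume_def sets_MX[symmetric]
    by (auto simp: emeasure_chart_measure Int_absorb2 dens_def)
qed

lemma volume_sets: "is_riemannian_volume X A g \<nu> \<Longrightarrow> sets \<nu> = sets MX"
  by (simp only: is_volume_iff)

lemma volume_emeasure:
  assumes "is_riemannian_volume X A g \<nu>" "c \<in> A" "B \<in> sets MX" "B \<subseteq> chart_dom c"
  shows "emeasure \<nu> B = emeasure (chart_measure c) B"
  using assms(1)[unfolded is_volume_iff, THEN conjunct2, rule_format, OF assms(2-4)] .

text \<open>Additivity over the disjoint pieces determines a measure from its values on subsets of
  chart domains.\<close>

lemma volume_unique:
  assumes "is_riemannian_volume X A g \<nu>" "is_riemannian_volume X A g \<nu>'"
  shows "\<nu> = \<nu>'"
proof -
  obtain N :: nat and cc E where E: "\<And>k. k < N \<Longrightarrow> cc k \<in> A" "\<And>k. k < N \<Longrightarrow> E k \<in> sets MX"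
    "\<And>k. k < N \<Longrightarrow> E k \<subseteq> chart_dom (cc k)" "disjoint_family_on E {..<N}" "(\<Union>k<N. E k) = topspace X"
    by (rule pieces) (rule that)
  have *: "emeasure \<nu> B = (\<Sum>k<N. emeasure (chart_measure (cc k)) (B \<inter> E k))"
    if \<nu>: "is_riemannian_volume X A g \<nu>" and B: "B \<in> sets MX" for \<nu> B
  proof -
    have s: "sets \<nu> = sets MX" by (rule volume_sets[OF \<nu>])
    have "emeasure \<nu> B = emeasure \<nu> (\<Union>k<N. B \<inter> E k)"
      using sets.sets_into_space[OF B] E(5) by (intro arg_cong[where f="emeasure \<nu>"]) auto
    also have "\<dots> = (\<Sum>k<N. emeasure \<nu> (B \<inter> E k))"
      using E(2,4) B s by (intro sum_emeasure[symmetric]) (auto simp: disjoint_family_on_def)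
    also have "\<dots> = (\<Sum>k<N. emeasure (chart_measure (cc k)) (B \<inter> E k))"
    proof (rule sum.cong[OF refl])
      fix k assume k: "k \<in> {..<N}"
      show "emeasure \<nu> (B \<inter> E k) = emeasure (chart_measure (cc k)) (B \<inter> E k)"
      proof -
        have "B \<inter> E k \<in> sets MX" "B \<inter> E k \<subseteq> chart_dom (cc k)" "cc k \<in> A"
          using E(1-3)[of k] B k by auto
        then show ?thesis by (intro volume_emeasure[OF \<nu>])
      qed
    qed
    finally show ?thesis .
  qed
  show ?thesis
  proof (rule measure_eqI)
    show "sets \<nu> = sets \<nu>'" by (simp add: volume_sets[OF assms(1)] volume_sets[OF assms(2)])
    show "emeasure \<nu> B = emeasure \<nu>' B" if "B \<in> sets \<nu>" for B
    proof -
      have "B \<in> sets MX" using that by (simp add: volume_sets[OF assms(1)])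
      then show ?thesis by (simp only: *[OF assms(1)] *[OF assms(2)])
    qed
  qed
qed

end

context riemannian_mfd
begin

text \<open>Sum the chart measures of the pieces. For a set inside a single chart,
  \<open>chart_measure_agree\<close> replaces every summand by the measure of that chart, so the
  choice of pieces leaves no trace.\<close>

lemma volume_exists: "\<exists>\<nu>. is_riemannian_volume X A g \<nu>"
proof -
  obtain N :: nat and cc E where E: "\<And>k. k < N \<Longrightarrow> cc k \<in> A" "\<And>k. k < N \<Longrightarrow> E k \<in> sets MX"
    "\<And>k. k < N \<Longrightarrow> E k \<subseteq> chart_dom (cc k)" "disjoint_family_on E {..<N}" "(\<Union>k<N. E k) = topspace X"
    by (rule pieces) (rule that)
  define \<mu> where "\<mu> B = (\<Sum>k<N. emeasure (chart_measure (cc k)) (B \<inter> E k))" for B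
  define \<nu> where "\<nu> = measure_of (topspace X) {U. openin X U} \<mu>"
  have sets\<nu>: "sets \<nu> = sets MX" by (simp add: \<nu>_def sets_measure_of open_Pow sets_MX)
  have em: "emeasure \<nu> B = \<mu> B" if "B \<in> sets MX" for B
  proof (rule emeasure_measure_of[OF \<nu>_def])
    show "{U. openin X U} \<subseteq> Pow (topspace X)" by (rule open_Pow)
    show "B \<in> sets \<nu>" using that sets\<nu> by simp
    show "positive (sets \<nu>) \<mu>" by (simp add: positive_def \<mu>_def)
    show "countably_additive (sets \<nu>) \<mu>"
      unfolding countably_additive_def
    proof (intro allI impI)
      fix F :: "nat \<Rightarrow> 'a set" assume F: "range F \<subseteq> sets \<nu>" "disjoint_family F" "\<Union> (range F) \<in> sets \<nu>"
      have "(\<Sum>n. \<mu> (F n)) = (\<Sum>k<N. \<Sum>n. emeasure (chart_measure (cc k)) (F n \<inter> E k))"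
        unfolding \<mu>_def by (rule suminf_sum) auto
      also have "\<dots> = \<mu> (\<Union> (range F))"
        unfolding \<mu>_def
      proof (rule sum.cong[OF refl])
        fix k assume k: "k \<in> {..<N}"
        have "(\<Sum>n. emeasure (chart_measure (cc k)) (F n \<inter> E k)) = emeasure (chart_measure (cc k)) (\<Union>n. F n \<inter> E k)"
          using F(1,2) E(2)[of k] k sets\<nu> by (intro suminf_emeasure) (auto simp: disjoint_family_on_def)
        then show "(\<Sum>n. emeasure (chart_measure (cc k)) (F n \<inter> E k)) = emeasure (chart_measure (cc k)) (\<Union> (range F) \<inter> E k)"
          by simp
      qed
      finally show "(\<Sum>n. \<mu> (F n)) = \<mu> (\<Union> (range F))" .
    qed
  qed
  have "is_riemannian_volume X A g \<nu>"
    unfolding is_volume_iff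
  proof (intro conjI ballI impI)
    show "sets \<nu> = sets MX" by (rule sets\<nu>)
    fix c B assume c: "c \<in> A" and B: "B \<in> sets MX" "B \<subseteq> chart_dom c"
    have "emeasure \<nu> B = (\<Sum>k<N. emeasure (chart_measure c) (B \<inter> E k))"
      unfolding em[OF B(1)] \<mu>_def
    proof (rule sum.cong[OF refl])
      fix k assume k: "k \<in> {..<N}"
      then show "emeasure (chart_measure (cc k)) (B \<inter> E k) = emeasure (chart_measure c) (B \<inter> E k)"
        using E(1-3)[of k] B c by (intro chart_measure_agree) auto
    qed
    also have "\<dots> = emeasure (chart_measure c) (\<Union>k<N. B \<inter> E k)"
      using E(2,4) B by (intro sum_emeasure) (auto simp: disjoint_family_on_def)
    also have "(\<Union>k<N. B \<inter> E k) = B" using sets.sets_into_space[OF B(1)] E(5) by auto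
    finally show "emeasure \<nu> B = emeasure (chart_measure c) B" .
  qed
  then show ?thesis by blast
qed

definition "vol_measure = riemannian_volume X A g"

lemma vol_measure: "is_riemannian_volume X A g vol_measure"
proof -
  obtain \<nu> where \<nu>: "is_riemannian_volume X A g \<nu>" using volume_exists by (rule exE)
  show ?thesis
    unfolding vol_measure_def riemannian_volume_def
    by (rule theI[of "is_riemannian_volume X A g", OF \<nu>]) (rule volume_unique[OF _ \<nu>])
qed

lemma sets_vol [simp]: "sets vol_measure = sets MX" "space vol_measure = topspace X"
proof -
  show 1: "sets vol_measure = sets MX" by (rule volume_sets[OF vol_measure])
  show "space vol_measure = topspace X" using sets_eq_imp_space_eq[OF 1] by simp
qed

lemma chart_measure_density:
  assumes c: "c \<in> A"
  shows "chart_measure c = density vol_measure (indicator (chart_dom c))"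
proof (rule measure_eqI)
  fix B assume "B \<in> sets (chart_measure c)"
  then have B: "B \<in> sets MX" by simp
  have U: "chart_dom c \<in> sets MX" using dom_open[OF c] by auto
  have "emeasure (chart_measure c) B = emeasure (chart_measure c) (B \<inter> chart_dom c)"
    using B U by (simp add: emeasure_chart_measure[OF c])
  also have "\<dots> = emeasure vol_measure (B \<inter> chart_dom c)"
    using B U by (intro volume_emeasure[OF vol_measure c, symmetric]) auto
  also have "\<dots> = emeasure (density vol_measure (indicator (chart_dom c))) B"
  proof -
    have "(\<lambda>x. indicator (chart_dom c) x * indicator B x :: ennreal) = indicator (B \<inter> chart_dom c)"
      by (auto simp: indicator_def fun_eq_iff)
    moreover have "(indicator (chart_dom c) :: 'a \<Rightarrow> ennreal) \<in> borel_measurable vol_measure"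
      using U by (intro borel_measurable_indicator) simp
    ultimately show ?thesis using B U by (subst emeasure_density) (simp_all add: sets.Int)
  qed
  finally show "emeasure (chart_measure c) B = emeasure (density vol_measure (indicator (chart_dom c))) B" .
qed simp

context
  fixes c and f :: "'a \<Rightarrow> real"
  assumes c: "c \<in> A" and cont: "continuous_on (chart_img c) (\<lambda>x. f (chart_inv c x))"
    and out: "\<And>p. p \<in> topspace X \<Longrightarrow> p \<notin> chart_dom c \<Longrightarrow> f p = 0"
begin

lemma chart_fun_measurable: "f \<in> borel_measurable MX"
proof -
  have U: "chart_dom c \<in> sets MX" using dom_open[OF c] by auto
  have "chart_map c \<in> restrict_space MX (chart_dom c) \<rightarrow>\<^sub>M restrict_space borel (chart_img c)"
    by (rule measurable_restrict_space2[OF _ map_measurable[OF c]]) (auto simp: space_restrict_space)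
  moreover have "(\<lambda>x. f (chart_inv c x)) \<in> borel_measurable (restrict_space borel (chart_img c))"
    by (rule borel_measurable_continuous_on_restrict[OF cont])
  ultimately have "(\<lambda>p. f (chart_inv c (chart_map c p))) \<in> borel_measurable (restrict_space MX (chart_dom c))"
    by (rule measurable_compose)
  then have "f \<in> borel_measurable (restrict_space MX (chart_dom c))"
    by (rule measurable_cong[THEN iffD1, rotated]) (auto simp: space_restrict_space c)
  then have "(\<lambda>p. indicator (chart_dom c) p *\<^sub>R f p) \<in> borel_measurable MX"
    using U by (subst (asm) borel_measurable_restrict_space_iff) auto
  then show ?thesis
    by (rule measurable_cong[THEN iffD1, rotated]) (auto simp: indicator_def out)
qed

text \<open>\<open>f\<close> vanishes outside the chart domain, so integrating it against the volume
  is integrating it against \<open>chart_measure c\<close>, which is the volume restricted to that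
  domain.\<close>

lemma chart_integral:
  shows "integral\<^sup>L vol_measure f = (LINT x|restrict_space lborel (chart_img c). dens c x * f (chart_inv c x))"
    and "integrable vol_measure f \<longleftrightarrow> integrable (restrict_space lborel (chart_img c)) (\<lambda>x. dens c x * f (chart_inv c x))"
proof -
  let ?L = "restrict_space lborel (chart_img c)"
  let ?D = "density ?L (\<lambda>x. ennreal (dens c x))"
  have U: "chart_dom c \<in> sets MX" using dom_open[OF c] by auto
  have sets: "sets ?L = sets (restrict_space borel (chart_img c))" by (simp add: sets_restrict_space)
  have inv: "chart_inv c \<in> ?D \<rightarrow>\<^sub>M MX"
    using inv_measurable[OF c] by (simp cong: measurable_cong_sets add: sets)
  have dm: "dens c \<in> borel_measurable ?L"
    using dens_measurable[OF c] by (simp cong: measurable_cong_sets add: sets)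
  have fm: "(\<lambda>x. f (chart_inv c x)) \<in> borel_measurable ?L"
    using borel_measurable_continuous_on_restrict[OF cont] by (simp cong: measurable_cong_sets add: sets)
  have dn: "AE x in ?L. 0 \<le> dens c x"
    using dens_pos[OF c] by (intro AE_I2) (auto simp: space_restrict_space less_imp_le)
  have fv: "f \<in> borel_measurable vol_measure" using chart_fun_measurable by (simp cong: measurable_cong_sets)
  have ind: "density vol_measure (indicator (chart_dom c)) = density vol_measure (\<lambda>p. ennreal (indicator (chart_dom c) p))"
    by (rule arg_cong[where f="density vol_measure"]) (auto simp: indicator_def)
  have fi: "indicator (chart_dom c) p *\<^sub>R f p = f p" if "p \<in> space vol_measure" for p
    using that out by (auto simp: indicator_def)
  have im: "(indicator (chart_dom c) :: 'a \<Rightarrow> real) \<in> borel_measurable vol_measure"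
    using U by (intro borel_measurable_indicator) simp
  have i1: "integral\<^sup>L (chart_measure c) f = integral\<^sup>L vol_measure f"
    unfolding chart_measure_density[OF c] ind
    using im fv by (subst integral_density) (auto intro!: Bochner_Integration.integral_cong simp: fi[simplified])
  have i2: "integrable (chart_measure c) f \<longleftrightarrow> integrable vol_measure f"
    unfolding chart_measure_density[OF c] ind
    using im fv by (subst integrable_density) (auto intro!: Bochner_Integration.integrable_cong simp: fi[simplified])
  have "integral\<^sup>L (chart_measure c) f = integral\<^sup>L ?D (\<lambda>x. f (chart_inv c x))"
    unfolding chart_measure_def by (rule integral_distr[OF inv chart_fun_measurable])
  also have "\<dots> = (LINT x|?L. dens c x * f (chart_inv c x))"
    using integral_density[OF fm dm dn] by simp
  finally show "integral\<^sup>L vol_measure f = (LINT x|?L. dens c x * f (chart_inv c x))" using i1 by simp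
  have "integrable (chart_measure c) f \<longleftrightarrow> integrable ?D (\<lambda>x. f (chart_inv c x))"
    unfolding chart_measure_def by (rule integrable_distr_eq[OF inv chart_fun_measurable])
  also have "\<dots> \<longleftrightarrow> integrable ?L (\<lambda>x. dens c x * f (chart_inv c x))"
    using integrable_density[OF fm dm dn] by simp
  finally show "integrable vol_measure f \<longleftrightarrow> integrable ?L (\<lambda>x. dens c x * f (chart_inv c x))" using i2 by simp
qed

end

end

section \<open>Change of coordinates\<close>

lemma matrix_inv_inverse:
  fixes M :: "real^'n^'n"
  assumes "det M \<noteq> 0"
  shows "M ** matrix_inv M = mat 1" "matrix_inv M ** M = mat 1"
proof -
  have "\<exists>B. M ** B = mat 1 \<and> B ** M = mat 1"
    using assms invertible_det_nz[of M] unfolding invertible_def by blast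
  then have "M ** matrix_inv M = mat 1 \<and> matrix_inv M ** M = mat 1"
    unfolding matrix_inv_def by (rule someI_ex)
  then show "M ** matrix_inv M = mat 1" "matrix_inv M ** M = mat 1" by auto
qed

text \<open>Cramer's rule exhibits the entries of the inverse as quotients of polynomials, from
  which their smoothness follows.\<close>

lemma matrix_inv_cramer:
  fixes M :: "real^'n^'n"
  assumes "det M \<noteq> 0"
  shows "matrix_inv M $ i $ j = det (\<chi> a b. if b = i then axis j 1 $ a else M $ a $ b) / det M"
proof -
  have "M *v (matrix_inv M *v axis j 1) = axis j 1"
    by (simp add: matrix_vector_mul_assoc matrix_inv_inverse[OF assms])
  then have "matrix_inv M *v axis j 1 = (\<chi> k. det (\<chi> a b. if b = k then axis j 1 $ a else M $ a $ b) / det M)"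
    using cramer[OF assms] by blast
  moreover have "(matrix_inv M *v axis j 1) $ i = matrix_inv M $ i $ j"
    by (simp add: matrix_vector_mult_basis column_def)
  ultimately show ?thesis by simp
qed

lemma smooth_matrix_inv:
  fixes M :: "'e::euclidean_space \<Rightarrow> real^'n^'n"
  assumes "approachable S" "\<And>i j. smooth_on S (\<lambda>p. M p $ i $ j)" "\<And>p. p \<in> S \<Longrightarrow> det (M p) \<noteq> 0"
  shows "smooth_on S (\<lambda>p. matrix_inv (M p) $ i $ j)"
proof -
  have "smooth_on S (\<lambda>p. det (\<chi> a b. if b = i then axis j 1 $ a else M p $ a $ b) / det (M p))"
  proof (intro smooth_divide smooth_det assms)
    show "smooth_on S (\<lambda>x. (\<chi> a b. if b = i then axis j 1 $ a else M x $ a $ b) $ k $ l)" for k l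
      using assms by (cases "l = i") (simp_all add: smooth_const)
  qed
  then show ?thesis
    by (rule smooth_cong[THEN iffD1, rotated]) (simp add: matrix_inv_cramer assms(3))
qed

lemma metric_onI:
  fixes M :: "'e::euclidean_space \<Rightarrow> real^'n^'n"
  assumes S: "approachable S" and sm: "\<And>i j. smooth_on S (\<lambda>p. M p $ i $ j)"
    and sym: "\<And>p i j. p \<in> S \<Longrightarrow> M p $ i $ j = M p $ j $ i"
    and pos: "\<And>p v. p \<in> S \<Longrightarrow> v \<noteq> 0 \<Longrightarrow> 0 < v \<bullet> (M p *v v)"
  shows "metric_on S (\<lambda>i j p. M p $ i $ j) (\<lambda>i j p. matrix_inv (M p) $ i $ j)"
proof
  have nz: "det (M p) \<noteq> 0" if "p \<in> S" for p using posdef_det_pos[OF pos[OF that]] by simp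
  show "approachable S" by fact
  show "smooth_on S (\<lambda>p. M p $ i $ j)" for i j by fact
  show "smooth_on S (\<lambda>p. matrix_inv (M p) $ i $ j)" for i j by (rule smooth_matrix_inv[OF S sm nz])
  show "M p $ i $ j = M p $ j $ i" if "p \<in> S" for p i j using sym that .
  show "(SS k. matrix_inv (M p) $ i $ k * M p $ k $ j) = (if i = j then 1 else 0)" if "p \<in> S" for p i j
    using arg_cong[OF matrix_inv_inverse(2)[OF nz[OF that]], of "\<lambda>M. M $ i $ j"]
    by (simp add: matrix_matrix_mult_def mat_def)
  show "matrix_inv (M p) $ i $ j = matrix_inv (M p) $ j $ i" if p: "p \<in> S" for p i j
  proof -
    let ?I = "matrix_inv (M p)"
    have MT: "transpose (M p) = M p" using sym[OF p] by (simp add: vec_eq_iff transpose_def)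
    have "transpose ?I = transpose ?I ** (M p ** ?I)" by (simp add: matrix_inv_inverse[OF nz[OF p]])
    also have "\<dots> = transpose (M p ** ?I) ** ?I"
      by (simp add: matrix_transpose_mul MT matrix_mul_assoc)
    also have "\<dots> = ?I" by (simp add: matrix_inv_inverse[OF nz[OF p]])
    finally have "transpose ?I = ?I" .
    from arg_cong[OF this, of "\<lambda>N. N $ j $ i"] show ?thesis by (simp add: transpose_def)
  qed
  show "0 < v \<bullet> ((\<chi> i j. M p $ i $ j) *v v)" if "p \<in> S" "v \<noteq> 0" for p v
    using pos[OF that] by simp
qed

lemma has_derivative_compose_open:
  assumes "open U" "open V" "\<And>x. x \<in> U \<Longrightarrow> T x \<in> V" "T differentiable_on U" "F differentiable_on V" "x \<in> U"
  shows "((\<lambda>x. F (T x)) has_derivative (\<lambda>v. dder V (dder U v T x) F (T x))) (at x within U)"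
  by (rule has_derivative_in_compose2[where g=F and t=V])
    (use assms in \<open>auto intro: dder_has_derivative\<close>)

lemma dder_sum_Basis:
  fixes F :: "'b::euclidean_space \<Rightarrow> real"
  assumes "F differentiable_on V" "y \<in> V"
  shows "dder V w F y = (\<Sum>b\<in>Basis. (w \<bullet> b) * dder V b F y)"
proof -
  interpret bounded_linear "\<lambda>v. dder V v F y"
    using dder_has_derivative[OF assms] by (rule has_derivative_bounded_linear)
  have "dder V w F y = dder V (\<Sum>b\<in>Basis. (w \<bullet> b) *\<^sub>R b) F y" by (simp add: euclidean_representation)
  then show ?thesis by (simp add: sum scaleR)
qed

text \<open>By the chain rule the derivative of the composition is a finite sum of products of
  components of the derivative of T with partial derivatives of F at T x. The latter are
  compositions of lower order, so induction on k applies.\<close>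

lemma Ck_compose:
  fixes F :: "'b::euclidean_space \<Rightarrow> real"
  assumes U: "open U" and V: "open V" and T: "\<And>x. x \<in> U \<Longrightarrow> T x \<in> V" "\<And>k. Ck_on k U T" and F: "Ck_on k V F"
  shows "Ck_on k U (\<lambda>x. F (T x))"
  using F
proof (induction k arbitrary: F)
  case 0
  have "continuous_on U T" using T(2)[of 0] by simp
  then have "continuous_on U (\<lambda>x. F (T x))"
    using 0 T(1) by (auto intro: continuous_on_compose2)
  then show ?case by simp
next
  case (Suc k)
  have Td: "T differentiable_on U" "\<And>v. Ck_on k U (dder U v T)" using T(2)[of "Suc k"] by (simp_all add: Ck_Suc)
  have Fd: "F differentiable_on V" "\<And>v. Ck_on k V (dder V v F)" using Suc.prems by (simp_all add: Ck_Suc)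
  note ap = approachable_open[OF U]
  have "((\<lambda>x. F (T x)) has_derivative (\<lambda>v. \<Sum>b\<in>Basis. (dder U v T x \<bullet> b) * dder V b F (T x))) (at x within U)" if "x \<in> U" for x
  proof -
    have eq: "(\<lambda>v. dder V (dder U v T x) F (T x)) = (\<lambda>v. \<Sum>b\<in>Basis. (dder U v T x \<bullet> b) * dder V b F (T x))"
      by (rule ext) (rule dder_sum_Basis[OF Fd(1) T(1)[OF that]])
    show ?thesis using has_derivative_compose_open[OF U V T(1) Td(1) Fd(1) that] unfolding eq .
  qed
  then show ?case
  proof (rule Ck_SucI[OF ap])
    fix v
    have s: "Ck_on k U (\<lambda>x. \<Sum>b\<in>B. (dder U v T x \<bullet> b) * dder V b F (T x))" if "finite B" for B
      using that
    proof (induction B)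
      case empty then show ?case by (simp add: Ck_const[OF ap])
    next
      case (insert b B)
      have "Ck_on k U (\<lambda>x. dder U v T x \<bullet> b)"
        by (rule Ck_linear[OF ap bounded_linear_inner_left Td(2)])
      then show ?case using insert Suc.IH[OF Fd(2)] by (simp add: Ck_add[OF ap] Ck_mult[OF ap])
    qed
    show "Ck_on k U (\<lambda>x. \<Sum>b\<in>Basis. (dder U v T x \<bullet> b) * dder V b F (T x))" by (rule s) simp
  qed
qed

lemma smooth_compose:
  fixes F :: "'b::euclidean_space \<Rightarrow> real"
  assumes "open U" "open V" "\<And>x. x \<in> U \<Longrightarrow> T x \<in> V" "smooth_on U T" "smooth_on V F"
  shows "smooth_on U (\<lambda>x. F (T x))"
  using assms Ck_compose[of U V T] unfolding smooth_on_def by blast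

context levi_civita
begin

lemma trace_\<Gamma>: "(SS i. SS j. h i j * D k (g i j)) = (SS m. \<Gamma> m m k) + (SS m. \<Gamma> m m k)"
proof -
  have 1: "(SS i. SS j. h i j * (SS m. \<Gamma> m k i * g m j)) = (SS m. \<Gamma> m m k)"
  proof -
    have "(SS i. SS j. h i j * (SS m. \<Gamma> m k i * g m j)) = (SS i. SS m. \<Gamma> m k i * (SS j. h i j * g j m))"
      unfolding sum_distrib_left by (rule sum.cong[OF refl], rule usum2) (simp add: mult_ac g_sym)
    then show ?thesis by (simp add: hg \<Gamma>_sym[of _ k])
  qed
  have "(SS i. SS j. h i j * (SS m. \<Gamma> m k j * g m i)) = (SS i. SS j. h i j * (SS m. \<Gamma> m k i * g m j))"
    by (rule usum2) (simp add: h_sym)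
  with 1 show ?thesis by (simp add: Dg sum.distrib distrib_left)
qed

text \<open>The trace of \<Gamma> in the divergence is half the trace of the derivative of the
  metric; doubling avoids the division. In this form only the metric, its inverse and first
  derivatives of the gradient have to be followed through a change of coordinates.\<close>

lemma Lap_trace: "Lap u + Lap u = (SS i. D i (grad u i)) + (SS i. D i (grad u i))
    + (SS k. (SS i. SS j. h i j * D k (g i j)) * grad u k)"
  unfolding trace_\<Gamma> Lap_div Div_def distrib_right sum.distrib sum_distrib_right
  by (simp only: ac_simps)

end

lemma (in metric_on) lap_trace:
  assumes p: "p \<in> interior S" and y: "smooth_on S y"
  defines "X \<equiv> \<lambda>k x. (SS j. h k j x * d j y x)"
  shows "2 * lap y p = 2 * (SS i. d i (X i) p) + (SS k. (SS i. SS j. h i j p * d k (g i j) p) * X k p)"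
proof -
  interpret L: levi_civita "\<lambda>i. gD (e i)" "\<lambda>i j. gm p (g i j)" "\<lambda>i j. gm p (h i j)" "\<lambda>k i j. gm p (chr k i j)"
    by (rule germ_levi_civita[OF p])
  have X: "smooth_on S (X k)" for k unfolding X_def by (intro sms y)
  have "L.grad (gm p y) k = gm p (X k)" for k
    by (simp add: X_def gms[OF p] sms y L.grad_def)
  then have "gm p (lap y) + gm p (lap y) = (SS i. gm p (d i (X i))) + (SS i. gm p (d i (X i)))
      + (SS k. (SS i. SS j. gm p (h i j) * gm p (d k (g i j))) * gm p (X k))"
    using L.Lap_trace[of "gm p y"] by (simp add: gm_lap[OF p y] gms[OF p] sms y X)
  then have "ev (gm p (lap y) + gm p (lap y)) = ev ((SS i. gm p (d i (X i))) + (SS i. gm p (d i (X i)))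
      + (SS k. (SS i. SS j. gm p (h i j) * gm p (d k (g i j))) * gm p (X k)))"
    by simp
  then show ?thesis by (simp add: ev_simps ev_two ev_sum ev_gm[OF p] sms y X)
qed

text \<open>The coordinate change of the Laplacian in divergence form: the two terms with second derivatives
  of the transition map cancel because its Jacobian satisfies \<open>D k (J a i) = D i (J a k)\<close>.\<close>

lemma divergence_change:
  fixes D :: "'n::finite \<Rightarrow> 'r::comm_ring_1 \<Rightarrow> 'r" and J K g g' h h' :: "'n \<Rightarrow> 'n \<Rightarrow> 'r"
  assumes der: "\<And>i. derivation (D i)"
    and Jsym: "\<And>a i k. D k (J a i) = D i (J a k)"
    and JK: "\<And>i j. (SS a. K i a * J a j) = (if i = j then 1 else 0)" "\<And>a b. (SS i. J a i * K i b) = (if a = b then 1 else 0)"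
    and X: "\<And>a. X' a = (SS i. J a i * X i)" "\<And>a j. D j (X' a) = (SS b. J b j * dX b a)"
    and g: "\<And>i j. g i j = (SS a. SS b. J a i * J b j * g' a b)" "\<And>a b k. D k (g' a b) = (SS c. J c k * dg c a b)"
      "\<And>a b. g' a b = g' b a"
    and h: "\<And>i j. h i j = h j i" "\<And>i j. (SS k. h i k * g k j) = (if i = j then 1 else 0)"
      "\<And>a b. h' a b = (SS i. SS j. J a i * J b j * h i j)"
  shows "2 * (SS i. D i (X i)) + (SS k. (SS i. SS j. h i j * D k (g i j)) * X k)
    = 2 * (SS a. dX a a) + (SS c. (SS a. SS b. h' a b * dg c a b) * X' c)"
proof -
  note ds = derivationD[OF der]
  \<comment> \<open>The contribution of the second derivatives of the transition map. It occurs
    twice in the trace of the metric, by the symmetry of the two factors J, and once in the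
    divergence, which carries the factor 2 in the statement.\<close>
  define Z where "Z = (SS k. (SS a. SS i. K i a * D k (J a i)) * X k)"
  \<comment> \<open>In matrix terms h J^T g' = J^-1, because h inverts g = J^T g' J.\<close>
  have hJg: "(SS j. SS b. h i j * J b j * g' a b) = K i a" for i a
  proof -
    have "(SS k. h i k * g k l) = (SS a. (SS j. SS b. h i j * J b j * g' a b) * J a l)" for l
    proof -
      have "(SS k. h i k * g k l) = (SS k. SS b. SS a. h i k * J b k * g' a b * J a l)"
        unfolding g(1) sum_distrib_left by (simp add: mult_ac g(3))
      also have "\<dots> = (SS a. SS k. SS b. h i k * J b k * g' a b * J a l)"
        by (rule usum3_312) simp
      finally show ?thesis by (simp add: sum_distrib_right)
    qed
    then have e: "(SS a. (SS j. SS b. h i j * J b j * g' a b) * J a l) = (if i = l then 1 else 0)" for l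
      by (simp add: h(2))
    define M where "M a = (SS j. SS b. h i j * J b j * g' a b)" for a
    have "M a = (SS b. M b * (SS l. J b l * K l a))" by (simp add: JK)
    also have "\<dots> = (SS l. (SS b. M b * J b l) * K l a)"
      unfolding sum_distrib_left sum_distrib_right by (rule usum2) (simp add: mult_ac)
    also have "\<dots> = K i a" using e unfolding M_def[symmetric] by simp
    finally show ?thesis unfolding M_def .
  qed
  have tr: "(SS i. SS j. h i j * D k (g i j)) = 2 * (SS a. SS i. K i a * D k (J a i))
      + (SS c. J c k * (SS a. SS b. h' a b * dg c a b))" for k
  proof -
    have "(SS i. SS j. h i j * D k (g i j)) = (SS i. SS j. SS a. SS b. h i j * (D k (J a i) * J b j * g' a b))
       + (SS i. SS j. SS a. SS b. h i j * (J a i * D k (J b j) * g' a b))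
       + (SS i. SS j. SS a. SS b. h i j * (J a i * J b j * D k (g' a b)))"
      unfolding g(1) by (simp add: ds sum_distrib_left distrib_left distrib_right sum.distrib mult_ac)
    moreover have T1: "(SS i. SS j. SS a. SS b. h i j * (D k (J a i) * J b j * g' a b)) = (SS a. SS i. K i a * D k (J a i))"
    proof -
      have "(SS i. SS j. SS a. SS b. h i j * (D k (J a i) * J b j * g' a b))
          = (SS i. SS a. SS j. SS b. D k (J a i) * (h i j * J b j * g' a b))"
        by (rule sum.cong[OF refl], rule usum3_213) (simp add: mult_ac)
      also have "\<dots> = (SS i. SS a. D k (J a i) * K i a)"
        unfolding hJg[symmetric] sum_distrib_left ..
      also have "\<dots> = (SS a. SS i. K i a * D k (J a i))"
        by (rule usum2) (simp add: mult_ac)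
      finally show ?thesis .
    qed
    moreover have "(SS i. SS j. SS a. SS b. h i j * (J a i * D k (J b j) * g' a b))
        = (SS i. SS j. SS a. SS b. h i j * (D k (J a i) * J b j * g' a b))"
    proof (rule usum2)
      fix i j
      show "(SS a. SS b. h i j * (J a i * D k (J b j) * g' a b)) = (SS a. SS b. h j i * (D k (J a j) * J b i * g' a b))"
        by (rule usum2) (simp add: h(1)[of i j] g(3) mult_ac)
    qed
    moreover have "(SS i. SS j. SS a. SS b. h i j * (J a i * J b j * D k (g' a b))) = (SS c. J c k * (SS a. SS b. h' a b * dg c a b))"
    proof -
      have "(SS i. SS j. SS a. SS b. h i j * (J a i * J b j * D k (g' a b)))
         = (SS a. SS b. (SS i. SS j. J a i * J b j * h i j) * D k (g' a b))"
      proof -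
        have "(SS i. SS j. SS a. SS b. h i j * (J a i * J b j * D k (g' a b)))
          = (SS i. SS a. SS b. SS j. h i j * (J a i * J b j * D k (g' a b)))"
          by (rule sum.cong[OF refl], rule usum3_231) simp
        also have "\<dots> = (SS a. SS b. SS i. SS j. h i j * (J a i * J b j * D k (g' a b)))"
          by (rule usum3_231) simp
        finally show ?thesis by (simp add: sum_distrib_right sum_distrib_left mult_ac)
      qed
      also have "\<dots> = (SS a. SS b. SS c. J c k * (h' a b * dg c a b))"
        unfolding h(3)[symmetric] g(2) sum_distrib_left by (simp add: mult_ac)
      also have "\<dots> = (SS c. SS a. SS b. J c k * (h' a b * dg c a b))"
        by (rule usum3_312) simp
      finally show ?thesis by (simp add: sum_distrib_left)
    qed
    ultimately show ?thesis by simp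
  qed
  have dX: "dX b a = (SS j. K j b * D j (X' a))" for a b
  proof -
    have "(SS j. K j b * D j (X' a)) = (SS c. (SS j. J c j * K j b) * dX c a)"
      unfolding X(2) sum_distrib_left sum_distrib_right by (rule usum2) (simp add: mult_ac)
    then show ?thesis by (simp add: JK)
  qed
  have divX: "(SS a. dX a a) = Z + (SS i. D i (X i))"
  proof -
    have "(SS a. dX a a) = (SS a. SS j. SS i. K j a * (D j (J a i) * X i)) + (SS a. SS j. SS i. K j a * (J a i * D j (X i)))"
      unfolding dX X(1) by (simp add: ds sum_distrib_left distrib_left sum.distrib)
    moreover have "(SS a. SS j. SS i. K j a * (D j (J a i) * X i)) = Z"
    proof -
      have "(SS a. SS j. SS i. K j a * (D j (J a i) * X i)) = (SS i. SS a. SS j. K j a * D i (J a j) * X i)"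
        by (rule usum3_312) (simp add: Jsym mult_ac)
      then show ?thesis by (simp add: Z_def sum_distrib_right)
    qed
    moreover have "(SS a. SS j. SS i. K j a * (J a i * D j (X i))) = (SS i. D i (X i))"
    proof -
      have "(SS a. SS j. SS i. K j a * (J a i * D j (X i))) = (SS j. SS i. SS a. K j a * J a i * D j (X i))"
        by (rule usum3_231) (simp add: mult_ac)
      also have "\<dots> = (SS j. SS i. (if j = i then 1 else 0) * D j (X i))"
        by (simp flip: JK(1) add: sum_distrib_right)
      finally show ?thesis by simp
    qed
    ultimately show ?thesis by simp
  qed
  have "(SS k. (SS i. SS j. h i j * D k (g i j)) * X k) = 2 * Z + (SS k. (SS c. J c k * (SS a. SS b. h' a b * dg c a b)) * X k)"
    unfolding tr Z_def by (simp only: distrib_right sum.distrib mult.assoc flip: sum_distrib_left)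
  also have "(SS k. (SS c. J c k * (SS a. SS b. h' a b * dg c a b)) * X k) = (SS c. (SS a. SS b. h' a b * dg c a b) * X' c)"
    unfolding X(1) sum_distrib_left[of _ "\<lambda>i. J _ i * X i"] sum_distrib_right[of "\<lambda>c. J c _ * _ c"]
    by (rule usum2) (simp add: mult_ac)
  finally show ?thesis unfolding divX by (simp add: algebra_simps)
qed

text \<open>Identifies the coordinate expressions of the metric \<open>M\<close> on \<open>V\<close> with those computed on a larger
  domain \<open>S\<close>, such as space-time, along an inclusion \<open>\<iota>\<close> of a time slice.\<close>

locale coord_link = metric_on S e g h
  for S :: "'e::euclidean_space set" and e :: "'n::finite \<Rightarrow> 'e" and g h +
  fixes V :: "(real^'n) set" and \<iota> :: "real^'n \<Rightarrow> 'e" and M :: "real^'n \<Rightarrow> real^'n^'n"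
  assumes \<iota>: "x \<in> V \<Longrightarrow> \<iota> x \<in> S"
    and link: "smooth_on S F \<Longrightarrow> (\<And>y. y \<in> V \<Longrightarrow> f y = F (\<iota> y)) \<Longrightarrow> x \<in> V \<Longrightarrow> partial i f x = dder S (e i) F (\<iota> x)"
    and Mg: "x \<in> V \<Longrightarrow> M x $ i $ j = g i j (\<iota> x)"
    and Mh: "x \<in> V \<Longrightarrow> matrix_inv (M x) $ i $ j = h i j (\<iota> x)"
begin

lemma christoffel_eq: "x \<in> V \<Longrightarrow> christoffel M k i j x = chr k i j (\<iota> x)"
  unfolding christoffel_def chr_def by (simp add: Mh link[OF g_smooth Mg])

lemma riemann_eq: "x \<in> V \<Longrightarrow> coord_riemann M l k i j x = riem l k i j (\<iota> x)"
  unfolding coord_riemann_def riem_def by (simp add: christoffel_eq link[OF smooth_chr christoffel_eq])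

lemma ricci_eq: "x \<in> V \<Longrightarrow> coord_ricci M x $ j $ k = ric j k (\<iota> x)"
  unfolding coord_ricci_def ric_def by (simp add: riemann_eq)

lemma scalar_eq: "x \<in> V \<Longrightarrow> coord_scalar_curvature M x = scal (\<iota> x)"
  unfolding coord_scalar_curvature_def scal_def by (simp add: Mh ricci_eq)

lemma vol_eq: "x \<in> V \<Longrightarrow> sqrt (det (M x)) = vol (\<iota> x)"
  unfolding vol_def by (intro arg_cong[where f=sqrt] arg_cong[where f=det]) (simp add: vec_eq_iff Mg)

context
  fixes u :: "real^'n \<Rightarrow> real" and U :: "'e \<Rightarrow> real"
  assumes U: "smooth_on S U" and u: "\<And>y. y \<in> V \<Longrightarrow> u y = U (\<iota> y)"
begin

lemma partial_eq: "x \<in> V \<Longrightarrow> partial i u x = d i U (\<iota> x)"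
  by (rule link[OF U u])

lemma laplacian_eq: "x \<in> V \<Longrightarrow> coord_laplacian M u x = lap U (\<iota> x)"
  unfolding coord_laplacian_def lap_def hss_def
  by (simp add: Mh christoffel_eq partial_eq link[OF smooth_dder[OF U] partial_eq])

lemma grad_norm_eq: "x \<in> V \<Longrightarrow> coord_grad_norm_sq M u x = nrm U (\<iota> x)"
  unfolding coord_grad_norm_sq_def nrm_def by (simp add: Mh partial_eq mult.assoc)

end

end

lemma partial_open:
  assumes "open V" "x \<in> V" "\<And>y. y \<in> V \<Longrightarrow> f y = F y"
  shows "partial i f x = dder V (axis i 1) F x"
  unfolding partial_def dder_open_subset(2)[OF assms(1) subset_refl assms(2), symmetric]
  by (rule dder_cong[OF assms(2,3)])

lemma coord_link_open:
  assumes V: "open V" and sm: "\<And>i j. smooth_on V (\<lambda>p. M p $ i $ j)"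
    and sym: "\<And>p i j. p \<in> V \<Longrightarrow> M p $ i $ j = M p $ j $ i"
    and pos: "\<And>p v. p \<in> V \<Longrightarrow> v \<noteq> 0 \<Longrightarrow> 0 < v \<bullet> (M p *v v)"
  shows "coord_link V (\<lambda>i. axis i 1) (\<lambda>i j p. M p $ i $ j) (\<lambda>i j p. matrix_inv (M p) $ i $ j) V (\<lambda>x. x) M"
proof -
  interpret metric_on V "\<lambda>i. axis i 1" "\<lambda>i j p. M p $ i $ j" "\<lambda>i j p. matrix_inv (M p) $ i $ j"
    by (rule metric_onI[OF approachable_open[OF V] sm sym pos])
  show ?thesis
    by unfold_locales (auto intro: partial_open[OF V])
qed

lemma coord_link_slice:
  fixes M :: "real \<Rightarrow> real^'n \<Rightarrow> real^'n^'n"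
  assumes V: "open V" and ab: "a < b" and t: "t \<in> {a..b}"
    and sm: "\<And>i j. smooth_on ({a..b} \<times> V) (\<lambda>(t, x). M t x $ i $ j)"
    and sym: "\<And>t x i j. t \<in> {a..b} \<Longrightarrow> x \<in> V \<Longrightarrow> M t x $ i $ j = M t x $ j $ i"
    and pos: "\<And>t x v. t \<in> {a..b} \<Longrightarrow> x \<in> V \<Longrightarrow> v \<noteq> 0 \<Longrightarrow> 0 < v \<bullet> (M t x *v v)"
  shows "coord_link ({a..b} \<times> V) (\<lambda>i. (0, axis i 1)) (\<lambda>i j (t, x). M t x $ i $ j)
    (\<lambda>i j (t, x). matrix_inv (M t x) $ i $ j) V (Pair t) (M t)"
proof -
  have ap: "approachable ({a..b} \<times> V)"
    by (rule approachable_Times[OF approachable_interval[OF ab] approachable_open[OF V]])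
  have "metric_on ({a..b} \<times> V) (\<lambda>i j p. (\<lambda>(t, x). M t x) p $ i $ j) (\<lambda>i j p. matrix_inv ((\<lambda>(t, x). M t x) p) $ i $ j)"
  proof (rule metric_onI[OF ap])
    show "smooth_on ({a..b} \<times> V) (\<lambda>p. (\<lambda>(t, x). M t x) p $ i $ j)" for i j
      using sm[of i j] by (simp add: case_prod_unfold)
  qed (use sym pos in auto)
  then interpret metric_on "{a..b} \<times> V" "\<lambda>i. (0, axis i 1)" "\<lambda>i j (t, x). M t x $ i $ j" "\<lambda>i j (t, x). matrix_inv (M t x) $ i $ j"
    by (simp add: case_prod_unfold)
  show ?thesis
  proof
    fix F :: "real \<times> (real^'n) \<Rightarrow> real" and f :: "real^'n \<Rightarrow> real" and x i assume F: "smooth_on ({a..b} \<times> V) F" "\<And>y. y \<in> V \<Longrightarrow> f y = F (t, y)" "x \<in> V"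
    have "partial i f x = dder V (axis i 1) (\<lambda>x. F (t, x)) x" by (rule partial_open[OF V F(3,2)])
    also have "\<dots> = dder ({a..b} \<times> V) (0, axis i 1) F (t, x)"
      unfolding dder_open_subset(2)[OF V subset_refl F(3)] by (rule slice_partial[OF V t F(3,1)])
    finally show "partial i f x = dder ({a..b} \<times> V) (0, axis i 1) F (t, x)" .
  qed (use t in auto)
qed

lemma sum_Basis_vec: "(\<Sum>b\<in>Basis. (w \<bullet> b) * f b) = (SS a. w $ a * f (axis a 1))" for w :: "real^'k::finite" and f :: "_ \<Rightarrow> real"
proof -
  have B: "Basis = (\<lambda>i. axis i (1::real)) ` (UNIV :: 'k set)" by (auto simp: Basis_vec_def)
  have i: "inj (\<lambda>i::'k. axis i (1::real))" by (simp add: inj_def axis_eq_axis)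
  show ?thesis unfolding B sum.reindex[OF i] by (simp add: inner_axis)
qed

definition coord_inner :: "(real ^ 'n \<Rightarrow> real ^ 'n ^ 'n) \<Rightarrow> (real ^ 'n \<Rightarrow> real) \<Rightarrow> (real ^ 'n \<Rightarrow> real) \<Rightarrow> real ^ 'n::finite \<Rightarrow> real" where
  "coord_inner G u w x = (SS i. SS j. matrix_inv (G x) $ i $ j * partial i u x * partial j w x)"

lemma coord_grad_norm_inner: "coord_grad_norm_sq G u = coord_inner G u u"
  by (simp add: fun_eq_iff coord_grad_norm_sq_def coord_inner_def)

section \<open>Coordinate independence of the gradient pairing and of the Laplacian\<close>

context riemannian_mfd
begin

lemma link_chart:
  "c \<in> A \<Longrightarrow> coord_link (chart_img c) (\<lambda>i. axis i 1) (\<lambda>i j x. g c x $ i $ j) (\<lambda>i j x. matrix_inv (g c x) $ i $ j)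
    (chart_img c) (\<lambda>x. x) (g c)"
  by (rule coord_link_open[OF img_open metric_smooth metric_sym metric_pos])

context
  fixes c d assumes c: "c \<in> A" and d: "d \<in> A"
begin

abbreviation "Ov \<equiv> chart_map c ` (chart_dom c \<inter> chart_dom d)"
abbreviation "T \<equiv> transition c d"

lemma Ov_open: "open Ov" and T_smooth: "smooth_on Ov T"
  using transition_smooth[OF c d] by auto

lemma Ov_sub: "Ov \<subseteq> chart_img c" by auto

lemma T_img: "z \<in> Ov \<Longrightarrow> T z \<in> chart_img d"
  using c by (auto simp: transition_def)

lemma inv_T: "z \<in> Ov \<Longrightarrow> chart_inv d (T z) = chart_inv c z"
  using c d by (auto simp: transition_def)

definition "J a i z = dder Ov (axis i 1) (\<lambda>z. T z $ a) z"
definition "Jm z = (\<chi> a i. J a i z)"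

lemma T_comp_smooth: "smooth_on Ov (\<lambda>z. T z $ a)"
  by (rule smooth_linear[OF approachable_open[OF Ov_open] bounded_linear_vec_nth T_smooth])

lemma J_smooth: "smooth_on Ov (J a i)"
  unfolding J_def[abs_def] by (rule smooth_dder[OF T_comp_smooth])

lemma T_deriv: "z \<in> Ov \<Longrightarrow> (T has_derivative (\<lambda>v. dder Ov v T z)) (at z)"
  using smooth_has_derivative[OF T_smooth] at_within_open[OF _ Ov_open] by metis

lemma J_eq: "z \<in> Ov \<Longrightarrow> dder Ov (axis i 1) T z $ a = J a i z"
proof -
  assume z: "z \<in> Ov"
  have "((\<lambda>z. T z $ a) has_derivative (\<lambda>v. dder Ov v T z $ a)) (at z within Ov)"
    by (rule bounded_linear.has_derivative[OF bounded_linear_vec_nth smooth_has_derivative[OF T_smooth z]])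
  from dder_eq[OF approachable_open[OF Ov_open] z this] show ?thesis by (simp add: J_def)
qed

lemma Jm_jacobian: "z \<in> Ov \<Longrightarrow> jacobian T (at z) = Jm z"
  unfolding jacobian_def frechet_derivative_at[OF T_deriv, symmetric]
  by (simp add: matrix_def Jm_def J_eq vec_eq_iff)

text \<open>Differentiability of F is asked at the single point T z. This covers the C^1 cutoffs as
  well as smooth functions.\<close>

lemma chain:
  assumes F: "(F has_derivative F') (at (T z))" and z: "z \<in> Ov" and f: "\<And>y. y \<in> Ov \<Longrightarrow> f y = F (T y)"
  shows "partial i f z = (SS b. J b i z * partial b F (T z))"
proof -
  have "((\<lambda>y. F (T y)) has_derivative (\<lambda>v. F' (dder Ov v T z))) (at z)"
    by (rule has_derivative_compose[OF T_deriv[OF z] F])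
  then have "(f has_derivative (\<lambda>v. F' (dder Ov v T z))) (at z)"
    by (rule has_derivative_transform_within_open[OF _ Ov_open z]) (simp add: f)
  then have "partial i f z = F' (dder Ov (axis i 1) T z)"
    unfolding partial_def by (simp add: frechet_derivative_at[symmetric])
  also have "\<dots> = F' (\<Sum>b\<in>Basis. (dder Ov (axis i 1) T z \<bullet> b) *\<^sub>R b)" by (simp add: euclidean_representation)
  also have "\<dots> = (\<Sum>b\<in>Basis. (dder Ov (axis i 1) T z \<bullet> b) * F' b)"
    by (simp add: linear_sum[OF has_derivative_linear[OF F]] linear_cmul[OF has_derivative_linear[OF F]])
  also have "\<dots> = (SS b. J b i z * F' (axis b 1))" by (simp add: sum_Basis_vec J_eq[OF z])
  finally show ?thesis by (simp add: partial_def frechet_derivative_at[OF F, symmetric])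
qed

lemma g_change: "z \<in> Ov \<Longrightarrow> g c z = transpose (Jm z) ** g d (T z) ** Jm z"
proof -
  assume z: "z \<in> Ov"
  then obtain p where p: "p \<in> chart_dom c" "p \<in> chart_dom d" "z = chart_map c p" by auto
  have "T z = chart_map d p" using p c by (simp add: transition_def)
  then show ?thesis using metric_change[OF c d p(1,2)] Jm_jacobian[OF z] p(3) by simp
qed

lemma det_Jm: "z \<in> Ov \<Longrightarrow> det (Jm z) \<noteq> 0"
proof
  assume z: "z \<in> Ov" "det (Jm z) = 0"
  then have "det (g c z) = 0" using g_change[OF z(1)] by (simp add: det_mul)
  then show False using metric_det_pos[OF c, of z] z(1) Ov_sub by force
qed

lemma inv_change: "z \<in> Ov \<Longrightarrow> matrix_inv (g d (T z)) = Jm z ** matrix_inv (g c z) ** transpose (Jm z)"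
proof -
  assume z: "z \<in> Ov"
  let ?J = "Jm z" and ?K = "matrix_inv (Jm z)" and ?G = "g d (T z)" and ?I = "matrix_inv (g c z)"
  have dc: "det (g c z) \<noteq> 0" using metric_det_pos[OF c, of z] z Ov_sub by force
  have dd: "det ?G \<noteq> 0" using metric_det_pos[OF d T_img[OF z]] by simp
  have "?J ** ?I ** transpose ?J ** ?G = ?J ** ?I ** (transpose ?J ** ?G ** ?J) ** ?K"
    using matrix_inv_inverse[OF det_Jm[OF z]] by (simp flip: matrix_mul_assoc)
  also have "\<dots> = ?J ** (?I ** g c z) ** ?K" by (simp add: g_change[OF z] matrix_mul_assoc)
  also have "\<dots> = mat 1" by (simp add: matrix_inv_inverse[OF dc] matrix_inv_inverse[OF det_Jm[OF z]])
  finally have "?J ** ?I ** transpose ?J ** ?G ** matrix_inv ?G = matrix_inv ?G" by simp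
  then show ?thesis using matrix_inv_inverse[OF dd] by (simp flip: matrix_mul_assoc)
qed

lemma g_change': "z \<in> Ov \<Longrightarrow> g c z $ i $ j = (SS a. SS b. J a i z * J b j z * g d (T z) $ a $ b)"
  unfolding g_change
  by (simp add: matrix_matrix_mult_def transpose_def Jm_def sum_distrib_left sum_distrib_right mult_ac)
     (rule usum2, simp add: mult_ac)

lemma inv_change': "z \<in> Ov \<Longrightarrow> matrix_inv (g d (T z)) $ a $ b = (SS i. SS j. J a i z * J b j z * matrix_inv (g c z) $ i $ j)"
  unfolding inv_change
  by (simp add: matrix_matrix_mult_def transpose_def Jm_def sum_distrib_left sum_distrib_right mult_ac)
     (rule usum2, simp add: mult_ac)

lemma inner_change:
  assumes z: "z \<in> Ov" and F: "(F has_derivative F') (at (T z))" "\<And>y. y \<in> Ov \<Longrightarrow> f y = F (T y)"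
    and G: "(G has_derivative G') (at (T z))" "\<And>y. y \<in> Ov \<Longrightarrow> k y = G (T y)"
  shows "coord_inner (g c) f k z = coord_inner (g d) F G (T z)"
proof -
  let ?I = "\<lambda>i j. matrix_inv (g c z) $ i $ j"
  have "coord_inner (g c) f k z = (SS i. SS j. SS a. SS b. ?I i j * (J a i z * partial a F (T z)) * (J b j z * partial b G (T z)))"
  proof -
    have "partial i f z = (SS b. J b i z * partial b F (T z))" "partial i k z = (SS b. J b i z * partial b G (T z))" for i
      by (rule chain[OF F(1) z F(2)], assumption) (rule chain[OF G(1) z G(2)])
    then show ?thesis
      by (simp add: coord_inner_def sum_product sum_distrib_left mult_ac)
  qed
  also have "\<dots> = (SS i. SS a. SS b. SS j. ?I i j * (J a i z * partial a F (T z)) * (J b j z * partial b G (T z)))"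
    by (rule sum.cong[OF refl], rule usum3_231) simp
  also have "\<dots> = (SS a. SS b. SS i. SS j. ?I i j * (J a i z * partial a F (T z)) * (J b j z * partial b G (T z)))"
    by (rule usum3_231) simp
  also have "\<dots> = coord_inner (g d) F G (T z)"
    unfolding coord_inner_def inv_change'[OF z] by (simp add: sum_distrib_left sum_distrib_right mult_ac)
  finally show ?thesis .
qed

text \<open>All quantities of chart d are pulled back by T, and the germs at x then satisfy the
  hypotheses of \<open>divergence_change\<close>. Evaluating its conclusion at x and applying
  \<open>lap_trace\<close> in both charts identifies the two Laplacians.\<close>

lemma laplacian_change:
  assumes x: "x \<in> Ov" and Y: "smooth_on (chart_img c) Yc" "smooth_on (chart_img d) Yd" "\<And>z. z \<in> Ov \<Longrightarrow> Yc z = Yd (T z)"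
  shows "coord_laplacian (g c) Yc x = coord_laplacian (g d) Yd (T x)"
proof -
  interpret C: coord_link "chart_img c" "\<lambda>i. axis i 1" "\<lambda>i j x. g c x $ i $ j" "\<lambda>i j x. matrix_inv (g c x) $ i $ j"
    "chart_img c" "\<lambda>x. x" "g c" by (rule link_chart[OF c])
  interpret D: coord_link "chart_img d" "\<lambda>i. axis i 1" "\<lambda>i j x. g d x $ i $ j" "\<lambda>i j x. matrix_inv (g d x) $ i $ j"
    "chart_img d" "\<lambda>x. x" "g d" by (rule link_chart[OF d])
  define X where "X i z = (SS j. matrix_inv (g c z) $ i $ j * C.d j Yc z)" for i z
  define X' where "X' a y = (SS b. matrix_inv (g d y) $ a $ b * D.d b Yd y)" for a y
  have Xs: "smooth_on (chart_img c) (X i)" for i unfolding X_def[abs_def] by (intro C.sms Y)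
  have X's: "smooth_on (chart_img d) (X' a)" for a unfolding X'_def[abs_def] by (intro D.sms Y)
  have res: "smooth_on Ov F" if "smooth_on (chart_img c) F" for F :: "real^'n \<Rightarrow> real"
    by (rule smooth_open_subset[OF that Ov_open Ov_sub])
  have comp: "smooth_on Ov (\<lambda>z. F (T z))" if "smooth_on (chart_img d) F" for F :: "real^'n \<Rightarrow> real"
    by (rule smooth_compose[OF Ov_open img_open[OF d] T_img T_smooth that])
  have dch: "dder Ov (axis i 1) (\<lambda>z. F (T z)) z = (SS b. J b i z * D.d b F (T z))"
    if F: "smooth_on (chart_img d) F" and z: "z \<in> Ov" for F :: "real^'n \<Rightarrow> real" and i z
  proof -
    have "(F has_derivative (\<lambda>v. dder (chart_img d) v F (T z))) (at (T z))"
      using smooth_has_derivative[OF F T_img[OF z]] at_within_open[OF T_img[OF z] img_open[OF d]] by simp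
    from chain[OF this z, of "\<lambda>z. F (T z)" i]
    show ?thesis
      by (simp add: partial_open[OF Ov_open z refl] partial_open[OF img_open[OF d] T_img[OF z] refl])
  qed
  have dres: "C.d i F z = dder Ov (axis i 1) F z" if "z \<in> Ov" for F :: "real^'n \<Rightarrow> real" and i z
    by (rule dder_open_subset(1)[OF Ov_open Ov_sub that])
  have dY: "C.d j Yc z = (SS b. J b j z * D.d b Yd (T z))" if "z \<in> Ov" for j z
    unfolding dres[OF that] dch[OF Y(2) that, symmetric] by (rule dder_cong[OF that Y(3)])
  have XX: "X' a (T z) = (SS i. J a i z * X i z)" if z: "z \<in> Ov" for a z
  proof -
    have "(SS i. J a i z * X i z) = (SS i. SS j. SS b. J a i z * matrix_inv (g c z) $ i $ j * J b j z * D.d b Yd (T z))"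
      unfolding X_def dY[OF z] by (simp add: sum_distrib_left mult_ac)
    also have "\<dots> = (SS b. SS i. SS j. J a i z * matrix_inv (g c z) $ i $ j * J b j z * D.d b Yd (T z))"
      by (rule usum3_312) simp
    finally show ?thesis unfolding X'_def inv_change'[OF z] by (simp add: sum_distrib_left sum_distrib_right mult_ac)
  qed
  define K where "K i a z = matrix_inv (Jm z) $ i $ a" for i a z
  have Ks: "smooth_on Ov (K i a)" for i a
    unfolding K_def[abs_def] by (rule smooth_matrix_inv[OF approachable_open[OF Ov_open] _ det_Jm]) (simp_all add: Jm_def J_smooth)
  note gs = germ_at_add[OF Ov_open x] germ_at_mult[OF Ov_open x] germ_at_sum[OF Ov_open x]
  note gD = gD_germ_at[OF Ov_open x] and gc = germ_at_cong[OF Ov_open x] and evg = ev_germ_at[OF Ov_open x]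
  note apO = approachable_open[OF Ov_open]
  let ?G = "germ_at x"
  have r1: "2 * (SS i. gD (axis i 1) (?G (X i))) + (SS k. (SS i. SS j. ?G (\<lambda>z. matrix_inv (g c z) $ i $ j) * gD (axis k 1) (?G (\<lambda>z. g c z $ i $ j))) * ?G (X k))
    = 2 * (SS a. ?G (\<lambda>z. D.d a (X' a) (T z))) + (SS c. (SS a. SS b. ?G (\<lambda>z. matrix_inv (g d (T z)) $ a $ b) * ?G (\<lambda>z. D.d c (\<lambda>y. g d y $ a $ b) (T z))) * ?G (\<lambda>z. X' c (T z)))"
  proof (rule divergence_change[where J = "\<lambda>a i. ?G (J a i)" and K = "\<lambda>i a. ?G (K i a)" and dX = "\<lambda>b a. ?G (\<lambda>z. D.d b (X' a) (T z))"
        and g' = "\<lambda>a b. ?G (\<lambda>z. g d (T z) $ a $ b)"])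
    show "derivation (gD (axis i 1 :: real^'n))" for i by (rule derivation_gD)
    \<comment> \<open>J a i is the i-th derivative of the component a of the transition map, so this
      is the symmetry of second derivatives.\<close>
    show "gD (axis k 1) (?G (J a i)) = gD (axis i 1) (?G (J a k))" for a i k
    proof -
      have "?G (J a i) = gD (axis i 1) (?G (\<lambda>z. T z $ a))" for i
        unfolding gD[OF T_comp_smooth] J_def[abs_def] ..
      note e = this
      show ?thesis unfolding e by (rule gD_commute)
    qed
    show "(SS a. ?G (K i a) * ?G (J a j)) = (if i = j then 1 else 0)" for i j
    proof -
      have "(SS a. ?G (K i a) * ?G (J a j)) = ?G (\<lambda>z. SS a. K i a z * J a j z)"
        by (simp add: gs Ks J_smooth smooth_mult[OF apO])
      also have "\<dots> = ?G (\<lambda>z. if i = j then 1 else 0)"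
      proof (rule gc)
        show "(SS a. K i a z * J a j z) = (if i = j then 1 else 0)" if "z \<in> Ov" for z
          using arg_cong[OF matrix_inv_inverse(2)[OF det_Jm[OF that]], of "\<lambda>M. M $ i $ j"]
          by (simp add: matrix_matrix_mult_def K_def Jm_def mat_def)
      qed (intro smooth_sum[OF apO] smooth_mult[OF apO] Ks J_smooth)
      finally show ?thesis by (simp add: germ_at_0[OF Ov_open x] germ_at_1[OF Ov_open x])
    qed
    show "(SS i. ?G (J a i) * ?G (K i b)) = (if a = b then 1 else 0)" for a b
    proof -
      have "(SS i. ?G (J a i) * ?G (K i b)) = ?G (\<lambda>z. SS i. J a i z * K i b z)"
        by (simp add: gs Ks J_smooth smooth_mult[OF apO])
      also have "\<dots> = ?G (\<lambda>z. if a = b then 1 else 0)"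
      proof (rule gc)
        show "(SS i. J a i z * K i b z) = (if a = b then 1 else 0)" if "z \<in> Ov" for z
          using arg_cong[OF matrix_inv_inverse(1)[OF det_Jm[OF that]], of "\<lambda>M. M $ a $ b"]
          by (simp add: matrix_matrix_mult_def K_def Jm_def mat_def)
      qed (intro smooth_sum[OF apO] smooth_mult[OF apO] Ks J_smooth)
      finally show ?thesis by (simp add: germ_at_0[OF Ov_open x] germ_at_1[OF Ov_open x])
    qed
    show "?G (\<lambda>z. X' a (T z)) = (SS i. ?G (J a i) * ?G (X i))" for a
    proof -
      have "?G (\<lambda>z. X' a (T z)) = ?G (\<lambda>z. SS i. J a i z * X i z)"
        by (rule gc[OF comp[OF X's] XX])
      then show ?thesis by (simp add: gs J_smooth res[OF Xs] smooth_mult[OF apO])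
    qed
    have dd: "gD (axis j 1) (?G (\<lambda>z. F (T z))) = (SS b. ?G (J b j) * ?G (\<lambda>z. D.d b F (T z)))"
      if F: "smooth_on (chart_img d) F" for F :: "real^'n \<Rightarrow> real" and j
    proof -
      have "gD (axis j 1) (?G (\<lambda>z. F (T z))) = ?G (\<lambda>z. SS b. J b j z * D.d b F (T z))"
        unfolding gD[OF comp[OF F]] by (rule gc[OF smooth_dder[OF comp[OF F]] dch[OF F]])
      then show ?thesis by (simp add: gs J_smooth comp[OF smooth_dder[OF F]] smooth_mult[OF apO])
    qed
    show "gD (axis j 1) (?G (\<lambda>z. X' a (T z))) = (SS b. ?G (J b j) * ?G (\<lambda>z. D.d b (X' a) (T z)))" for a j
      by (rule dd[OF X's])
    show "gD (axis k 1) (?G (\<lambda>z. g d (T z) $ a $ b)) = (SS c. ?G (J c k) * ?G (\<lambda>z. D.d c (\<lambda>y. g d y $ a $ b) (T z)))" for a b k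
      by (rule dd[OF D.g_smooth])
    show "?G (\<lambda>z. g c z $ i $ j) = (SS a. SS b. ?G (J a i) * ?G (J b j) * ?G (\<lambda>z. g d (T z) $ a $ b))" for i j
    proof -
      have "?G (\<lambda>z. g c z $ i $ j) = ?G (\<lambda>z. SS a. SS b. J a i z * J b j z * g d (T z) $ a $ b)"
        by (rule gc[OF res[OF C.g_smooth] g_change'])
      then show ?thesis by (simp add: gs J_smooth comp[OF D.g_smooth] smooth_mult[OF apO] smooth_sum[OF apO])
    qed
    show "?G (\<lambda>z. g d (T z) $ a $ b) = ?G (\<lambda>z. g d (T z) $ b $ a)" for a b
      by (rule gc[OF comp[OF D.g_smooth] D.g_sym[OF T_img]])
    show "?G (\<lambda>z. matrix_inv (g c z) $ i $ j) = ?G (\<lambda>z. matrix_inv (g c z) $ j $ i)" for i j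
      by (rule gc[OF res[OF C.h_smooth] C.h_sym]) (use Ov_sub in blast)
    show "(SS k. ?G (\<lambda>z. matrix_inv (g c z) $ i $ k) * ?G (\<lambda>z. g c z $ k $ j)) = (if i = j then 1 else 0)" for i j
    proof -
      have "(SS k. ?G (\<lambda>z. matrix_inv (g c z) $ i $ k) * ?G (\<lambda>z. g c z $ k $ j)) = ?G (\<lambda>z. SS k. matrix_inv (g c z) $ i $ k * g c z $ k $ j)"
        by (simp add: gs res C.sms)
      also have "\<dots> = ?G (\<lambda>z. if i = j then 1 else 0)"
      proof (rule gc)
        show "(SS k. matrix_inv (g c z) $ i $ k * g c z $ k $ j) = (if i = j then 1 else 0)" if "z \<in> Ov" for z
          using C.hg that Ov_sub by blast
      qed (intro res C.sms)
      finally show ?thesis by (simp add: germ_at_0[OF Ov_open x] germ_at_1[OF Ov_open x])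
    qed
    show "?G (\<lambda>z. matrix_inv (g d (T z)) $ a $ b) = (SS i. SS j. ?G (J a i) * ?G (J b j) * ?G (\<lambda>z. matrix_inv (g c z) $ i $ j))" for a b
    proof -
      have "?G (\<lambda>z. matrix_inv (g d (T z)) $ a $ b) = ?G (\<lambda>z. SS i. SS j. J a i z * J b j z * matrix_inv (g c z) $ i $ j)"
        by (rule gc[OF comp[OF D.h_smooth] inv_change'])
      then show ?thesis by (simp add: gs J_smooth res[OF C.h_smooth] smooth_mult[OF apO] smooth_sum[OF apO])
    qed
  qed
  have gd: "gD (axis k 1) (?G F) = ?G (C.d k F)" if "smooth_on (chart_img c) F" for F k
    unfolding gD[OF res[OF that]] by (rule gc[OF smooth_dder[OF res[OF that]] dres[symmetric]])
  have r2: "2 * (SS i. C.d i (X i) x) + (SS k. (SS i. SS j. matrix_inv (g c x) $ i $ j * C.d k (\<lambda>z. g c z $ i $ j) x) * X k x)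
    = 2 * (SS a. D.d a (X' a) (T x)) + (SS c. (SS a. SS b. matrix_inv (g d (T x)) $ a $ b * D.d c (\<lambda>y. g d y $ a $ b) (T x)) * X' c (T x))"
    using arg_cong[OF r1, of ev]
    by (simp add: gd Xs C.g_smooth ev_simps ev_two ev_sum evg evg[OF comp[OF D.h_smooth]] res comp C.h_smooth D.h_smooth X's D.g_smooth smooth_dder)
  have "x \<in> interior (chart_img c)" "T x \<in> interior (chart_img d)"
    using x T_img[OF x] Ov_sub img_open c d by (auto simp: interior_open)
  then have "2 * C.lap Yc x = 2 * D.lap Yd (T x)"
    using r2 C.lap_trace[OF _ Y(1)] D.lap_trace[OF _ Y(2)] unfolding X_def X'_def by simp
  moreover have "coord_laplacian (g c) Yc x = C.lap Yc x"
    using x Ov_sub by (intro C.laplacian_eq[OF Y(1)]) auto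
  moreover have "coord_laplacian (g d) Yd (T x) = D.lap Yd (T x)"
    using T_img[OF x] by (intro D.laplacian_eq[OF Y(2)]) auto
  ultimately show ?thesis by simp
qed

end

lemma chart_at:
  assumes "p \<in> topspace X" shows "chart_at A p \<in> A" "p \<in> chart_dom (chart_at A p)"
proof -
  have "p \<in> (\<Union>c\<in>A. chart_dom c)" using assms charts_cover by simp
  then have "\<exists>c. c \<in> A \<and> p \<in> chart_dom c" by blast
  from someI_ex[OF this] show "chart_at A p \<in> A" "p \<in> chart_dom (chart_at A p)" by (simp_all add: chart_at_def)
qed

lemma laplacian_chart:
  assumes c: "c \<in> A" and p: "p \<in> chart_dom c" and y: "\<And>d. d \<in> A \<Longrightarrow> smooth_on (chart_img d) (\<lambda>x. y (chart_inv d x))"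
  shows "laplacian A g y p = coord_laplacian (g c) (\<lambda>x. y (chart_inv c x)) (chart_map c p)"
proof -
  let ?d = "chart_at A p"
  have d: "?d \<in> A" "p \<in> chart_dom ?d" using chart_at p dom_sub[OF c] by auto
  have x: "chart_map c p \<in> chart_map c ` (chart_dom c \<inter> chart_dom ?d)" using p d by blast
  have "coord_laplacian (g c) (\<lambda>x. y (chart_inv c x)) (chart_map c p)
      = coord_laplacian (g ?d) (\<lambda>x. y (chart_inv ?d x)) (transition c ?d (chart_map c p))"
    by (rule laplacian_change[OF c d(1) x y[OF c] y[OF d(1)]]) (simp add: inv_T[OF c d(1)])
  also have "transition c ?d (chart_map c p) = chart_map ?d p" using p c by (simp add: transition_def)
  finally show ?thesis by (simp add: laplacian_def Let_def comp_def)
qed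

end

section \<open>Partitions of unity and the divergence theorem\<close>

lemma Ck_open_Un:
  assumes V: "open V" "open W" and f: "Ck_on k V f" "Ck_on k W f"
  shows "Ck_on k (V \<union> W) f"
  using f
proof (induction k arbitrary: f)
  case 0 then show ?case using V by (simp add: continuous_on_open_Un)
next
  case (Suc k)
  have o: "open (V \<union> W)" using V by blast
  have "dder (V \<union> W) v f x = dder V v f x" if "x \<in> V" for x v
    by (rule dder_open_subset(1)[OF V(1) _ that]) blast
  then have 1: "Ck_on k V (dder (V \<union> W) v f)" for v
    using Suc.prems(1) Ck_cong[of V "dder (V \<union> W) v f" "dder V v f" k] by (simp add: Ck_Suc)
  have "dder (V \<union> W) v f x = dder W v f x" if "x \<in> W" for x v
    by (rule dder_open_subset(1)[OF V(2) _ that]) blast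
  then have 2: "Ck_on k W (dder (V \<union> W) v f)" for v
    using Suc.prems(2) Ck_cong[of W "dder (V \<union> W) v f" "dder W v f" k] by (simp add: Ck_Suc)
  have "f differentiable_on V \<union> W"
    using Suc.prems V o by (auto simp: Ck_Suc differentiable_on_eq_differentiable_at)
  then show ?case using Suc.IH[OF 1 2] by (simp add: Ck_Suc)
qed

text \<open>Coordinate expressions take arbitrary values outside the chart image, so a compactly
  supported one is set to zero there before it is integrated over the whole space.\<close>

definition ext0 :: "'e::euclidean_space set \<Rightarrow> ('e \<Rightarrow> real) \<Rightarrow> 'e \<Rightarrow> real" where
  "ext0 V h x = (if x \<in> V then h x else 0)"

context
  fixes V K :: "'e::euclidean_space set" and h :: "'e \<Rightarrow> real"
  assumes V: "open V" and K: "compact K" "K \<subseteq> V" and h0: "\<And>x. x \<in> V \<Longrightarrow> x \<notin> K \<Longrightarrow> h x = 0"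
begin

lemma ext0_out: "x \<notin> K \<Longrightarrow> ext0 V h x = 0"
  using h0 by (simp add: ext0_def)

lemma Ck_ext0: "Ck_on k V h \<Longrightarrow> Ck_on k UNIV (ext0 V h)"
proof -
  assume h: "Ck_on k V h"
  have o: "open (- K)" using K compact_imp_closed by blast
  have 1: "Ck_on k V (ext0 V h)" using h Ck_cong[of V "ext0 V h" h k] by (simp add: ext0_def)
  have "Ck_on k (- K) (\<lambda>x. 0 :: real)" by (rule Ck_const[OF approachable_open[OF o]])
  then have 2: "Ck_on k (- K) (ext0 V h)" using Ck_cong[of "- K" "ext0 V h" "\<lambda>x. 0" k] ext0_out by simp
  have "V \<union> - K = UNIV" using K by blast
  then show ?thesis using Ck_open_Un[OF V o 1 2] by simp
qed

lemma continuous_ext0: "continuous_on V h \<Longrightarrow> continuous_on UNIV (ext0 V h)"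
  using Ck_ext0[of 0] by simp

lemma dder_ext0: "dder UNIV v (ext0 V h) x = ext0 V (dder V v h) x"
proof (cases "x \<in> V")
  case True
  have "dder UNIV v (ext0 V h) x = dder V v (ext0 V h) x" by (rule dder_open_subset(1)[OF V _ True]) simp
  also have "\<dots> = dder V v h x" by (rule dder_cong[OF True]) (simp add: ext0_def)
  finally show ?thesis using True by (simp add: ext0_def)
next
  case False
  have o: "open (- K)" using K compact_imp_closed by blast
  have x: "x \<in> - K" using False K by blast
  have "dder UNIV v (ext0 V h) x = dder (- K) v (ext0 V h) x" by (rule dder_open_subset(1)[OF o _ x]) simp
  also have "\<dots> = dder (- K) v (\<lambda>x. 0) x" by (rule dder_cong[OF x]) (simp add: ext0_out)
  also have "\<dots> = 0" by (rule dder_eq[OF approachable_open[OF o] x]) (rule has_derivative_const)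
  finally show ?thesis using False by (simp add: ext0_def)
qed

end

section \<open>Integration of compactly supported functions and C^1 bumps\<close>

lemma lborel_integral_cbox:
  fixes F :: "'e::euclidean_space \<Rightarrow> real"
  assumes "continuous_on UNIV F" "\<And>x. x \<notin> cbox a b \<Longrightarrow> F x = 0"
  shows "integrable lborel F" "integral\<^sup>L lborel F = integral (cbox a b) F"
proof -
  have c: "continuous_on (cbox a b) F" using assms(1) continuous_on_subset by blast
  have i: "set_integrable lborel (cbox a b) F"
    unfolding set_integrable_def by (rule borel_integrable_compact[OF compact_cbox c])
  have F: "(\<lambda>x. indicator (cbox a b) x *\<^sub>R F x) = F"
    using assms(2) by (auto simp: fun_eq_iff indicator_def)
  show "integrable lborel F" using i unfolding set_integrable_def F .
  show "integral\<^sup>L lborel F = integral (cbox a b) F"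
    using set_borel_integral_eq_integral(2)[OF i] unfolding set_lebesgue_integral_def F .
qed

lemma compact_in_cbox:
  fixes K :: "'e::euclidean_space set"
  assumes "compact K" obtains a b where "K \<subseteq> cbox a b"
  using bounded_subset_cbox_symmetric[OF compact_imp_bounded[OF assms]] by blast

text \<open>By translation invariance the integral of F (x + s v) is independent of s.
  Differentiating under the integral sign at s = 0 gives the integral of the derivative in direction
  v.\<close>

lemma integral_partial_zero:
  fixes F :: "'e::euclidean_space \<Rightarrow> real"
  assumes F: "Ck_on (Suc 0) UNIV F" and K: "compact K" and out: "\<And>x. x \<notin> K \<Longrightarrow> F x = 0"
  shows "integral\<^sup>L lborel (dder UNIV v F) = 0" "integrable lborel (dder UNIV v F)"
proof -
  have Fd: "F differentiable_on UNIV" and dc: "continuous_on UNIV (dder UNIV v F)" using F by (simp_all add: Ck_Suc)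
  have Fc: "continuous_on UNIV F" using Fd differentiable_imp_continuous_on by blast
  \<comment> \<open>The union of the supports of all translates with |s| at most 1 is compact, so a
    single box serves for every s.\<close>
  have "compact ((\<lambda>(x, s). x - s *\<^sub>R v) ` (K \<times> {-1..1::real}))"
    by (intro compact_continuous_image compact_Times K) (auto intro!: continuous_intros simp: split_beta)
  then obtain a b where ab: "(\<lambda>(x, s). x - s *\<^sub>R v) ` (K \<times> {-1..1::real}) \<subseteq> cbox a b" by (rule compact_in_cbox)
  have out': "F (x + s *\<^sub>R v) = 0" if "s \<in> {-1..1}" "x \<notin> cbox a b" for x s
  proof (rule out, rule notI)
    assume "x + s *\<^sub>R v \<in> K"
    then have "x \<in> (\<lambda>(x, s). x - s *\<^sub>R v) ` (K \<times> {-1..1::real})"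
      using that(1) by (intro image_eqI[of _ _ "(x + s *\<^sub>R v, s)"]) auto
    then show False using ab that(2) by blast
  qed
  have "K \<subseteq> (\<lambda>(x, s). x - s *\<^sub>R v) ` (K \<times> {-1..1::real})"
  proof
    fix x assume "x \<in> K" then show "x \<in> (\<lambda>(x, s). x - s *\<^sub>R v) ` (K \<times> {-1..1::real})"
      by (intro image_eqI[of _ _ "(x, 0)"]) auto
  qed
  then have Kab: "K \<subseteq> cbox a b" using ab by blast
  have der: "((\<lambda>s. F (x + s *\<^sub>R v)) has_field_derivative dder UNIV v F (x + s *\<^sub>R v)) (at s within {-1..1})" for x s
  proof -
    have D: "(F has_derivative (\<lambda>w. dder UNIV w F (x + s *\<^sub>R v))) (at (x + s *\<^sub>R v))"
      using dder_has_derivative[OF Fd, of "x + s *\<^sub>R v"] by simp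
    have "((\<lambda>s. F (x + s *\<^sub>R v)) has_derivative (\<lambda>c. dder UNIV (c *\<^sub>R v) F (x + s *\<^sub>R v))) (at s within {-1..1})"
      by (rule has_derivative_compose[where f="\<lambda>s. x + s *\<^sub>R v" and f'="\<lambda>c. c *\<^sub>R v", OF _ D]) (auto intro!: derivative_eq_intros)
    moreover have "dder UNIV (c *\<^sub>R v) F (x + s *\<^sub>R v) = dder UNIV v F (x + s *\<^sub>R v) * c" for c
      using linear_cmul[OF has_derivative_linear[OF D], of c v] by simp
    ultimately show ?thesis by (simp add: has_field_derivative_def)
  qed
  have "((\<lambda>s. integral (cbox a b) (\<lambda>x. F (x + s *\<^sub>R v))) has_field_derivative
      integral (cbox a b) (\<lambda>x. dder UNIV v F (x + 0 *\<^sub>R v))) (at 0 within {-1..1::real})"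
  proof (rule leibniz_rule_field_derivative[where fx = "\<lambda>s x. dder UNIV v F (x + s *\<^sub>R v)"])
    show "(\<lambda>x. F (x + s *\<^sub>R v)) integrable_on cbox a b" for s
      by (intro integrable_continuous continuous_on_compose2[OF Fc]) (auto intro!: continuous_intros)
    show "continuous_on ({- 1..1} \<times> cbox a b) (\<lambda>(s, x). dder UNIV v F (x + s *\<^sub>R v))"
      unfolding split_beta by (intro continuous_on_compose2[OF dc]) (auto intro!: continuous_intros)
  qed (use der in auto)
  moreover have "integral (cbox a b) (\<lambda>x. F (x + s *\<^sub>R v)) = integral (cbox a b) F" if "s \<in> {-1..1}" for s
  proof -
    have c: "continuous_on UNIV (\<lambda>x. F (x + s *\<^sub>R v))"
      by (intro continuous_on_compose2[OF Fc]) (auto intro!: continuous_intros)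
    have "integral (cbox a b) (\<lambda>x. F (x + s *\<^sub>R v)) = (LINT x|lborel. F (x + s *\<^sub>R v))"
      using out'[OF that] by (intro lborel_integral_cbox(2)[symmetric] c) auto
    also have "\<dots> = (LINT x|distr lborel borel ((+) (s *\<^sub>R v)). F x)"
      using borel_measurable_continuous_onI[OF Fc] by (subst integral_distr) (auto simp: add.commute)
    also have "\<dots> = integral (cbox a b) F"
      unfolding lborel_distr_plus using out Kab by (intro lborel_integral_cbox(2) Fc) auto
    finally show ?thesis .
  qed
  then have "((\<lambda>s. integral (cbox a b) (\<lambda>x. F (x + s *\<^sub>R v))) has_field_derivative 0) (at 0 within {-1..1::real})"
    by (intro has_field_derivative_transform_within[OF DERIV_const[of "integral (cbox a b) F"], of 1]) auto
  ultimately have "integral (cbox a b) (\<lambda>x. dder UNIV v F (x + 0 *\<^sub>R v)) = 0"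
  proof -
    assume a1: "((\<lambda>s. integral (cbox a b) (\<lambda>x. F (x + s *\<^sub>R v))) has_field_derivative
        integral (cbox a b) (\<lambda>x. dder UNIV v F (x + 0 *\<^sub>R v))) (at 0 within {-1..1::real})"
      and a2: "((\<lambda>s. integral (cbox a b) (\<lambda>x. F (x + s *\<^sub>R v))) has_field_derivative 0) (at 0 within {-1..1::real})"
    have "at (0::real) within {-1..1} = at 0" by (intro at_within_interior) auto
    then show ?thesis using DERIV_unique a1 a2 by metis
  qed
  moreover have "dder UNIV v F x = 0" if "x \<notin> cbox a b" for x
  proof -
    have x: "x \<in> - cbox a b" using that by simp
    have o: "open (- cbox a b)" by (intro open_Compl closed_cbox)
    have "dder UNIV v F x = dder (- cbox a b) v F x" by (rule dder_open_subset(1)[OF o _ x]) simp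
    also have "\<dots> = dder (- cbox a b) v (\<lambda>x. 0) x" using out Kab by (intro dder_cong[OF x]) auto
    also have "\<dots> = 0" by (rule dder_eq[OF approachable_open[OF o] x]) (rule has_derivative_const)
    finally show ?thesis .
  qed
  ultimately show "integral\<^sup>L lborel (dder UNIV v F) = 0" "integrable lborel (dder UNIV v F)"
    using lborel_integral_cbox[OF dc, of a b] by simp_all
qed

lemma max_sq_derivative: "((\<lambda>s::real. (max 0 s)\<^sup>2) has_real_derivative 2 * max 0 s) (at s)"
proof -
  consider "s < 0" | "s = 0" | "s > 0" by linarith
  then show ?thesis
  proof cases
    case 1
    have "((\<lambda>s. 0) has_real_derivative 0) (at s)" by simp
    then have "((\<lambda>s::real. (max 0 s)\<^sup>2) has_real_derivative 0) (at s)"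
      by (rule has_field_derivative_transform_within_open[where S="{..<0}"]) (use 1 in auto)
    then show ?thesis using 1 by simp
  next
    case 3
    have "((\<lambda>s. s\<^sup>2) has_real_derivative 2 * s) (at s)" by (auto intro!: derivative_eq_intros)
    then have "((\<lambda>s::real. (max 0 s)\<^sup>2) has_real_derivative 2 * s) (at s)"
      by (rule has_field_derivative_transform_within_open[where S="{0<..}"]) (use 3 in auto)
    then show ?thesis using 3 by simp
  next
    case 2
    have "(\<lambda>h::real. (max 0 h)\<^sup>2 / h) = (\<lambda>h. max 0 h)"
      by (auto simp: fun_eq_iff max_def power2_eq_square)
    moreover have "((\<lambda>h::real. max 0 h) \<longlongrightarrow> max 0 0) (at 0)" by (intro tendsto_intros)
    ultimately show ?thesis unfolding 2 by (simp add: DERIV_def)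
  qed
qed

text \<open>The square of the positive part has the continuous derivative 2 max 0 s. For r > 0 the
  bump is positive exactly on the open ball around a of radius sqrt r.\<close>

lemma bump_C1: "Ck_on (Suc 0) UNIV (\<lambda>y::'e::euclidean_space. (max 0 (r - (y - a) \<bullet> (y - a)))\<^sup>2)"
proof (rule Ck_SucI)
  show "approachable (UNIV :: 'e set)" by (simp add: approachable_open)
  show "((\<lambda>y. (max 0 (r - (y - a) \<bullet> (y - a)))\<^sup>2) has_derivative (\<lambda>v. - (2 * (v \<bullet> (y - a))) * (2 * max 0 (r - (y - a) \<bullet> (y - a))))) (at y within UNIV)" for y :: 'e
  proof (rule DERIV_compose_FDERIV[OF max_sq_derivative])
    show "((\<lambda>y. r - (y - a) \<bullet> (y - a)) has_derivative (\<lambda>v. - (2 * (v \<bullet> (y - a))))) (at y within UNIV)"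
      by (auto intro!: derivative_eq_intros simp: inner_commute algebra_simps)
  qed
  show "Ck_on 0 UNIV (\<lambda>y. - (2 * (v \<bullet> (y - a))) * (2 * max 0 (r - (y - a) \<bullet> (y - a))))" for v :: 'e
    by (auto intro!: continuous_intros)
qed

section \<open>Cutoffs and a partition of unity on the manifold\<close>

context closed_mfd
begin

lemma inv_continuous: "c \<in> A \<Longrightarrow> continuous_map (top_of_set (chart_img c)) X (chart_inv c)"
  unfolding continuous_map_def
proof (intro conjI allI impI)
  assume c: "c \<in> A"
  show "chart_inv c \<in> topspace (top_of_set (chart_img c)) \<rightarrow> topspace X" using dom_sub[OF c] inv_dom by auto
  fix W assume "openin X W"
  then have "open (chart_map c ` (W \<inter> chart_dom c))" by (rule open_map_image[OF c])
  moreover have "{x \<in> topspace (top_of_set (chart_img c)). chart_inv c x \<in> W} = chart_map c ` (W \<inter> chart_dom c)"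
    by (simp add: map_image_eq[OF c])
  moreover have "chart_map c ` (W \<inter> chart_dom c) \<subseteq> chart_img c" by auto
  ultimately show "openin (top_of_set (chart_img c)) {x \<in> topspace (top_of_set (chart_img c)). chart_inv c x \<in> W}"
    by (simp add: openin_open_eq[OF img_open[OF c]])
qed

text \<open>This uses the Hausdorff property. The complement of such a set is open, so a function
  supported in it and extended by zero keeps its regularity in every other chart.\<close>

lemma closed_inv_image:
  assumes c: "c \<in> A" and K: "compact K" "K \<subseteq> chart_img c"
  shows "closedin X (chart_inv c ` K)"
proof -
  have "compactin (top_of_set (chart_img c)) K" using K by (simp add: compactin_subtopology)
  then have "compactin X (chart_inv c ` K)" by (rule image_compactin[OF _ inv_continuous[OF c]])
  moreover have "Hausdorff_space X" using mfd by (simp add: closed_manifold_def)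
  ultimately show ?thesis by (rule compactin_imp_closedin[rotated])
qed

lemma inv_image_eq: "c \<in> A \<Longrightarrow> K \<subseteq> chart_img c \<Longrightarrow> chart_inv c ` K = {p \<in> chart_dom c. chart_map c p \<in> K}"
proof -
  assume c: "c \<in> A" and K: "K \<subseteq> chart_img c"
  have "p \<in> chart_inv c ` K" if "p \<in> chart_dom c" "chart_map c p \<in> K" for p
    using that c by (intro image_eqI[of _ _ "chart_map c p"]) auto
  then show ?thesis using K by auto
qed

text \<open>The support is confined to a compact set inside one chart, while the C^1 condition is
  imposed in every chart of the atlas; a pointwise zero outside the chart would not give the
  latter.\<close>

definition cutoff :: "('a, 'n) chart \<Rightarrow> (real^'n) set \<Rightarrow> ('a \<Rightarrow> real) \<Rightarrow> bool" where
  "cutoff c K \<eta> \<longleftrightarrow> c \<in> A \<and> compact K \<and> K \<subseteq> chart_img c \<and>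
     (\<forall>d\<in>A. Ck_on (Suc 0) (chart_img d) (\<lambda>x. \<eta> (chart_inv d x))) \<and>
     (\<forall>p\<in>topspace X. \<not> (p \<in> chart_dom c \<and> chart_map c p \<in> K) \<longrightarrow> \<eta> p = 0)"

lemma bump_exists:
  assumes p: "p \<in> topspace X"
  obtains c K b where "cutoff c K b" "\<And>q. 0 \<le> b q" "openin X {q \<in> topspace X. 0 < b q}" "0 < b p"
proof -
  have "p \<in> (\<Union>c\<in>A. chart_dom c)" using p charts_cover by simp
  then obtain c where c: "c \<in> A" "p \<in> chart_dom c" by blast
  obtain r where r: "r > 0" "cball (chart_map c p) r \<subseteq> chart_img c"
    using img_open[OF c(1)] c(2) open_contains_cball map_img by metis
  define K where "K = cball (chart_map c p) r"
  define \<beta> where "\<beta> y = (max 0 (r\<^sup>2 - (y - chart_map c p) \<bullet> (y - chart_map c p)))\<^sup>2" for y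
  define b where "b q = (if q \<in> chart_dom c then \<beta> (chart_map c q) else 0)" for q
  have \<beta>pos: "0 < \<beta> y \<longleftrightarrow> y \<in> ball (chart_map c p) r" for y
  proof -
    have "norm (y - chart_map c p) < r \<longleftrightarrow> (norm (y - chart_map c p))\<^sup>2 < r\<^sup>2"
      using power_strict_mono[of "norm (y - chart_map c p)" r 2] power2_less_imp_less[of "norm (y - chart_map c p)" r] r(1)
      by auto
    then have "y \<in> ball (chart_map c p) r \<longleftrightarrow> (norm (y - chart_map c p))\<^sup>2 < r\<^sup>2"
      by (simp add: dist_norm norm_minus_commute)
    then show ?thesis by (auto simp: \<beta>_def power2_norm_eq_inner max_def)
  qed
  have \<beta>0: "\<beta> y = 0" if "y \<notin> K" for y
  proof -
    have "\<not> 0 < \<beta> y" using that unfolding \<beta>pos K_def by auto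
    moreover have "0 \<le> \<beta> y" by (simp add: \<beta>_def)
    ultimately show ?thesis by simp
  qed
  have \<beta>C: "Ck_on (Suc 0) UNIV \<beta>" unfolding \<beta>_def[abs_def] by (rule bump_C1)
  have K: "compact K" "K \<subseteq> chart_img c" using r by (simp_all add: K_def)
  have cut: "cutoff c K b"
    unfolding cutoff_def
  proof (intro conjI ballI impI c(1) K)
    fix d assume d: "d \<in> A"
    \<comment> \<open>Two open sets cover the image of chart d: on the overlap with c the function
      is the bump composed with a transition map, and off the compact support it is zero.\<close>
    let ?V1 = "chart_map d ` (chart_dom d \<inter> chart_dom c)"
    let ?V2 = "chart_map d ` ((topspace X - chart_inv c ` K) \<inter> chart_dom d)"
    have o1: "open ?V1" and T: "smooth_on ?V1 (transition d c)" using transition_smooth[OF d c(1)] by auto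
    have o2: "open ?V2" by (rule open_map_image[OF d]) (use closed_inv_image[OF c(1) K] in \<open>simp add: openin_diff\<close>)
    have "Ck_on (Suc 0) ?V1 (\<lambda>x. \<beta> (transition d c x))"
      using T by (intro Ck_compose[OF o1 open_UNIV _ _ \<beta>C]) (auto simp: smooth_on_def)
    moreover have "b (chart_inv d x) = \<beta> (transition d c x)" if "x \<in> ?V1" for x
      using that d by (auto simp: b_def transition_def)
    ultimately have 1: "Ck_on (Suc 0) ?V1 (\<lambda>x. b (chart_inv d x))"
      using Ck_cong[of ?V1 "\<lambda>x. b (chart_inv d x)" "\<lambda>x. \<beta> (transition d c x)"] by blast
    have "b (chart_inv d x) = 0" if "x \<in> ?V2" for x
    proof -
      obtain q where q: "q \<in> chart_dom d" "q \<notin> chart_inv c ` K" "x = chart_map d q"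
        using \<open>x \<in> ?V2\<close> by (elim imageE IntE DiffE)
      then have "q \<notin> chart_dom c \<or> chart_map c q \<notin> K" using inv_image_eq[OF c(1) K(2)] by blast
      then show ?thesis using q d \<beta>0 by (auto simp: b_def)
    qed
    moreover have "Ck_on (Suc 0) ?V2 (\<lambda>x. 0 :: real)" by (rule Ck_const[OF approachable_open[OF o2]])
    ultimately have 2: "Ck_on (Suc 0) ?V2 (\<lambda>x. b (chart_inv d x))"
      using Ck_cong[of ?V2 "\<lambda>x. b (chart_inv d x)" "\<lambda>x. 0"] by blast
    have "chart_img d = ?V1 \<union> ?V2"
    proof
      show "chart_img d \<subseteq> ?V1 \<union> ?V2"
        unfolding chart_img_def using inv_image_eq[OF c(1) K(2)] dom_sub[OF d] by blast
    qed auto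
    then show "Ck_on (Suc 0) (chart_img d) (\<lambda>x. b (chart_inv d x))" using Ck_open_Un[OF o1 o2 1 2] by simp
  next
    fix q assume "q \<in> topspace X" "\<not> (q \<in> chart_dom c \<and> chart_map c q \<in> K)"
    then show "b q = 0" using \<beta>0 by (auto simp: b_def)
  qed
  have "{q \<in> topspace X. 0 < b q} = {q \<in> chart_dom c. chart_map c q \<in> ball (chart_map c p) r}"
    using dom_sub[OF c(1)] by (auto simp: b_def \<beta>pos simp del: mem_ball)
  then have op: "openin X {q \<in> topspace X. 0 < b q}" using open_inv_image[OF c(1) open_ball] by simp
  have "0 < b p" using c(2) r(1) by (simp add: b_def \<beta>pos)
  moreover have "0 \<le> b q" for q by (simp add: b_def \<beta>_def)
  ultimately show ?thesis using that cut op by blast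
qed

lemma Ck_sum:
  assumes "approachable S" "finite I" "\<And>i. i \<in> I \<Longrightarrow> Ck_on k S (f i)"
  shows "Ck_on k S (\<lambda>x. \<Sum>i\<in>I. f i x :: real)"
  using assms(2,3) by (induction I) (simp_all add: Ck_const[OF assms(1)] Ck_add[OF assms(1)])

text \<open>By compactness finitely many bumps have a positive sum, by which each is divided. They
  are indexed by the points at which they were chosen.\<close>

theorem partition_of_unity:
  obtains P :: "'a set" and c K \<eta> where "finite P" "\<And>p. p \<in> P \<Longrightarrow> cutoff (c p) (K p) (\<eta> p)"
    "\<And>p q. p \<in> P \<Longrightarrow> q \<in> topspace X \<Longrightarrow> 0 \<le> \<eta> p q" "\<And>q. q \<in> topspace X \<Longrightarrow> (\<Sum>p\<in>P. \<eta> p q) = 1"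
proof -
  have "\<forall>p\<in>topspace X. \<exists>z. cutoff (fst z) (fst (snd z)) (snd (snd z)) \<and> (\<forall>q. 0 \<le> snd (snd z) q) \<and>
      openin X {q \<in> topspace X. 0 < snd (snd z) q} \<and> 0 < snd (snd z) p"
  proof
    fix p assume "p \<in> topspace X"
    then show "\<exists>z. cutoff (fst z) (fst (snd z)) (snd (snd z)) \<and> (\<forall>q. 0 \<le> snd (snd z) q) \<and>
      openin X {q \<in> topspace X. 0 < snd (snd z) q} \<and> 0 < snd (snd z) p"
    proof (rule bump_exists)
      fix c K b assume "cutoff c K b" "\<And>q. 0 \<le> b q" "openin X {q \<in> topspace X. 0 < b q}" "0 < b p"
      then show ?thesis by (intro exI[of _ "(c, K, b)"]) simp
    qed
  qed
  from bchoice[OF this] obtain Z where Z: "\<forall>p\<in>topspace X. cutoff (fst (Z p)) (fst (snd (Z p))) (snd (snd (Z p))) \<and>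
      (\<forall>q. 0 \<le> snd (snd (Z p)) q) \<and> openin X {q \<in> topspace X. 0 < snd (snd (Z p)) q} \<and> 0 < snd (snd (Z p)) p" ..
  define c where "c p = fst (Z p)" for p
  define K where "K p = fst (snd (Z p))" for p
  define b where "b p = snd (snd (Z p))" for p
  have b: "\<And>p. p \<in> topspace X \<Longrightarrow> cutoff (c p) (K p) (b p)" "\<And>p q. p \<in> topspace X \<Longrightarrow> 0 \<le> b p q"
    "\<And>p. p \<in> topspace X \<Longrightarrow> openin X {q \<in> topspace X. 0 < b p q}" "\<And>p. p \<in> topspace X \<Longrightarrow> 0 < b p p"
    using Z by (simp_all add: c_def K_def b_def)
  define N where "N p = {q \<in> topspace X. 0 < b p q}" for p
  have "compactin X (topspace X)" using mfd by (simp add: closed_manifold_def compact_space_def)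
  moreover have "topspace X \<subseteq> (\<Union>p\<in>topspace X. N p)"
  proof
    fix p assume "p \<in> topspace X"
    then show "p \<in> (\<Union>p\<in>topspace X. N p)" using b(4) by (intro UN_I[of p]) (simp_all add: N_def)
  qed
  moreover have "openin X (N p)" if "p \<in> topspace X" for p unfolding N_def by (rule b(3)[OF that])
  ultimately obtain F where F: "finite F" "F \<subseteq> N ` topspace X" "topspace X \<subseteq> \<Union> F"
    using compactinD[of X "topspace X" "N ` topspace X"] by (auto simp del: UN_simps)
  obtain P where P: "P \<subseteq> topspace X" "finite P" "F = N ` P"
    using finite_subset_image[OF F(1,2)] by blast
  define s where "s q = (\<Sum>p\<in>P. b p q)" for q
  have spos: "0 < s q" if "q \<in> topspace X" for q
  proof -
    have "q \<in> \<Union> F" using F(3) \<open>q \<in> topspace X\<close> by (rule subsetD)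
    then obtain p where p: "p \<in> P" "q \<in> N p" using P(3) by auto
    have "0 < b p q" using p(2) by (simp add: N_def)
    also have "b p q \<le> s q" unfolding s_def using P(1,2) p(1) b(2) by (intro member_le_sum) (auto dest: subsetD)
    finally show ?thesis .
  qed
  show ?thesis
  proof
    show "finite P" by fact
    show "cutoff (c p) (K p) (\<lambda>q. b p q * inverse (s q))" if p: "p \<in> P" for p
    proof -
      have bc: "cutoff (c p) (K p) (b p)" using b(1) p P(1) by blast
      have "Ck_on (Suc 0) (chart_img d) (\<lambda>x. b p (chart_inv d x) * inverse (s (chart_inv d x)))" if d: "d \<in> A" for d
      proof -
        note ap = approachable_open[OF img_open[OF d]]
        have bd: "Ck_on (Suc 0) (chart_img d) (\<lambda>x. b q (chart_inv d x))" if "q \<in> P" for q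
          using b(1)[of q] P(1) that d by (auto simp: cutoff_def)
        have "Ck_on (Suc 0) (chart_img d) (\<lambda>x. s (chart_inv d x))"
          unfolding s_def by (rule Ck_sum[OF ap P(2) bd])
        then have "Ck_on (Suc 0) (chart_img d) (\<lambda>x. inverse (s (chart_inv d x)))"
        proof (rule Ck_inverse[OF ap])
          fix x assume "x \<in> chart_img d"
          then have "chart_inv d x \<in> topspace X" using dom_sub[OF d] inv_dom by blast
          then show "s (chart_inv d x) \<noteq> 0" using spos by force
        qed
        then show ?thesis using bd[OF p] by (rule Ck_mult[OF ap, rotated])
      qed
      then show ?thesis using bc unfolding cutoff_def by simp
    qed
    show "0 \<le> b p q * inverse (s q)" if "p \<in> P" "q \<in> topspace X" for p q
      using b(2)[of p q] P(1) spos[OF that(2)] that(1) by (simp add: subset_iff less_imp_le)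
    show "(\<Sum>p\<in>P. b p q * inverse (s q)) = 1" if "q \<in> topspace X" for q
      using spos[OF that] by (simp add: s_def flip: sum_distrib_right)
  qed
qed

end

section \<open>The divergence theorem for the Laplacian\<close>

context riemannian_mfd
begin

lemma compact_chart_integral:
  fixes f :: "'a \<Rightarrow> real"
  assumes c: "c \<in> A" and K: "compact K" "K \<subseteq> chart_img c"
    and cont: "continuous_on (chart_img c) (\<lambda>x. f (chart_inv c x))"
    and out: "\<And>p. p \<in> topspace X \<Longrightarrow> \<not> (p \<in> chart_dom c \<and> chart_map c p \<in> K) \<Longrightarrow> f p = 0"
  shows "integral\<^sup>L vol_measure f = (LINT x|lborel. ext0 (chart_img c) (\<lambda>x. dens c x * f (chart_inv c x)) x)"
    and "integrable vol_measure f"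
proof -
  let ?V = "chart_img c" and ?h = "\<lambda>x. dens c x * f (chart_inv c x)"
  have V: "open ?V" by (rule img_open[OF c])
  have h0: "?h x = 0" if "x \<in> ?V" "x \<notin> K" for x
    using out[OF subsetD[OF dom_sub[OF c] inv_dom[OF that(1)]]] that by simp
  have hc: "continuous_on ?V ?h" by (intro continuous_on_mult dens_continuous[OF c] cont)
  have e: "continuous_on UNIV (ext0 ?V ?h)" by (rule continuous_ext0[OF V K h0 hc])
  obtain a b where ab: "K \<subseteq> cbox a b" by (rule compact_in_cbox[OF K(1)])
  have "ext0 ?V ?h x = 0" if "x \<notin> cbox a b" for x
  proof (rule ext0_out[where h="?h", OF V K h0])
    show "x \<notin> K" using ab that by blast
  qed
  from lborel_integral_cbox(1)[OF e this] have i: "integrable lborel (ext0 ?V ?h)" .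
  have eq: "(\<lambda>x. indicator ?V x *\<^sub>R ?h x) = ext0 ?V ?h" by (auto simp: fun_eq_iff ext0_def indicator_def)
  have s: "?V \<inter> space lborel \<in> sets lborel" using V by simp
  note ci = chart_integral[OF c cont out]
  show "integral\<^sup>L vol_measure f = (LINT x|lborel. ext0 ?V ?h x)"
    using integral_restrict_space[OF s, of ?h, unfolded eq] by (subst ci(1)) simp_all
  show "integrable vol_measure f"
    using i integrable_restrict_space[OF s, of ?h, unfolded eq] by (subst ci(2)) simp_all
qed

lemma cutoff_continuous: "cutoff c K \<eta> \<Longrightarrow> d \<in> A \<Longrightarrow> continuous_on (chart_img d) (\<lambda>x. \<eta> (chart_inv d x))"
  unfolding cutoff_def by (blast intro: Ck_SucD[of 0, unfolded Ck_on.simps(1)])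

definition inn :: "('a \<Rightarrow> real) \<Rightarrow> ('a \<Rightarrow> real) \<Rightarrow> 'a \<Rightarrow> real" where
  "inn u w p = (let d = chart_at A p in
    coord_inner (g d) (\<lambda>x. u (chart_inv d x)) (\<lambda>x. w (chart_inv d x)) (chart_map d p))"

lemma inn_chart:
  assumes c: "c \<in> A" and p: "p \<in> chart_dom c"
    and u: "\<And>d. d \<in> A \<Longrightarrow> (\<lambda>x. u (chart_inv d x)) differentiable_on chart_img d"
    and w: "\<And>d. d \<in> A \<Longrightarrow> (\<lambda>x. w (chart_inv d x)) differentiable_on chart_img d"
  shows "inn u w p = coord_inner (g c) (\<lambda>x. u (chart_inv c x)) (\<lambda>x. w (chart_inv c x)) (chart_map c p)"
proof -
  let ?d = "chart_at A p"
  have d: "?d \<in> A" "p \<in> chart_dom ?d" using chart_at p dom_sub[OF c] by auto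
  have x: "chart_map c p \<in> chart_map c ` (chart_dom c \<inter> chart_dom ?d)" using p d by blast
  have T: "transition c ?d (chart_map c p) = chart_map ?d p" using p c by (simp add: transition_def)
  have D: "\<exists>F'. (F has_derivative F') (at (transition c ?d (chart_map c p)))" if "F differentiable_on chart_img ?d" for F :: "real^'n \<Rightarrow> real"
    using that d img_open[OF d(1)] unfolding T differentiable_on_eq_differentiable_at[OF img_open[OF d(1)]] differentiable_def by auto
  obtain F' where F': "((\<lambda>x. u (chart_inv ?d x)) has_derivative F') (at (transition c ?d (chart_map c p)))"
    using D[OF u[OF d(1)]] ..
  obtain G' where G': "((\<lambda>x. w (chart_inv ?d x)) has_derivative G') (at (transition c ?d (chart_map c p)))"
    using D[OF w[OF d(1)]] ..
  have "coord_inner (g c) (\<lambda>x. u (chart_inv c x)) (\<lambda>x. w (chart_inv c x)) (chart_map c p)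
     = coord_inner (g ?d) (\<lambda>x. u (chart_inv ?d x)) (\<lambda>x. w (chart_inv ?d x)) (transition c ?d (chart_map c p))"
    by (rule inner_change[OF c d(1) x F' _ G']) (simp_all add: inv_T[OF c d(1)])
  then show ?thesis by (simp add: inn_def Let_def T)
qed

lemma partial_zero:
  assumes V: "open V" "x \<in> V" and f: "\<And>y. y \<in> V \<Longrightarrow> f y = k"
  shows "partial i f x = 0"
proof -
  have "partial i f x = dder V (axis i 1) (\<lambda>x. k) x" by (rule partial_open[OF V f])
  also have "\<dots> = 0" by (rule dder_eq[OF approachable_open[OF V(1)] V(2)]) (rule has_derivative_const)
  finally show ?thesis .
qed

text \<open>\<open>inn\<close> is computed in the chart chosen at p, which may differ from c. In
  that chart p has a neighbourhood off the compact support, on which \<eta> vanishes, so its partial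
  derivatives at p are zero.\<close>

lemma cutoff_inn_zero:
  assumes "cutoff c K \<eta>" "p \<in> topspace X" "\<not> (p \<in> chart_dom c \<and> chart_map c p \<in> K)"
  shows "inn \<eta> y p = 0"
proof -
  let ?d = "chart_at A p"
  have d: "?d \<in> A" "p \<in> chart_dom ?d" using chart_at assms(2) by auto
  have c: "c \<in> A" "compact K" "K \<subseteq> chart_img c" using assms(1) by (simp_all add: cutoff_def)
  let ?V = "chart_map ?d ` ((topspace X - chart_inv c ` K) \<inter> chart_dom ?d)"
  have o: "open ?V" by (rule open_map_image[OF d(1)]) (use closed_inv_image[OF c] in \<open>simp add: openin_diff\<close>)
  have p: "chart_map ?d p \<in> ?V" using d assms inv_image_eq[OF c(1,3)] by blast
  have "\<eta> (chart_inv ?d y) = 0" if "y \<in> ?V" for y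
  proof -
    from that obtain q where q: "q \<in> topspace X" "q \<in> chart_dom ?d" "q \<notin> chart_inv c ` K" "y = chart_map ?d q"
      by (elim imageE IntE DiffE)
    then have "\<not> (q \<in> chart_dom c \<and> chart_map c q \<in> K)" using inv_image_eq[OF c(1,3)] by blast
    then show ?thesis using assms(1) q d by (simp add: cutoff_def)
  qed
  from partial_zero[OF o p this] show ?thesis by (simp add: inn_def Let_def coord_inner_def)
qed

lemma cutoff_differentiable: "cutoff c K \<eta> \<Longrightarrow> d \<in> A \<Longrightarrow> (\<lambda>x. \<eta> (chart_inv d x)) differentiable_on chart_img d"
  by (simp add: cutoff_def Ck_Suc)

context
  fixes y :: "'a \<Rightarrow> real"
  assumes y: "\<And>d. d \<in> A \<Longrightarrow> smooth_on (chart_img d) (\<lambda>x. y (chart_inv d x))"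
begin

lemma laplacian_continuous: "c \<in> A \<Longrightarrow> continuous_on (chart_img c) (\<lambda>x. laplacian A g y (chart_inv c x))"
proof -
  assume c: "c \<in> A"
  interpret C: coord_link "chart_img c" "\<lambda>i. axis i 1" "\<lambda>i j x. g c x $ i $ j" "\<lambda>i j x. matrix_inv (g c x) $ i $ j"
    "chart_img c" "\<lambda>x. x" "g c" by (rule link_chart[OF c])
  have "laplacian A g y (chart_inv c x) = C.lap (\<lambda>x. y (chart_inv c x)) x" if "x \<in> chart_img c" for x
    using that by (simp add: laplacian_chart[OF c _ y] C.laplacian_eq[OF y[OF c] refl])
  then show ?thesis
    using smooth_continuous[OF C.smooth_lap[OF y[OF c]]] by (simp cong: continuous_on_cong)
qed

text \<open>The integrand is div (\<eta> grad y). In the chart c its product with the volume density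
  is a sum of partial derivatives of compactly supported C^1 functions, each of which integrates to
  zero.\<close>

lemma cutoff_divergence:
  assumes cut: "cutoff c K \<eta>"
  defines "f \<equiv> \<lambda>p. \<eta> p * laplacian A g y p + inn \<eta> y p"
  shows "integral\<^sup>L vol_measure f = 0" "integrable vol_measure f"
proof -
  have c: "c \<in> A" and K: "compact K" "K \<subseteq> chart_img c" using cut by (simp_all add: cutoff_def)
  interpret C: coord_link "chart_img c" "\<lambda>i. axis i 1" "\<lambda>i j x. g c x $ i $ j" "\<lambda>i j x. matrix_inv (g c x) $ i $ j"
    "chart_img c" "\<lambda>x. x" "g c" by (rule link_chart[OF c])
  let ?V = "chart_img c"
  note V = img_open[OF c]
  note ap = approachable_open[OF V]
  define Y where "Y x = y (chart_inv c x)" for x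
  define E where "E x = \<eta> (chart_inv c x)" for x
  define W where "W i x = C.vol x * (SS j. matrix_inv (g c x) $ i $ j * C.d j Y x)" for i x
  have Ys: "smooth_on ?V Y" unfolding Y_def[abs_def] by (rule y[OF c])
  have Ws: "smooth_on ?V (W i)" for i unfolding W_def[abs_def] by (intro C.sms Ys)
  have Ec: "Ck_on (Suc 0) ?V E" using cut c by (simp add: cutoff_def E_def[abs_def])
  have Ed: "E differentiable_on ?V" using Ec by (simp add: Ck_Suc)
  have EW: "Ck_on (Suc 0) ?V (\<lambda>x. E x * W i x)" for i
    by (rule Ck_mult[OF ap Ec]) (use Ws[of i] in \<open>simp add: smooth_on_def del: Ck_on.simps\<close>)
  have E0: "E x * W i x = 0" if "x \<in> ?V" "x \<notin> K" for i x
    using cut that subsetD[OF dom_sub[OF c] inv_dom[OF that(1)]] by (auto simp: cutoff_def E_def)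
  \<comment> \<open>The i-th component of the field \<eta> grad y times the volume density,
    continued by zero to the whole coordinate space.\<close>
  define F where "F i = ext0 ?V (\<lambda>x. E x * W i x)" for i
  have F1: "Ck_on (Suc 0) UNIV (F i)" for i unfolding F_def by (rule Ck_ext0[OF V K E0 EW])
  have F0: "F i x = 0" if "x \<notin> K" for i x unfolding F_def by (rule ext0_out[OF V K E0 that])
  have fx: "f (chart_inv c x) = E x * C.lap Y x + (SS i. SS j. matrix_inv (g c x) $ i $ j * C.d i E x * C.d j Y x)"
    if x: "x \<in> ?V" for x
  proof -
    have "laplacian A g y (chart_inv c x) = C.lap Y x"
      using x by (simp add: laplacian_chart[OF c _ y] C.laplacian_eq[OF y[OF c] refl] Y_def[abs_def])
    moreover have "inn \<eta> y (chart_inv c x) = (SS i. SS j. matrix_inv (g c x) $ i $ j * C.d i E x * C.d j Y x)"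
      using x inn_chart[OF c inv_dom[OF x], of \<eta> y] cutoff_differentiable[OF cut] smooth_differentiable[OF y]
      by (simp add: coord_inner_def partial_open[OF V x refl] E_def[abs_def] Y_def[abs_def])
    ultimately show ?thesis by (simp add: f_def E_def)
  qed
  have div: "dens c x * f (chart_inv c x) = (SS i. C.d i (\<lambda>x. E x * W i x) x)" if x: "x \<in> ?V" for x
  proof -
    have "C.d i (\<lambda>x. E x * W i x) x = E x * C.d i (W i) x + C.d i E x * W i x" for i
      by (rule dder_eq[OF ap x])
        (rule has_derivative_mult[OF dder_has_derivative[OF Ed x] smooth_has_derivative[OF Ws x]])
    moreover have "C.vol x * C.lap Y x = (SS i. C.d i (W i) x)"
      unfolding W_def[abs_def] using x V by (intro C.divergence_form Ys) (simp add: interior_open)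
    moreover have "dens c x = C.vol x" using C.vol_eq[OF x] by (simp add: dens_def)
    ultimately show ?thesis
      using x by (simp add: fx distrib_left sum.distrib sum_distrib_left W_def mult_ac flip: sum_distrib_left)
        (simp add: sum_distrib_left mult_ac)
  qed
  have cont: "continuous_on ?V (\<lambda>x. f (chart_inv c x))"
  proof -
    have "continuous_on ?V (\<lambda>x. E x * C.lap Y x + (SS i. SS j. matrix_inv (g c x) $ i $ j * C.d i E x * C.d j Y x))"
      using Ec unfolding Ck_Suc Ck_on.simps(1)
      by (intro continuous_on_add continuous_on_mult continuous_on_sum differentiable_imp_continuous_on[OF Ed]
          smooth_continuous[OF C.smooth_lap[OF Ys]] smooth_continuous[OF C.h_smooth] smooth_continuous[OF smooth_dder[OF Ys]]) simp
    then show ?thesis using fx by (simp cong: continuous_on_cong)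
  qed
  have out: "f p = 0" if "p \<in> topspace X" "\<not> (p \<in> chart_dom c \<and> chart_map c p \<in> K)" for p
    unfolding f_def using cutoff_inn_zero[OF cut that] cut that by (simp add: cutoff_def)
  note ci = compact_chart_integral[OF c K cont out]
  show "integrable vol_measure f" by (rule ci(2))
  have "dder UNIV v (F i) x = ext0 ?V (dder ?V v (\<lambda>x. E x * W i x)) x" for v i x
    unfolding F_def by (rule dder_ext0[OF V K E0])
  then have "ext0 ?V (\<lambda>x. dens c x * f (chart_inv c x)) x = (SS i. dder UNIV (axis i 1) (F i) x)" for x
    using div by (simp add: ext0_def)
  then have "integral\<^sup>L vol_measure f = (LINT x|lborel. (SS i. dder UNIV (axis i 1) (F i) x))"
    by (simp add: ci(1))
  also have "\<dots> = (SS i. (LINT x|lborel. dder UNIV (axis i 1) (F i) x))"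
    by (rule Bochner_Integration.integral_sum) (rule integral_partial_zero(2)[OF F1 K(1) F0])
  also have "\<dots> = 0" using integral_partial_zero(1)[OF F1 K(1) F0] by simp
  finally show "integral\<^sup>L vol_measure f = 0" .
qed

end

context
  fixes P :: "'a set" and c K \<eta>
  assumes P: "finite P" and cut: "\<And>p. p \<in> P \<Longrightarrow> cutoff (c p) (K p) (\<eta> p)"
    and sum1: "\<And>q. q \<in> topspace X \<Longrightarrow> (\<Sum>p\<in>P. \<eta> p q) = 1"
begin

lemma partition_integral:
  assumes f: "\<And>d. d \<in> A \<Longrightarrow> continuous_on (chart_img d) (\<lambda>x. f (chart_inv d x))"
  shows "integral\<^sup>L vol_measure f = (\<Sum>p\<in>P. LINT x|lborel.
    ext0 (chart_img (c p)) (\<lambda>x. dens (c p) x * (\<eta> p (chart_inv (c p) x) * f (chart_inv (c p) x))) x)"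
    and "integrable vol_measure f"
proof -
  have ci: "integral\<^sup>L vol_measure (\<lambda>q. \<eta> p q * f q) = (LINT x|lborel.
    ext0 (chart_img (c p)) (\<lambda>x. dens (c p) x * (\<eta> p (chart_inv (c p) x) * f (chart_inv (c p) x))) x)"
    "integrable vol_measure (\<lambda>q. \<eta> p q * f q)" if p: "p \<in> P" for p
  proof -
    have c: "c p \<in> A" "compact (K p)" "K p \<subseteq> chart_img (c p)" using cut[OF p] by (simp_all add: cutoff_def)
    have co: "continuous_on (chart_img (c p)) (\<lambda>x. \<eta> p (chart_inv (c p) x) * f (chart_inv (c p) x))"
      by (intro continuous_on_mult cutoff_continuous[OF cut[OF p] c(1)] f c)
    have out: "\<eta> p q * f q = 0" if "q \<in> topspace X" "\<not> (q \<in> chart_dom (c p) \<and> chart_map (c p) q \<in> K p)" for q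
      using cut[OF p] that by (simp add: cutoff_def)
    show "integral\<^sup>L vol_measure (\<lambda>q. \<eta> p q * f q) = (LINT x|lborel.
        ext0 (chart_img (c p)) (\<lambda>x. dens (c p) x * (\<eta> p (chart_inv (c p) x) * f (chart_inv (c p) x))) x)"
      by (rule compact_chart_integral(1)[OF c, of "\<lambda>q. \<eta> p q * f q", OF co out])
    show "integrable vol_measure (\<lambda>q. \<eta> p q * f q)"
      by (rule compact_chart_integral(2)[OF c, of "\<lambda>q. \<eta> p q * f q", OF co out])
  qed
  have eq: "f q = (\<Sum>p\<in>P. \<eta> p q * f q)" if "q \<in> topspace X" for q
    using that by (simp add: sum1 flip: sum_distrib_right)
  have "integrable vol_measure (\<lambda>q. \<Sum>p\<in>P. \<eta> p q * f q)"
    by (rule Bochner_Integration.integrable_sum) (rule ci(2))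
  then show "integrable vol_measure f"
    by (subst Bochner_Integration.integrable_cong[OF refl eq]) simp_all
  have "integral\<^sup>L vol_measure f = integral\<^sup>L vol_measure (\<lambda>q. \<Sum>p\<in>P. \<eta> p q * f q)"
    by (rule Bochner_Integration.integral_cong) (simp_all add: eq)
  also have "\<dots> = (\<Sum>p\<in>P. integral\<^sup>L vol_measure (\<lambda>q. \<eta> p q * f q))"
    by (rule Bochner_Integration.integral_sum) (rule ci(2))
  finally show "integral\<^sup>L vol_measure f = (\<Sum>p\<in>P. LINT x|lborel.
    ext0 (chart_img (c p)) (\<lambda>x. dens (c p) x * (\<eta> p (chart_inv (c p) x) * f (chart_inv (c p) x))) x)"
    by (simp add: ci(1))
qed

text \<open>Sum \<open>cutoff_divergence\<close> over the partition. The functions add up to the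
  constant 1, whose differential is zero, so the pairings with d y cancel and the Laplacian itself
  remains.\<close>

lemma integral_laplacian:
  assumes y: "\<And>d. d \<in> A \<Longrightarrow> smooth_on (chart_img d) (\<lambda>x. y (chart_inv d x))"
  shows "integral\<^sup>L vol_measure (laplacian A g y) = 0"
proof -
  have inn0: "(\<Sum>p\<in>P. inn (\<eta> p) y q) = 0" if q: "q \<in> topspace X" for q
  proof -
    let ?d = "chart_at A q"
    have d: "?d \<in> A" "q \<in> chart_dom ?d" using chart_at q by auto
    let ?z = "chart_map ?d q" and ?V = "chart_img ?d"
    have z: "?z \<in> ?V" using d by simp
    note V = img_open[OF d(1)]
    have D: "((\<lambda>x. \<eta> p (chart_inv ?d x)) has_derivative (\<lambda>v. dder ?V v (\<lambda>x. \<eta> p (chart_inv ?d x)) ?z)) (at ?z within ?V)"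
      if "p \<in> P" for p
      by (rule dder_has_derivative[OF cutoff_differentiable[OF cut[OF that] d(1)] z])
    have "(\<Sum>p\<in>P. partial i (\<lambda>x. \<eta> p (chart_inv ?d x)) ?z) = 0" for i
    proof -
      have "(\<Sum>p\<in>P. partial i (\<lambda>x. \<eta> p (chart_inv ?d x)) ?z) = (\<Sum>p\<in>P. dder ?V (axis i 1) (\<lambda>x. \<eta> p (chart_inv ?d x)) ?z)"
        by (simp add: partial_open[OF V z refl])
      also have "\<dots> = dder ?V (axis i 1) (\<lambda>x. \<Sum>p\<in>P. \<eta> p (chart_inv ?d x)) ?z"
        by (rule dder_eq[OF approachable_open[OF V] z, symmetric]) (rule has_derivative_sum[OF D])
      also have "\<dots> = dder ?V (axis i 1) (\<lambda>x. 1) ?z"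
        using dom_sub[OF d(1)] inv_dom by (intro dder_cong[OF z] sum1) blast
      also have "\<dots> = 0"
        by (rule dder_eq[OF approachable_open[OF V] z]) (rule has_derivative_const)
      finally show ?thesis .
    qed
    note pz = this
    have "(\<Sum>p\<in>P. inn (\<eta> p) y q) = (\<Sum>p\<in>P. SS i. SS j. matrix_inv (g ?d ?z) $ i $ j * partial i (\<lambda>x. \<eta> p (chart_inv ?d x)) ?z
        * partial j (\<lambda>x. y (chart_inv ?d x)) ?z)"
      by (simp add: inn_def Let_def coord_inner_def)
    also have "\<dots> = (SS i. SS j. \<Sum>p\<in>P. matrix_inv (g ?d ?z) $ i $ j * partial i (\<lambda>x. \<eta> p (chart_inv ?d x)) ?z
        * partial j (\<lambda>x. y (chart_inv ?d x)) ?z)"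
      by (subst sum.swap) (intro sum.cong refl sum.swap)
    also have "\<dots> = 0" using pz by (simp flip: sum_distrib_left sum_distrib_right)
    finally show ?thesis .
  qed
  have "laplacian A g y q = (\<Sum>p\<in>P. \<eta> p q * laplacian A g y q + inn (\<eta> p) y q)" if "q \<in> topspace X" for q
    using that by (simp add: sum.distrib inn0 sum1 flip: sum_distrib_right)
  then have "integral\<^sup>L vol_measure (laplacian A g y) = integral\<^sup>L vol_measure (\<lambda>q. \<Sum>p\<in>P. \<eta> p q * laplacian A g y q + inn (\<eta> p) y q)"
    by (intro Bochner_Integration.integral_cong) simp_all
  also have "\<dots> = (\<Sum>p\<in>P. integral\<^sup>L vol_measure (\<lambda>q. \<eta> p q * laplacian A g y q + inn (\<eta> p) y q))"
    by (rule Bochner_Integration.integral_sum) (rule cutoff_divergence(2)[OF y cut])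
  also have "\<dots> = 0" using cutoff_divergence(1)[OF y cut] by simp
  finally show ?thesis .
qed

end

end

section \<open>Monotonicity\<close>

lemma (in metric_on) lap_neg_ln:
  assumes u: "smooth_on S u" and pos: "\<And>p. p \<in> S \<Longrightarrow> u p > 0" and p: "p \<in> S"
  defines "f \<equiv> \<lambda>x. - ln (u x)"
  shows "lap u p = u p * (nrm f p - lap f p)"
proof -
  have f: "smooth_on S f" unfolding f_def by (intro smooth_minus[OF S] smooth_ln[OF S] u pos)
  have du: "dder S v u q = - (u q * dder S v f q)" if q: "q \<in> S" for q v
  proof -
    have "(f has_derivative (\<lambda>v. - (dder S v u q * inverse (u q)))) (at q within S)"
      unfolding f_def by (rule derivative_eq_intros smooth_has_derivative[OF u q] refl pos[OF q])+
    from dder_eq[OF S q this] show ?thesis using pos[OF q] by simp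
  qed
  have ddu: "d i (d j u) p = u p * d i f p * d j f p - u p * d i (d j f) p" for i j
  proof -
    have "d i (d j u) p = d i (\<lambda>q. - (u q * d j f q)) p" by (rule dder_cong[OF p du])
    also have "\<dots> = - (u p * d i (d j f) p + d i u p * d j f p)"
      by (rule dder_eq[OF S p])
        (rule has_derivative_minus[OF has_derivative_mult[OF smooth_has_derivative[OF u p] smooth_has_derivative[OF smooth_dder[OF f] p]]])
    finally show ?thesis by (simp add: du[OF p])
  qed
  have hs: "hss u i j p = u p * (d i f p * d j f p - hss f i j p)" for i j
    unfolding hss_def by (simp add: ddu du[OF p] algebra_simps sum_distrib_left sum_negf)
  have "lap u p = (SS i. SS j. u p * (h i j p * (d i f p * d j f p)) - u p * (h i j p * hss f i j p))"
    by (simp add: lap_def hs right_diff_distrib mult_ac)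
  then show ?thesis
    by (simp add: lap_def nrm_def right_diff_distrib sum_subtractf sum_distrib_left)
qed

text \<open>The support bound \<open>K\<close> is the same for all parameters, so I x V and I x (-
  K) are relatively open and cover; on the second the function is zero.\<close>

lemma continuous_ext0_param:
  fixes h :: "'t::euclidean_space \<times> 'e::euclidean_space \<Rightarrow> real"
  assumes V: "open V" and K: "compact K" "K \<subseteq> V" and h: "continuous_on (I \<times> V) h"
    and h0: "\<And>t x. t \<in> I \<Longrightarrow> x \<in> V \<Longrightarrow> x \<notin> K \<Longrightarrow> h (t, x) = 0"
  shows "continuous_on (I \<times> UNIV) (\<lambda>(t, x). ext0 V (\<lambda>x. h (t, x)) x)"
proof -
  have U: "I \<times> UNIV = I \<times> V \<union> I \<times> (- K)" using K by blast
  have o: "open (- K)" using K compact_imp_closed by blast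
  have op: "openin (top_of_set (I \<times> V \<union> I \<times> (- K))) (I \<times> W)" if "open W" for W
  proof -
    have "I \<times> W = (I \<times> UNIV) \<inter> (UNIV \<times> W)" by blast
    then show ?thesis using that open_Times[OF open_UNIV that] by (auto simp flip: U simp: openin_open)
  qed
  have "continuous_on (I \<times> V) (\<lambda>(t, x). ext0 V (\<lambda>x. h (t, x)) x)"
    using h by (rule continuous_on_eq) (auto simp: ext0_def)
  moreover have "continuous_on (I \<times> (- K)) (\<lambda>(t, x). ext0 V (\<lambda>x. h (t, x)) x)"
    using continuous_on_const[of _ 0] by (rule continuous_on_eq) (auto simp: ext0_def h0)
  ultimately show ?thesis unfolding U by (rule continuous_on_Un_local_open[OF op[OF V] op[OF o]])
qed

context
  fixes a b t :: real and V :: "'e::euclidean_space set" and x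
  assumes ab: "a < b" and t: "t \<in> {a..b}" and V: "open V" and x: "x \<in> V"
begin

lemma time_has_derivative:
  fixes F :: "real \<times> 'e \<Rightarrow> real"
  assumes "smooth_on ({a..b} \<times> V) F"
  shows "((\<lambda>s. F (s, x)) has_real_derivative dder ({a..b} \<times> V) (1, 0) F (t, x)) (at t within {a..b})"
proof -
  let ?S = "{a..b} \<times> V"
  have p: "(t, x) \<in> ?S" using t x by simp
  note D = smooth_has_derivative[OF assms p]
  have "((\<lambda>s. F ((\<lambda>s. (s, x)) s)) has_derivative (\<lambda>c. dder ?S (c, 0) F (t, x))) (at t within {a..b})"
    by (rule has_derivative_in_compose2[where t = ?S])
      (use t x smooth_has_derivative[OF assms] in \<open>auto intro!: derivative_eq_intros\<close>)
  moreover have "(\<lambda>c. dder ?S (c, 0) F (t, x)) = (*) (dder ?S (1, 0) F (t, x))"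
  proof
    show "dder ?S (c, 0) F (t, x) = dder ?S (1, 0) F (t, x) * c" for c
      using linear_cmul[OF has_derivative_linear[OF D], of c "(1, 0)"] by simp
  qed
  ultimately show ?thesis by (simp only: has_field_derivative_def)
qed

lemma time_derivative_unique:
  assumes "(f has_vector_derivative D) (at t within {a..b})" "(f has_vector_derivative D') (at t within {a..b})"
  shows "D = D'"
  using dder_eq[OF approachable_interval[OF ab] t assms(1)[unfolded has_vector_derivative_def], of 1]
    dder_eq[OF approachable_interval[OF ab] t assms(2)[unfolded has_vector_derivative_def], of 1] by simp

lemma time_dder_eq:
  fixes F :: "real \<times> 'e \<Rightarrow> real"
  assumes "smooth_on ({a..b} \<times> V) F" "(f has_real_derivative D) (at t within {a..b})" "\<And>s. s \<in> {a..b} \<Longrightarrow> f s = F (s, x)"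
  shows "dder ({a..b} \<times> V) (1, 0) F (t, x) = D"
proof (rule time_derivative_unique)
  show "((\<lambda>s. F (s, x)) has_vector_derivative dder ({a..b} \<times> V) (1, 0) F (t, x)) (at t within {a..b})"
    using time_has_derivative[OF assms(1)] by (simp add: has_real_derivative_iff_has_vector_derivative)
  have "((\<lambda>s. F (s, x)) has_real_derivative D) (at t within {a..b})"
    by (rule has_field_derivative_transform_within[OF assms(2), of 1]) (use t assms(3) in auto)
  then show "((\<lambda>s. F (s, x)) has_vector_derivative D) (at t within {a..b})"
    by (simp add: has_real_derivative_iff_has_vector_derivative)
qed

end

section \<open>The flow in charts of space-time\<close>

locale conjugate_heat_flow = closed_mfd X A
  for X :: "'a topology" and A :: "('a, 'n::finite) chart set" +
  fixes g :: "real \<Rightarrow> ('a, 'n) tensor2" and \<rho> :: "real \<Rightarrow> 'a \<Rightarrow> real" and t0 t1 :: real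
  assumes lt: "t0 < t1" and flow: "ricci_flow A t0 t1 g"
    and pos: "t \<in> {t0..t1} \<Longrightarrow> p \<in> topspace X \<Longrightarrow> 0 < \<rho> t p"
    and heat: "backward_heat_flow A t0 t1 g \<rho>"
begin

lemma metric_t: "t \<in> {t0..t1} \<Longrightarrow> riemannian_mfd X A (g t)"
  using flow by unfold_locales (simp add: ricci_flow_def)

abbreviation "St c \<equiv> {t0..t1} \<times> chart_img c"
abbreviation et :: "'n \<Rightarrow> real \<times> (real^'n)" where "et i \<equiv> (0, axis i 1)"
abbreviation "gt c \<equiv> (\<lambda>i j (t, x). g t c x $ i $ j)"
abbreviation "ht c \<equiv> (\<lambda>i j (t, x). matrix_inv (g t c x) $ i $ j)"
abbreviation "ut c \<equiv> (\<lambda>(t, x). \<rho> t (chart_inv c x))"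

lemma St_approachable: "c \<in> A \<Longrightarrow> approachable (St c)"
  by (rule approachable_Times[OF approachable_interval[OF lt] approachable_open[OF img_open]])

lemma link:
  assumes c: "c \<in> A" and t: "t \<in> {t0..t1}"
  shows "coord_link (St c) et (gt c) (ht c) (chart_img c) (Pair t) (g t c)"
proof (rule coord_link_slice[OF img_open[OF c] lt t])
  fix i j :: 'n
  have bl: "bounded_linear (\<lambda>M::real^'n^'n. M $ i $ j)"
    by (intro bounded_linear_compose[OF bounded_linear_vec_nth bounded_linear_vec_nth])
  have "smooth_on (St c) (\<lambda>(t, x). g t c x)" using flow c by (simp add: ricci_flow_def)
  from smooth_linear[OF St_approachable[OF c] bl this]
  show "smooth_on (St c) (\<lambda>(t, x). g t c x $ i $ j)" by (simp add: case_prod_unfold)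
next
  fix s x i j assume s: "s \<in> {t0..t1}" "x \<in> chart_img c"
  interpret riemannian_mfd X A "g s" by (rule metric_t[OF s(1)])
  show "g s c x $ i $ j = g s c x $ j $ i" by (rule metric_sym[OF c s(2)])
next
  fix s x and v :: "real^'n" assume s: "s \<in> {t0..t1}" "x \<in> chart_img c" "v \<noteq> 0"
  interpret riemannian_mfd X A "g s" by (rule metric_t[OF s(1)])
  show "0 < v \<bullet> (g s c x *v v)" by (rule metric_pos[OF c s(2,3)])
qed

lemma flow_deriv: "t \<in> {t0..t1} \<Longrightarrow> c \<in> A \<Longrightarrow> x \<in> chart_img c \<Longrightarrow>
    ((\<lambda>s. g s c x) has_vector_derivative (- 2) *\<^sub>R coord_ricci (g t c) x) (at t within {t0..t1})"
  using flow by (simp add: ricci_flow_def)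

lemma \<rho>_smooth: "c \<in> A \<Longrightarrow> smooth_on (St c) (ut c)"
  using heat by (simp add: backward_heat_flow_def smooth_fun_family_def)

lemma \<rho>_slice: "t \<in> {t0..t1} \<Longrightarrow> c \<in> A \<Longrightarrow> smooth_on (chart_img c) (\<lambda>x. \<rho> t (chart_inv c x))"
  using smooth_slice[OF approachable_open[OF img_open] _ \<rho>_smooth, of c t] by simp

lemma ut_pos: "c \<in> A \<Longrightarrow> p \<in> St c \<Longrightarrow> ut c p > 0"
  by (auto intro!: pos intro: subsetD[OF dom_sub inv_dom])

lemma ricci_flow_chart:
  assumes c: "c \<in> A" shows "ricci_flow_on (St c) et (gt c) (ht c) (1, 0) (ut c)"
proof -
  have t0: "t0 \<in> {t0..t1}" using lt by simp
  \<comment> \<open>The slab expressions \<open>L.ric\<close>, \<open>L.lap\<close> and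
    \<open>L.vol\<close> do not depend on the slice; t0 merely provides an instance. The slice at
    the time under consideration is brought in as \<open>M\<close>.\<close>
  interpret L: coord_link "St c" et "gt c" "ht c" "chart_img c" "Pair t0" "g t0 c" by (rule link[OF c t0])
  have "dder (St c) (1, 0) (gt c i j) p = - 2 * L.ric i j p" if p: "p \<in> St c" for p i j
  proof -
    obtain t x where tx: "p = (t, x)" "t \<in> {t0..t1}" "x \<in> chart_img c" using p by auto
    interpret M: coord_link "St c" et "gt c" "ht c" "chart_img c" "Pair t" "g t c" by (rule link[OF c tx(2)])
    have bl: "bounded_linear (\<lambda>M::real^'n^'n. M $ i $ j)"
      by (intro bounded_linear_compose[OF bounded_linear_vec_nth bounded_linear_vec_nth])
    have "((\<lambda>s. g s c x $ i $ j) has_real_derivative (- 2 * L.ric i j (t, x))) (at t within {t0..t1})"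
      using bounded_linear.has_vector_derivative[OF bl flow_deriv[OF tx(2) c tx(3)]] M.ricci_eq[OF tx(3)]
      by (simp add: has_real_derivative_iff_has_vector_derivative)
    from time_dder_eq[OF lt tx(2) img_open[OF c] tx(3) L.g_smooth this] show ?thesis by (simp add: tx(1))
  qed
  moreover have "dder (St c) (1, 0) (\<lambda>x. ut c x * L.vol x) p = - (L.lap (ut c) p * L.vol p)" if p: "p \<in> St c" for p
  proof -
    obtain t x where tx: "p = (t, x)" "t \<in> {t0..t1}" "x \<in> chart_img c" using p by auto
    interpret M: coord_link "St c" et "gt c" "ht c" "chart_img c" "Pair t" "g t c" by (rule link[OF c tx(2)])
    interpret R: riemannian_mfd X A "g t" by (rule metric_t[OF tx(2)])
    have "laplacian A (g t) (\<rho> t) (chart_inv c x) = L.lap (ut c) (t, x)"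
      using tx(3) R.laplacian_chart[OF c inv_dom[OF tx(3)] \<rho>_slice[OF tx(2)]]
        M.laplacian_eq[OF \<rho>_smooth[OF c], of "\<lambda>x. \<rho> t (chart_inv c x)" x] by simp
    then have lp: "- coord_density (g t) (laplacian A (g t) (\<rho> t)) c x = - (L.lap (ut c) (t, x) * L.vol (t, x))"
      by (simp add: coord_density_def M.vol_eq[OF tx(3)])
    have "((\<lambda>s. coord_density (g s) (\<rho> s) c x) has_real_derivative - coord_density (g t) (laplacian A (g t) (\<rho> t)) c x)
        (at t within {t0..t1})"
      using heat tx c by (simp add: backward_heat_flow_def)
    then have D: "((\<lambda>s. coord_density (g s) (\<rho> s) c x) has_real_derivative - (L.lap (ut c) (t, x) * L.vol (t, x)))
        (at t within {t0..t1})" unfolding lp .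
    have "coord_density (g s) (\<rho> s) c x = ut c (s, x) * L.vol (s, x)" if s: "s \<in> {t0..t1}" for s
    proof -
      interpret N: coord_link "St c" et "gt c" "ht c" "chart_img c" "Pair s" "g s c" by (rule link[OF c s])
      show ?thesis by (simp add: coord_density_def N.vol_eq[OF tx(3)])
    qed
    from time_dder_eq[OF lt tx(2) img_open[OF c] tx(3) smooth_mult[OF L.S \<rho>_smooth[OF c] L.smooth_vol] D this]
    show ?thesis by (simp add: tx(1))
  qed
  ultimately show ?thesis
    by unfold_locales (rule \<rho>_smooth[OF c] | erule ut_pos[OF c] | assumption)+
qed

text \<open>No curvature computation is needed for the coordinate invariance: the Ricci tensor transforms as a
  tensor because it is a multiple of the time derivative of the metric.\<close>

lemma scalar_curvature_chart:
  assumes t: "t \<in> {t0..t1}" and c: "c \<in> A" and p: "p \<in> chart_dom c"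
  shows "scalar_curvature A (g t) p = coord_scalar_curvature (g t c) (chart_map c p)"
proof -
  interpret R: riemannian_mfd X A "g t" by (rule metric_t[OF t])
  let ?d = "chart_at A p"
  have d: "?d \<in> A" "p \<in> chart_dom ?d" using R.chart_at p dom_sub[OF c] by auto
  let ?x = "chart_map c p" and ?y = "chart_map ?d p"
  have x: "?x \<in> chart_map c ` (chart_dom c \<inter> chart_dom ?d)" using p d by blast
  have T: "transition c ?d ?x = ?y" using p c by (simp add: transition_def)
  \<comment> \<open>J belongs to a fixed transition map, so it is the same at all times and the time
    derivative passes through the transformation rule of the metric.\<close>
  define J where "J = R.Jm c ?d ?x"
  have Jj: "jacobian (transition c ?d) (at ?x) = J" unfolding J_def by (rule R.Jm_jacobian[OF c d(1) x])
  have gs: "g s c ?x = transpose J ** g s ?d ?y ** J" if "s \<in> {t0..t1}" for s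
  proof -
    interpret Q: riemannian_mfd X A "g s" by (rule metric_t[OF that])
    show ?thesis using Q.metric_change[OF c d(1) p d(2)] by (simp add: Jj)
  qed
  have bl: "bounded_linear (\<lambda>M::real^'n^'n. transpose J ** M ** J)"
    by (intro linear_conv_bounded_linear[THEN iffD1] linearI)
      (simp_all add: vec_eq_iff matrix_matrix_mult_def distrib_left distrib_right sum.distrib sum_distrib_left sum_distrib_right mult_ac)
  have "((\<lambda>s. transpose J ** g s ?d ?y ** J) has_vector_derivative transpose J ** ((- 2) *\<^sub>R coord_ricci (g t ?d) ?y) ** J) (at t within {t0..t1})"
    by (rule bounded_linear.has_vector_derivative[OF bl flow_deriv[OF t d(1)]]) (use d in simp)
  then have "((\<lambda>s. g s c ?x) has_vector_derivative transpose J ** ((- 2) *\<^sub>R coord_ricci (g t ?d) ?y) ** J) (at t within {t0..t1})"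
    by (rule has_vector_derivative_transform[OF t, rotated]) (simp add: gs)
  from time_derivative_unique[OF lt t img_open[OF c] map_img[OF p] flow_deriv[OF t c map_img[OF p]] this]
  have "(- 2) *\<^sub>R coord_ricci (g t c) ?x = (- 2) *\<^sub>R (transpose J ** coord_ricci (g t ?d) ?y ** J)"
    by (simp add: linear_cmul[OF bounded_linear.linear[OF bl]] linear_neg[OF bounded_linear.linear[OF bl]])
  then have Ric: "coord_ricci (g t c) ?x = transpose J ** coord_ricci (g t ?d) ?y ** J" by simp
  have Jx: "J $ a $ i = R.J c ?d a i ?x" for a i by (simp add: J_def R.Jm_def[OF c d(1)])
  have Ric': "coord_ricci (g t c) ?x $ i $ j = (SS a. SS b. J $ a $ i * J $ b $ j * coord_ricci (g t ?d) ?y $ a $ b)" for i j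
    unfolding Ric by (simp add: matrix_matrix_mult_def transpose_def sum_distrib_left sum_distrib_right mult_ac)
      (rule usum2, simp add: mult_ac)
  let ?I = "matrix_inv (g t c ?x)" and ?Q = "coord_ricci (g t ?d) ?y"
  have "coord_scalar_curvature (g t c) ?x = (SS i. SS j. SS a. SS b. ?I $ i $ j * (J $ a $ i * J $ b $ j * ?Q $ a $ b))"
    by (simp add: coord_scalar_curvature_def Ric' sum_distrib_left)
  also have "\<dots> = (SS i. SS a. SS b. SS j. ?I $ i $ j * (J $ a $ i * J $ b $ j * ?Q $ a $ b))"
    by (rule sum.cong[OF refl], rule usum3_231) simp
  also have "\<dots> = (SS a. SS b. SS i. SS j. ?I $ i $ j * (J $ a $ i * J $ b $ j * ?Q $ a $ b))"
    by (rule usum3_231) simp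
  also have "\<dots> = coord_scalar_curvature (g t ?d) ?y"
    unfolding coord_scalar_curvature_def T[symmetric] R.inv_change'[OF c d(1) x]
    by (simp add: T Jx sum_distrib_left sum_distrib_right mult_ac)
  finally show ?thesis by (simp add: scalar_curvature_def Let_def)
qed

definition "perelman_density t p = (let f = \<lambda>q. - ln (\<rho> t q) in
  (2 * laplacian A (g t) f p - grad_norm_sq A (g t) f p + scalar_curvature A (g t) p) * \<rho> t p)"

lemma grad_norm_chart:
  assumes t: "t \<in> {t0..t1}" and c: "c \<in> A" and p: "p \<in> chart_dom c"
    and f: "\<And>d. d \<in> A \<Longrightarrow> smooth_on (chart_img d) (\<lambda>x. f (chart_inv d x))"
  shows "grad_norm_sq A (g t) f p = coord_grad_norm_sq (g t c) (\<lambda>x. f (chart_inv c x)) (chart_map c p)"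
proof -
  interpret R: riemannian_mfd X A "g t" by (rule metric_t[OF t])
  have "grad_norm_sq A (g t) f p = R.inn f f p"
    by (simp add: grad_norm_sq_def R.inn_def coord_grad_norm_inner comp_def)
  also have "\<dots> = coord_inner (g t c) (\<lambda>x. f (chart_inv c x)) (\<lambda>x. f (chart_inv c x)) (chart_map c p)"
    by (rule R.inn_chart[OF c p]) (rule smooth_differentiable[OF f], assumption)+
  finally show ?thesis by (simp add: coord_grad_norm_inner)
qed

context
  fixes c assumes c: "c \<in> A"
begin

interpretation R: ricci_flow_on "St c" et "gt c" "ht c" "(1, 0)" "ut c" by (rule ricci_flow_chart[OF c])

context
  fixes t x assumes t: "t \<in> {t0..t1}" and x: "x \<in> chart_img c"
begin

interpretation M: coord_link "St c" et "gt c" "ht c" "chart_img c" "Pair t" "g t c" by (rule link[OF c t])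
interpretation N: riemannian_mfd X A "g t" by (rule metric_t[OF t])

lemma laplacian_chart_t:
  assumes "\<And>d. d \<in> A \<Longrightarrow> smooth_on (chart_img d) (\<lambda>x. y (chart_inv d x))"
    and "smooth_on (St c) Y" "\<And>x. x \<in> chart_img c \<Longrightarrow> y (chart_inv c x) = Y (t, x)"
  shows "laplacian A (g t) y (chart_inv c x) = R.lap Y (t, x)"
  using N.laplacian_chart[OF c inv_dom[OF x] assms(1)] M.laplacian_eq[OF assms(2), of "\<lambda>x. y (chart_inv c x)", OF assms(3) x] x
  by simp

lemma ln_slice: "d \<in> A \<Longrightarrow> smooth_on (chart_img d) (\<lambda>x. - ln (\<rho> t (chart_inv d x)))"
  using ut_pos[of d] t by (intro smooth_minus smooth_ln \<rho>_slice approachable_open[OF img_open]) auto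

lemma pot_chart: "R.pot (t, y) = - ln (\<rho> t (chart_inv c y))"
  unfolding R.pot_def by simp

lemma perelman_density_chart: "perelman_density t (chart_inv c x) = R.perelman (t, x)"
proof -
  have "laplacian A (g t) (\<lambda>q. - ln (\<rho> t q)) (chart_inv c x) = R.lap R.pot (t, x)"
    by (rule laplacian_chart_t[OF ln_slice R.smooth_pot pot_chart[symmetric]])
  moreover have "grad_norm_sq A (g t) (\<lambda>q. - ln (\<rho> t q)) (chart_inv c x) = R.nrm R.pot (t, x)"
    using grad_norm_chart[OF t c inv_dom[OF x], of "\<lambda>q. - ln (\<rho> t q)", OF ln_slice] x
      M.grad_norm_eq[OF R.smooth_pot, of "\<lambda>x. - ln (\<rho> t (chart_inv c x))" x] by (simp add: pot_chart)
  moreover have "scalar_curvature A (g t) (chart_inv c x) = R.scal (t, x)"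
    using scalar_curvature_chart[OF t c inv_dom[OF x]] M.scalar_eq[OF x] x by simp
  ultimately show ?thesis by (simp add: perelman_density_def Let_def R.perelman_def)
qed

text \<open>With f = - ln \<rho> the two densities differ by 2 (|\<nabla> f|^2 - \<Delta> f) \<rho>,
  which \<open>lap_neg_ln\<close> recognises as 2 \<Delta> \<rho>. Passing from ln \<rho> to f
  leaves the gradient norm unchanged.\<close>

lemma integrand_chart:
  "(grad_norm_sq A (g t) (\<lambda>q. ln (\<rho> t q)) (chart_inv c x) + scalar_curvature A (g t) (chart_inv c x)) * \<rho> t (chart_inv c x)
    = perelman_density t (chart_inv c x) + 2 * laplacian A (g t) (\<rho> t) (chart_inv c x)"
proof -
  have ln: "smooth_on (chart_img d) (\<lambda>x. ln (\<rho> t (chart_inv d x)))" if "d \<in> A" for d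
    using smooth_minus[OF approachable_open[OF img_open[OF that]] ln_slice[OF that]] by simp
  have n: "R.nrm (\<lambda>p. - R.pot p) (t, x) = R.nrm R.pot (t, x)"
  proof -
    have p: "(t, x) \<in> St c" using t x by simp
    have "dder (St c) v (\<lambda>p. - R.pot p) (t, x) = - dder (St c) v R.pot (t, x)" for v
      by (rule dder_eq[OF R.S p]) (rule has_derivative_minus[OF smooth_has_derivative[OF R.smooth_pot p]])
    then show ?thesis by (simp add: R.nrm_def)
  qed
  have "grad_norm_sq A (g t) (\<lambda>q. ln (\<rho> t q)) (chart_inv c x) = R.nrm R.pot (t, x)"
    using grad_norm_chart[OF t c inv_dom[OF x], of "\<lambda>q. ln (\<rho> t q)", OF ln] x n
      M.grad_norm_eq[OF smooth_minus[OF R.S R.smooth_pot], of "\<lambda>x. ln (\<rho> t (chart_inv c x))" x] by (simp add: pot_chart)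
  moreover have "scalar_curvature A (g t) (chart_inv c x) = R.scal (t, x)"
    using scalar_curvature_chart[OF t c inv_dom[OF x]] M.scalar_eq[OF x] x by simp
  moreover have "laplacian A (g t) (\<rho> t) (chart_inv c x) = R.lap (ut c) (t, x)"
    by (rule laplacian_chart_t[OF \<rho>_slice[OF t] \<rho>_smooth[OF c]]) simp_all
  moreover have "R.lap (ut c) (t, x) = ut c (t, x) * (R.nrm R.pot (t, x) - R.lap R.pot (t, x))"
    unfolding R.pot_def[abs_def] using t x by (intro R.lap_neg_ln R.u R.u_pos) auto
  ultimately show ?thesis by (simp add: perelman_density_chart R.perelman_def algebra_simps)
qed

end

lemma perelman_density_slice: "t \<in> {t0..t1} \<Longrightarrow> smooth_on (chart_img c) (\<lambda>x. perelman_density t (chart_inv c x))"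
  using smooth_slice[OF approachable_open[OF img_open[OF c]] _ R.smooth_perelman, of t]
    smooth_cong[of "chart_img c" "\<lambda>x. perelman_density t (chart_inv c x)" "\<lambda>x. R.perelman (t, x)"] perelman_density_chart by blast

end

text \<open>Everything takes place in one chart, over a fixed box in Lebesgue measure, so the
  derivative can be taken under the integral. It exists up to the end times; the lower bound comes
  from \<open>perelman_inequality\<close> and so is restricted to interior times. Nonnegativity of
  \<eta> preserves the inequality.\<close>

lemma cutoff_integral_derivative:
  assumes cut: "cutoff c K \<eta>" and nonneg: "\<And>q. q \<in> topspace X \<Longrightarrow> 0 \<le> \<eta> q" and t: "t \<in> {t0..t1}"
  shows "\<exists>D. ((\<lambda>t. LINT x|lborel. ext0 (chart_img c) (\<lambda>x. sqrt (det (g t c x)) * (\<eta> (chart_inv c x) * perelman_density t (chart_inv c x))) x)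
      has_real_derivative D) (at t within {t0..t1}) \<and>
    (t \<in> {t0<..<t1} \<longrightarrow>
      - (LINT x|lborel. ext0 (chart_img c) (\<lambda>x. sqrt (det (g t c x)) * (\<eta> (chart_inv c x) * laplacian A (g t) (perelman_density t) (chart_inv c x))) x) \<le> D)"
proof -
  have c: "c \<in> A" and K: "compact K" "K \<subseteq> chart_img c" using cut by (simp_all add: cutoff_def)
  interpret R: ricci_flow_on "St c" et "gt c" "ht c" "(1, 0)" "ut c" by (rule ricci_flow_chart[OF c])
  let ?W = "chart_img c"
  note W = img_open[OF c]
  obtain a b where ab: "K \<subseteq> cbox a b" by (rule compact_in_cbox[OF K(1)])
  define E where "E x = \<eta> (chart_inv c x)" for x
  \<comment> \<open>The product of the cutoff with a function on the slab, continued by zero; it is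
    continuous in time and space jointly and vanishes outside a box independent of t.\<close>
  define Z where "Z F t x = ext0 ?W (\<lambda>x. E x * F (t, x)) x" for F and t :: real and x
  have top: "chart_inv c x \<in> topspace X" if "x \<in> ?W" for x using subsetD[OF dom_sub[OF c] inv_dom[OF that]] .
  have E0: "E x = 0" if "x \<in> ?W" "x \<notin> K" for x
    using cut that top[OF that(1)] by (auto simp: cutoff_def E_def)
  have Epos: "0 \<le> E x" if "x \<in> ?W" for x using nonneg[OF top[OF that]] by (simp add: E_def)
  have Ec: "continuous_on ?W E"
    using cut c unfolding E_def[abs_def] cutoff_def by (blast intro: Ck_SucD[of 0, unfolded Ck_on.simps(1)])
  have Zc: "continuous_on ({t0..t1} \<times> UNIV) (\<lambda>(t, x). Z F t x)" if F: "smooth_on (St c) F" for F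
  proof -
    have "continuous_on (St c) (\<lambda>z. E (snd z) * F z)"
      by (intro continuous_on_mult smooth_continuous[OF F] continuous_on_compose2[OF Ec continuous_on_snd]) auto
    from continuous_ext0_param[OF W K this] show ?thesis by (simp add: Z_def E0)
  qed
  have Zt: "continuous_on UNIV (Z F t)" if F: "smooth_on (St c) F" and t: "t \<in> {t0..t1}" for F t
  proof -
    have "continuous_on UNIV (\<lambda>x. (\<lambda>(t, x). Z F t x) (t, x))"
      by (rule continuous_on_compose2[OF Zc[OF F]]) (use t in \<open>auto intro!: continuous_intros\<close>)
    then show ?thesis by simp
  qed
  have Z0: "Z F t x = 0" if "x \<notin> cbox a b" for F t x
    using ab that E0[of x] by (auto simp: Z_def ext0_def)
  have Zi: "Z F t integrable_on cbox a b" if "smooth_on (St c) F" "t \<in> {t0..t1}" for F t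
    by (rule integrable_continuous[OF continuous_on_subset[OF Zt[OF that] subset_UNIV]])
  have ZL: "(LINT x|lborel. Z F t x) = integral (cbox a b) (Z F t)" if "smooth_on (St c) F" "t \<in> {t0..t1}" for F t
    by (rule lborel_integral_cbox(2)[OF Zt[OF that] Z0])
  have vol: "sqrt (det (g t c x)) = R.vol (t, x)" if "t \<in> {t0..t1}" "x \<in> ?W" for t x
    using coord_link.vol_eq[OF link[OF c that(1)] that(2)] .
  define H where "H z = R.perelman z * R.vol z" for z
  have H: "smooth_on (St c) H" unfolding H_def[abs_def] by (intro R.sms R.smooth_perelman)
  define L where "L z = R.vol z * R.lap R.perelman z" for z
  have L: "smooth_on (St c) L" unfolding L_def[abs_def] by (intro R.sms R.smooth_perelman)
  define H' where "H' = dder (St c) (1, 0) H"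
  have H': "smooth_on (St c) H'" unfolding H'_def by (rule smooth_dder[OF H])
  have eqH: "(\<lambda>x. ext0 ?W (\<lambda>x. sqrt (det (g t c x)) * (\<eta> (chart_inv c x) * perelman_density t (chart_inv c x))) x) = Z H t"
    if "t \<in> {t0..t1}" for t
    using that by (auto simp: fun_eq_iff ext0_def Z_def H_def E_def vol perelman_density_chart[OF c])
  have eqL: "(\<lambda>x. ext0 ?W (\<lambda>x. sqrt (det (g t c x)) * (\<eta> (chart_inv c x) * laplacian A (g t) (perelman_density t) (chart_inv c x))) x) = Z L t"
    if s: "t \<in> {t0..t1}" for t
  proof -
    have "laplacian A (g t) (perelman_density t) (chart_inv c x) = R.lap R.perelman (t, x)" if "x \<in> ?W" for x
      by (rule laplacian_chart_t[OF c s that perelman_density_slice[OF _ s] R.smooth_perelman perelman_density_chart[OF c s]])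
    then show ?thesis using s by (auto simp: fun_eq_iff ext0_def Z_def L_def E_def vol)
  qed
  \<comment> \<open>The cutoff is constant in time, so the derivative falls on \<open>H\<close>
    alone; joint continuity of \<open>Z H'\<close> on the compact slab over the box justifies the
    Leibniz rule.\<close>
  have D: "((\<lambda>t. integral (cbox a b) (Z H t)) has_field_derivative integral (cbox a b) (Z H' t)) (at t within {t0..t1})"
  proof (rule leibniz_rule_field_derivative[OF _ Zi[OF H] continuous_on_subset[OF Zc[OF H']] t])
    fix s x assume s: "s \<in> {t0..t1}"
    show "((\<lambda>s. Z H s x) has_real_derivative Z H' s x) (at s within {t0..t1})"
    proof (cases "x \<in> ?W")
      case True
      from DERIV_cmult[OF time_has_derivative[OF lt s W True H]]
      show ?thesis using True by (simp add: Z_def ext0_def H'_def)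
    qed (simp add: Z_def ext0_def)
  qed auto
  show ?thesis
  proof (intro exI conjI impI)
    show "((\<lambda>t. LINT x|lborel. ext0 ?W (\<lambda>x. sqrt (det (g t c x)) * (\<eta> (chart_inv c x) * perelman_density t (chart_inv c x))) x)
      has_real_derivative integral (cbox a b) (Z H' t)) (at t within {t0..t1})"
      by (rule has_field_derivative_transform_within[OF D, of 1]) (use t in \<open>auto simp: eqH ZL[OF H]\<close>)
  next
    assume ti: "t \<in> {t0<..<t1}"
    have "- integral (cbox a b) (Z L t) = integral (cbox a b) (\<lambda>x. - Z L t x)" by simp
    also have "\<dots> \<le> integral (cbox a b) (Z H' t)"
    proof (rule integral_le[OF integrable_neg[OF Zi[OF L t]] Zi[OF H' t]])
      show "- Z L t x \<le> Z H' t x" for x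
      proof (cases "x \<in> ?W")
        case True
        have "(t, x) \<in> interior (St c)" using ti True W by (simp add: interior_Times interior_open)
        from R.perelman_inequality[OF this] have "- L (t, x) \<le> H' (t, x)"
          by (simp add: L_def H'_def H_def[abs_def])
        then have "E x * - L (t, x) \<le> E x * H' (t, x)" by (rule mult_left_mono[OF _ Epos[OF True]])
        then show ?thesis using True by (simp add: Z_def ext0_def)
      qed (simp add: Z_def ext0_def)
    qed
    finally show "- (LINT x|lborel. ext0 ?W (\<lambda>x. sqrt (det (g t c x)) * (\<eta> (chart_inv c x) * laplacian A (g t) (perelman_density t) (chart_inv c x))) x)
        \<le> integral (cbox a b) (Z H' t)"
      by (simp add: eqL[OF t] ZL[OF L t])
  qed
qed

section \<open>Summation over the partition of unity\<close>

context
  fixes P :: "'a set" and c K \<eta>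
  assumes P: "finite P" and cut: "\<And>p. p \<in> P \<Longrightarrow> cutoff (c p) (K p) (\<eta> p)"
    and sum1: "\<And>q. q \<in> topspace X \<Longrightarrow> (\<Sum>p\<in>P. \<eta> p q) = 1"
    and nonneg: "\<And>p q. p \<in> P \<Longrightarrow> q \<in> topspace X \<Longrightarrow> 0 \<le> \<eta> p q"
begin

lemma F_functional_eq:
  assumes t: "t \<in> {t0..t1}"
  shows "F_functional X A (g t) (\<rho> t) = (\<Sum>p\<in>P. LINT x|lborel.
    ext0 (chart_img (c p)) (\<lambda>x. sqrt (det (g t (c p) x)) * (\<eta> p (chart_inv (c p) x) * perelman_density t (chart_inv (c p) x))) x)"
    and "(\<Sum>p\<in>P. LINT x|lborel. ext0 (chart_img (c p))
      (\<lambda>x. sqrt (det (g t (c p) x)) * (\<eta> p (chart_inv (c p) x) * laplacian A (g t) (perelman_density t) (chart_inv (c p) x))) x) = 0"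
proof -
  interpret N: riemannian_mfd X A "g t" by (rule metric_t[OF t])
  have pi: "integral\<^sup>L N.vol_measure f = (\<Sum>p\<in>P. LINT x|lborel. ext0 (chart_img (c p))
      (\<lambda>x. sqrt (det (g t (c p) x)) * (\<eta> p (chart_inv (c p) x) * f (chart_inv (c p) x))) x)"
    "integrable N.vol_measure f"
    if "\<And>d. d \<in> A \<Longrightarrow> continuous_on (chart_img d) (\<lambda>x. f (chart_inv d x))" for f
    using N.partition_integral[OF P cut sum1 that] by (simp_all add: N.dens_def)
  note Vs = perelman_density_slice[OF _ t] and Rs = \<rho>_slice[OF t]
  have "F_functional X A (g t) (\<rho> t) = (\<integral>q. perelman_density t q + 2 * laplacian A (g t) (\<rho> t) q \<partial>N.vol_measure)"
    unfolding F_functional_def N.vol_measure_def[symmetric]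
  proof (rule Bochner_Integration.integral_cong[OF refl])
    fix q assume "q \<in> space N.vol_measure"
    then have q: "q \<in> topspace X" by simp
    note d = N.chart_at[OF q]
    show "(grad_norm_sq A (g t) (\<lambda>q. ln (\<rho> t q)) q + scalar_curvature A (g t) q) * \<rho> t q = perelman_density t q + 2 * laplacian A (g t) (\<rho> t) q"
      using integrand_chart[OF d(1) t map_img[OF d(2)]] by (simp add: inv_map[OF d])
  qed
  also have "\<dots> = integral\<^sup>L N.vol_measure (perelman_density t) + 2 * integral\<^sup>L N.vol_measure (laplacian A (g t) (\<rho> t))"
    using pi(2)[OF smooth_continuous[OF Vs]] pi(2)[OF N.laplacian_continuous[OF Rs]] by simp
  also have "integral\<^sup>L N.vol_measure (laplacian A (g t) (\<rho> t)) = 0"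
    by (rule N.integral_laplacian[OF P cut sum1 Rs])
  finally show "F_functional X A (g t) (\<rho> t) = (\<Sum>p\<in>P. LINT x|lborel.
    ext0 (chart_img (c p)) (\<lambda>x. sqrt (det (g t (c p) x)) * (\<eta> p (chart_inv (c p) x) * perelman_density t (chart_inv (c p) x))) x)"
    using pi(1)[OF smooth_continuous[OF Vs]] by simp
  show "(\<Sum>p\<in>P. LINT x|lborel. ext0 (chart_img (c p))
      (\<lambda>x. sqrt (det (g t (c p) x)) * (\<eta> p (chart_inv (c p) x) * laplacian A (g t) (perelman_density t) (chart_inv (c p) x))) x) = 0"
    using pi(1)[OF N.laplacian_continuous[OF Vs]] N.integral_laplacian[OF P cut sum1 Vs] by simp
qed

text \<open>The lower bounds of the single charts add up to minus the integral of the Laplacian of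
  \<open>perelman_density t\<close>, which is zero. The bound need not be nonnegative chart by
  chart; only the sum is.\<close>

lemma F_functional_derivative:
  assumes t: "t \<in> {t0..t1}"
  shows "\<exists>D. ((\<lambda>t. F_functional X A (g t) (\<rho> t)) has_real_derivative D) (at t within {t0..t1}) \<and> (t \<in> {t0<..<t1} \<longrightarrow> 0 \<le> D)"
proof -
  let ?I = "\<lambda>p t. LINT x|lborel. ext0 (chart_img (c p)) (\<lambda>x. sqrt (det (g t (c p) x)) * (\<eta> p (chart_inv (c p) x) * perelman_density t (chart_inv (c p) x))) x"
  let ?L = "\<lambda>p. LINT x|lborel. ext0 (chart_img (c p)) (\<lambda>x. sqrt (det (g t (c p) x)) * (\<eta> p (chart_inv (c p) x) * laplacian A (g t) (perelman_density t) (chart_inv (c p) x))) x"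
  have "\<forall>p\<in>P. \<exists>D. (?I p has_real_derivative D) (at t within {t0..t1}) \<and> (t \<in> {t0<..<t1} \<longrightarrow> - ?L p \<le> D)"
    using cutoff_integral_derivative[OF cut nonneg t] by blast
  from bchoice[OF this] obtain D where D: "\<And>p. p \<in> P \<Longrightarrow> (?I p has_real_derivative D p) (at t within {t0..t1})"
    "\<And>p. p \<in> P \<Longrightarrow> t \<in> {t0<..<t1} \<Longrightarrow> - ?L p \<le> D p" by blast
  have "((\<lambda>t. \<Sum>p\<in>P. ?I p t) has_real_derivative (\<Sum>p\<in>P. D p)) (at t within {t0..t1})"
    by (rule DERIV_sum[OF D(1)])
  then have "((\<lambda>t. F_functional X A (g t) (\<rho> t)) has_real_derivative (\<Sum>p\<in>P. D p)) (at t within {t0..t1})"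
    by (rule has_field_derivative_transform_within[of _ _ _ _ 1]) (use t F_functional_eq(1) in auto)
  moreover have "0 \<le> (\<Sum>p\<in>P. D p)" if "t \<in> {t0<..<t1}"
  proof -
    have "0 = (\<Sum>p\<in>P. - ?L p)" using F_functional_eq(2)[OF t] by (simp add: sum_negf)
    also have "\<dots> \<le> (\<Sum>p\<in>P. D p)" by (rule sum_mono[OF D(2)[OF _ that]])
    finally show ?thesis .
  qed
  ultimately show ?thesis by blast
qed

end

theorem F_functional_mono: "mono_on {t0..t1} (\<lambda>t. F_functional X A (g t) (\<rho> t))"
proof -
  let ?F = "\<lambda>t. F_functional X A (g t) (\<rho> t)"
  have D: "\<exists>D. (?F has_real_derivative D) (at t within {t0..t1}) \<and> (t \<in> {t0<..<t1} \<longrightarrow> 0 \<le> D)" if t: "t \<in> {t0..t1}" for t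
  proof (rule partition_of_unity)
    fix P :: "'a set" and c K \<eta> assume "finite P" "\<And>p. p \<in> P \<Longrightarrow> cutoff (c p) (K p) (\<eta> p)"
      "\<And>p q. p \<in> P \<Longrightarrow> q \<in> topspace X \<Longrightarrow> 0 \<le> \<eta> p q" "\<And>q. q \<in> topspace X \<Longrightarrow> (\<Sum>p\<in>P. \<eta> p q) = 1"
    from F_functional_derivative[OF this(1,2,4,3) t] show ?thesis .
  qed
  show ?thesis
  proof (rule mono_onI)
    fix r s assume rs: "r \<in> {t0..t1}" "s \<in> {t0..t1}" "r \<le> s"
    show "?F r \<le> ?F s"
    proof (rule DERIV_nonneg_imp_increasing_open[OF rs(3)])
      fix t assume "r < t" "t < s"
      then have t: "t \<in> {t0..t1}" "t \<in> {t0<..<t1}" using rs by auto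
      moreover have "at t within {t0..t1} = at t" using t(2) by (intro at_within_interior) simp
      ultimately show "\<exists>D. (?F has_real_derivative D) (at t) \<and> 0 \<le> D" using D[OF t(1)] by auto
    next
      \<comment> \<open>The sign of the derivative is known inside the interval, and the one-sided
        derivatives at t0 and t1 provide continuity up to the ends.\<close>
      have "continuous_on {t0..t1} ?F"
        unfolding continuous_on_eq_continuous_within using D DERIV_continuous by blast
      then show "continuous_on {r..s} ?F" by (rule continuous_on_subset) (use rs in auto)
    qed
  qed
qed

end

theorem corollary6:
  fixes X :: "'a topology"
    and A :: "('a, 'n::finite) chart set"
    and g :: "real \<Rightarrow> ('a, 'n) tensor2"
    and \<alpha> :: "real \<Rightarrow> 'a measure"
    and \<rho> :: "real \<Rightarrow> 'a \<Rightarrow> real"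
    and t0 t1 :: real
  assumes "closed_manifold X A"
    and "connected_space X"
    and "ricci_flow A t0 t1 g"
    and "\<And>t. t \<in> {t0..t1} \<Longrightarrow> \<alpha> t \<in> P_infty X A"
    and "\<And>t. t \<in> {t0..t1} \<Longrightarrow>
           \<alpha> t = density (riemannian_volume X A (g t)) (\<lambda>p. ennreal (\<rho> t p))"
    and "\<And>t p. t \<in> {t0..t1} \<Longrightarrow> p \<in> topspace X \<Longrightarrow> 0 < \<rho> t p"
    and "backward_heat_flow A t0 t1 g \<rho>"
  shows "mono_on {t0..t1} (\<lambda>t. F_functional X A (g t) (\<rho> t))"
proof (cases "t0 < t1")
  case True
  interpret conjugate_heat_flow X A g \<rho> t0 t1
    using assms True by unfold_locales
  show ?thesis by (rule F_functional_mono)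
next
  \<comment> \<open>The interval has at most one point.\<close>
  case False
  show ?thesis
  proof (rule mono_onI)
    fix r s assume "r \<in> {t0..t1}" "s \<in> {t0..t1}" "r \<le> s"
    then have "r = s" using False by simp
    then show "F_functional X A (g r) (\<rho> r) \<le> F_functional X A (g s) (\<rho> s)" by simp
  qed
qed

end
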